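(* Let $m,n,\ell$ be non-negative integers, let $\mathfrak{b}$ be a parity sequence with $m$ entries $\delta$ and $n$ entries $\epsilon$, and let $\pi$ be the associated colored rectangle, $\mathcal{W}_\pi$ the associated finite $W$-superalgebra (with its Kazhdan filtration) and $Y_{m|n}^{\ell}$ the truncated super Yangian of level $\ell$ (with its canonical filtration), all as described in the context. Then there is an isomorphism of filtered superalgebras $Y_{m|n}^{\ell}\cong \mathcal{W}_\pi$ which, for all $1\le i,j\le m+n$ and $1\le r\le \ell$, sends the image $t^{(r)}_{ij;\mathfrak{b}}\in Y^\ell_{m|n}$ of the generator $t^{(r)}_{ij}$ to the element $t^{(r)}_{ij;\mathfrak{b}}\in U(\mathfrak{p})$ defined in the context (in particular these elements lie in $\mathcal{W}_\pi$).
   Context: Parity sequence: $\mathfrak{b}=(\mathfrak{b}_1,\dots,\mathfrak{b}_{m+n})$ with $m$ entries equal to $\delta$ and $n$ equal to $\epsilon$; for $1\le i\le m+n$ put $|i|=\bar 0$ if $\mathfrak{b}_i=\delta$ and $|i|=\bar 1$ if $\mathfrak{b}_i=\epsilon$. Super Yangian: $Y_{m|n}$ is the associative superalgebra over $\mathbb{C}$ with generators $t^{(r)}_{ij}$ ($1\le i,j\le m+n$, $r\ge 1$), $t^{(r)}_{ij}$ of parity $|i|+|j|$, subject to $[t_{ij}^{(r)}, t_{hk}^{(s)}] = (-1)^{|i||j| + |i||h| + |j||h|}\sum_{t=0}^{\min(r,s) -1} ( t_{hj}^{(t)} t_{ik}^{(r+s-1-t)} - t_{hj}^{(r+s-1-t)}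 t_{ik}^{(t)} )$, where $t^{(0)}_{ij}:=\delta_{ij}$ and $[x,y]=xy-(-1)^{|x||y|}yx$ is the supercommutator. Its canonical filtration has $F_dY_{m|n}$ spanned by supermonomials in the generators of total degree $\le d$, where $\deg t^{(r)}_{ij}=r$. The truncated super Yangian $Y^\ell_{m|n}$ is the quotient of $Y_{m|n}$ by the two-sided ideal generated by all $t^{(r)}_{ij}$ with $r>\ell$, with the induced filtration; $t^{(r)}_{ij;\mathfrak{b}}$ denotes the image of $t^{(r)}_{ij}$. Rectangle: $\pi$ is a rectangular array of boxes with $m+n$ rows numbered $1,\dots,m+n$ from top to bottom and $\ell$ columns numbered $1,\dots,\ell$ from left to right; row $i$ has parity $|i|$. For a box $a$ write $\mathrm{row}(a)$, $\mathrm{col}(a)$, and $|a|:=|\mathrm{row}(a)|$. Put $M=m\ell$, $N=n\ell$, and let $V=\mathbb{C}^{M|N}$ have homogeneous basis $\{v_a\}$ indexed by the boxes of $\pi$, $v_a$ of parity $|a|$. Let $\mathfrak{g}=\mathfrak{gl}_{M|N}=\mathrm{End}(V)$ with matrix units $e_{a,b}$ (parity $|a|+|b|$). $W$-superalgebra: let $e=\sum e_{a,b}$, summed over pairs of boxes $a,b$ in the same row with $\mathrm{col}(b)=\mathrm{col}(a)+1$, and $\chi(y)=\mathrm{str}(ye)$ for $y\in\mathfrak{g}$ (str = supertrace). Let $\mathfrak{p}=\mathrm{span}\{e_{a,b}:\mathrm{col}(a)\le \mathrm{col}(b)\}$, $\mathfrak{m}=\mathrm{span}\{e_{a,b}:\mathrm{col}(a)>\mathrm{col}(b)\}$,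 $I_\chi$ the left ideal of $U(\mathfrak{g})$ generated by $\{y-\chi(y):y\in\mathfrak{m}\}$, so $U(\mathfrak{g})=U(\mathfrak{p})\oplus I_\chi$; let $\mathrm{pr}_\chi:U(\mathfrak{g})\to U(\mathfrak{p})$ be the projection. Then $\mathcal{W}_\pi=\{y\in U(\mathfrak{p}):\mathrm{pr}_\chi([x,y])=0\ \forall x\in\mathfrak{m}\}$. Kazhdan filtration: $\deg e_{a,b}=\mathrm{col}(b)-\mathrm{col}(a)+1$, $F_dU(\mathfrak{g})$ is spanned by supermonomials $e_{a_1,b_1}\cdots e_{a_s,b_s}$ of total degree $\le d$, and $F_d\mathcal{W}_\pi=\mathcal{W}_\pi\cap F_dU(\mathfrak{g})$. Elements: for $1\le c\le\ell$ put $\rho_c=-(\ell-c)(m-n)$; for boxes $a,b$ put $\tilde e_{a,b}=(-1)^{\mathrm{col}(b)-\mathrm{col}(a)}(e_{a,b}+\delta_{ab}(-1)^{|a|}\rho_{\mathrm{col}(a)})$. For $1\le i,j\le m+n$ and $1\le r\le\ell$ define $t^{(r)}_{ij;\mathfrak{b}}=\sum_{s=1}^r\sum (-1)^{|a_1|+\cdots+|a_s|}\tilde e_{a_1,b_1}\cdots\tilde e_{a_s,b_s}\in U(\mathfrak{p})$, the inner sum over boxes $a_1,\dots,a_s,b_1,\dots,b_s$ with: $\sum_t(\mathrm{col}(b_t)-\mathrm{col}(a_t)+1)=r$; $\mathrm{col}(a_t)\le\mathrm{col}(b_t)$ for all $t$; $\mathrm{col}(b_t)<\mathrm{col}(a_{t+1})$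 and $\mathrm{row}(b_t)=\mathrm{row}(a_{t+1})$ for $1\le t\le s-1$; $\mathrm{row}(a_1)=i$, $\mathrm{row}(b_s)=j$. *)

theory Defs
  imports Complex_Main
begin

text \<open>An element of the free associative algebra on letters of type 'x is a finitely
supported function from words to coefficients; we work with all functions and
restrict to finitely supported ones via fspan.\<close>

type_synonym 'x fa = "'x list \<Rightarrow> complex"

definition fzero :: "'x fa" where "fzero = (\<lambda>w. 0)"
definition fone :: "'x fa" where "fone = (\<lambda>w. if w = [] then 1 else 0)"
definition fadd :: "'x fa \<Rightarrow> 'x fa \<Rightarrow> 'x fa" where "fadd f g = (\<lambda>w. f w + g w)"
definition fsub :: "'x fa \<Rightarrow> 'x fa \<Rightarrow> 'x fa" where "fsub f g = (\<lambda>w. f w - g w)"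
definition fsmul :: "complex \<Rightarrow> 'x fa \<Rightarrow> 'x fa" where "fsmul c f = (\<lambda>w. c * f w)"
definition fmul :: "'x fa \<Rightarrow> 'x fa \<Rightarrow> 'x fa" where
  "fmul f g = (\<lambda>w. \<Sum>k\<le>length w. f (take k w) * g (drop k w))"
definition fmono :: "'x list \<Rightarrow> 'x fa" where "fmono u = (\<lambda>w. if w = u then 1 else 0)"
definition fgen :: "'x \<Rightarrow> 'x fa" where "fgen x = fmono [x]"
definition fprod :: "'x fa list \<Rightarrow> 'x fa" where "fprod fs = foldr fmul fs fone"
definition fsum :: "('i \<Rightarrow> 'x fa) \<Rightarrow> 'i set \<Rightarrow> 'x fa" where
  "fsum F I = (\<lambda>w. \<Sum>i\<in>I. F i w)"

definition fspan :: "'x list set \<Rightarrow> 'x fa set" where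
  "fspan S = {f. finite {w. f w \<noteq> 0} \<and> (\<forall>w. f w \<noteq> 0 \<longrightarrow> w \<in> S)}"

definition hom_ext :: "('x \<Rightarrow> 'y fa) \<Rightarrow> 'x fa \<Rightarrow> 'y fa" where
  "hom_ext \<sigma> f = fsum (\<lambda>w. fsmul (f w) (fprod (map \<sigma> w))) {w. f w \<noteq> 0}"

inductive_set two_ideal :: "'x fa set \<Rightarrow> 'x fa set" for G where
  gen: "g \<in> G \<Longrightarrow> fmul (fmul (fmono u) g) (fmono v) \<in> two_ideal G"
| zero: "fzero \<in> two_ideal G"
| add: "\<lbrakk>a \<in> two_ideal G; b \<in> two_ideal G\<rbrakk> \<Longrightarrow> fadd a b \<in> two_ideal G"
| smul: "a \<in> two_ideal G \<Longrightarrow> fsmul c a \<in> two_ideal G"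

inductive_set left_ideal :: "'x fa set \<Rightarrow> 'x fa set" for G where
  gen: "g \<in> G \<Longrightarrow> fmul (fmono u) g \<in> left_ideal G"
| zero: "fzero \<in> left_ideal G"
| add: "\<lbrakk>a \<in> left_ideal G; b \<in> left_ideal G\<rbrakk> \<Longrightarrow> fadd a b \<in> left_ideal G"
| smul: "a \<in> left_ideal G \<Longrightarrow> fsmul c a \<in> left_ideal G"

text \<open>Super structure: parity of letters (True = odd), of words, homogeneous parts and
the (bilinearly extended) supercommutator.\<close>
definition wpar :: "('x \<Rightarrow> bool) \<Rightarrow> 'x list \<Rightarrow> bool" where
  "wpar par w = foldr (\<lambda>x acc. par x \<noteq> acc) w False"

definition hpart :: "('x \<Rightarrow> bool) \<Rightarrow> bool \<Rightarrow> 'x fa \<Rightarrow> 'x fa" where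
  "hpart par p f = (\<lambda>w. if wpar par w = p then f w else 0)"

definition sgn :: "bool \<Rightarrow> complex" where "sgn b = (if b then -1 else 1)"

definition scomm :: "('x \<Rightarrow> bool) \<Rightarrow> 'x fa \<Rightarrow> 'x fa \<Rightarrow> 'x fa" where
  "scomm par f g = fsum (\<lambda>(p, q). fsub (fmul (hpart par p f) (hpart par q g))
        (fsmul (sgn (p \<and> q)) (fmul (hpart par q g) (hpart par p f)))) UNIV"

datatype pty = Delta | Eps

text \<open>Parity of row / index i (1-based); True means odd.\<close>
definition ipar :: "pty list \<Rightarrow> nat \<Rightarrow> bool" where
  "ipar bs i = (bs ! (i - 1) = Eps)"

type_synonym box = "nat \<times> nat"  \<comment> \<open>(row, column)\<close>

definition boxes :: "nat \<Rightarrow> nat \<Rightarrow> box set" where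
  "boxes k l = {1..k} \<times> {1..l}"

definition bpar :: "pty list \<Rightarrow> box \<Rightarrow> bool" where
  "bpar bs a = ipar bs (fst a)"

section \<open>U(gl(M|N)) as a quotient of the free algebra on matrix units\<close>

definition Egens :: "nat \<Rightarrow> nat \<Rightarrow> (box \<times> box) set" where
  "Egens k l = boxes k l \<times> boxes k l"

definition epar :: "pty list \<Rightarrow> box \<times> box \<Rightarrow> bool" where
  "epar bs g = (bpar bs (fst g) \<noteq> bpar bs (snd g))"

definition U_rel :: "pty list \<Rightarrow> box \<times> box \<Rightarrow> box \<times> box \<Rightarrow> (box \<times> box) fa" where
  "U_rel bs x y = (case x of (a, b) \<Rightarrow> case y of (c, d) \<Rightarrow>
     fsub (fsub (fmul (fgen (a, b)) (fgen (c, d)))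
                (fsmul (sgn (epar bs (a, b) \<and> epar bs (c, d))) (fmul (fgen (c, d)) (fgen (a, b)))))
          (fsub (if b = c then fgen (a, d) else fzero)
                (fsmul (sgn (epar bs (a, b) \<and> epar bs (c, d))) (if d = a then fgen (c, b) else fzero))))"

definition IU :: "pty list \<Rightarrow> nat \<Rightarrow> nat \<Rightarrow> (box \<times> box) fa set" where
  "IU bs k l = two_ideal {U_rel bs x y | x y. x \<in> Egens k l \<and> y \<in> Egens k l}"

text \<open>Representatives of elements of U(g).\<close>
definition Ucar :: "nat \<Rightarrow> nat \<Rightarrow> (box \<times> box) fa set" where
  "Ucar k l = fspan {w. set w \<subseteq> Egens k l}"

definition Pgens :: "nat \<Rightarrow> nat \<Rightarrow> (box \<times> box) set" where
  "Pgens k l = {g \<in> Egens k l. snd (fst g) \<le> snd (snd g)}"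

definition Mgens :: "nat \<Rightarrow> nat \<Rightarrow> (box \<times> box) set" where
  "Mgens k l = {g \<in> Egens k l. snd (fst g) > snd (snd g)}"

definition in_Up :: "pty list \<Rightarrow> nat \<Rightarrow> nat \<Rightarrow> (box \<times> box) fa \<Rightarrow> bool" where
  "in_Up bs k l y \<longleftrightarrow> y \<in> Ucar k l \<and>
     (\<exists>u \<in> fspan {w. set w \<subseteq> Pgens k l}. fsub y u \<in> IU bs k l)"

definition unit_mat :: "box \<times> box \<Rightarrow> (box \<times> box \<Rightarrow> complex)" where
  "unit_mat g = (\<lambda>x. if x = g then 1 else 0)"

definition e_mat :: "nat \<Rightarrow> nat \<Rightarrow> (box \<times> box \<Rightarrow> complex)" where
  "e_mat k l = (\<lambda>(c, d). if c \<in> boxes k l \<and> d \<in> boxes k l \<and> fst c = fst d \<and> snd d = snd c + 1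
                        then 1 else 0)"

definition matmul :: "box set \<Rightarrow> (box \<times> box \<Rightarrow> complex) \<Rightarrow> (box \<times> box \<Rightarrow> complex) \<Rightarrow> (box \<times> box \<Rightarrow> complex)" where
  "matmul B X Y = (\<lambda>(a, c). \<Sum>b\<in>B. X (a, b) * Y (b, c))"

definition str :: "pty list \<Rightarrow> box set \<Rightarrow> (box \<times> box \<Rightarrow> complex) \<Rightarrow> complex" where
  "str bs B X = (\<Sum>a\<in>B. sgn (bpar bs a) * X (a, a))"

definition chi :: "pty list \<Rightarrow> nat \<Rightarrow> nat \<Rightarrow> box \<times> box \<Rightarrow> complex" where
  "chi bs k l g = str bs (boxes k l) (matmul (boxes k l) (unit_mat g) (e_mat k l))"

text \<open>The left ideal I_chi, lifted to the free algebra (it contains the defining ideal of U(g)).\<close>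
definition Ichi :: "pty list \<Rightarrow> nat \<Rightarrow> nat \<Rightarrow> (box \<times> box) fa set" where
  "Ichi bs k l = left_ideal (IU bs k l \<union>
     {fsub (fgen g) (fsmul (chi bs k l g) fone) | g. g \<in> Mgens k l})"

definition mspan :: "nat \<Rightarrow> nat \<Rightarrow> (box \<times> box) fa set" where
  "mspan k l = fspan {[g] | g. g \<in> Mgens k l}"

text \<open>The W-superalgebra: y in U(p) with pr_chi([x,y]) = 0, i.e. [x,y] in I_chi, for all x in m.\<close>
definition Wset :: "pty list \<Rightarrow> nat \<Rightarrow> nat \<Rightarrow> (box \<times> box) fa set" where
  "Wset bs k l = {y. in_Up bs k l y \<and> (\<forall>x \<in> mspan k l. scomm (epar bs) x y \<in> Ichi bs k l)}"

definition kdeg :: "box \<times> box \<Rightarrow> int" where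
  "kdeg g = int (snd (snd g)) - int (snd (fst g)) + 1"

definition FU :: "pty list \<Rightarrow> nat \<Rightarrow> nat \<Rightarrow> nat \<Rightarrow> (box \<times> box) fa set" where
  "FU bs k l d = {z \<in> Ucar k l. \<exists>u \<in> fspan {w. set w \<subseteq> Egens k l \<and> sum_list (map kdeg w) \<le> int d}.
                      fsub z u \<in> IU bs k l}"

type_synonym tgen = "nat \<times> nat \<times> nat"  \<comment> \<open>(i, j, r) stands for t_ij^(r)\<close>

definition Tgens :: "nat \<Rightarrow> tgen set" where
  "Tgens k = {(i, j, r). i \<in> {1..k} \<and> j \<in> {1..k} \<and> 1 \<le> r}"

definition tpar :: "pty list \<Rightarrow> tgen \<Rightarrow> bool" where
  "tpar bs g = (case g of (i, j, r) \<Rightarrow> ipar bs i \<noteq> ipar bs j)"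

definition tY :: "nat \<Rightarrow> nat \<Rightarrow> nat \<Rightarrow> tgen fa" where
  "tY i j r = (if r = 0 then (if i = j then fone else fzero) else fgen (i, j, r))"

definition Y_rel :: "pty list \<Rightarrow> tgen \<Rightarrow> tgen \<Rightarrow> tgen fa" where
  "Y_rel bs x y = (case x of (i, j, r) \<Rightarrow> case y of (h, k, s) \<Rightarrow>
     fsub (fsub (fmul (tY i j r) (tY h k s))
                (fsmul (sgn (tpar bs (i, j, r) \<and> tpar bs (h, k, s))) (fmul (tY h k s) (tY i j r))))
          (fsmul (sgn (((ipar bs i \<and> ipar bs j) \<noteq> (ipar bs i \<and> ipar bs h)) \<noteq> (ipar bs j \<and> ipar bs h)))
             (fsum (\<lambda>t. fsub (fmul (tY h j t) (tY i k (r + s - 1 - t)))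
                             (fmul (tY h j (r + s - 1 - t)) (tY i k t))) {0..<min r s})))"

definition Jideal :: "pty list \<Rightarrow> nat \<Rightarrow> nat \<Rightarrow> tgen fa set" where
  "Jideal bs k l = two_ideal ({Y_rel bs x y | x y. x \<in> Tgens k \<and> y \<in> Tgens k} \<union>
                              {fgen g | g. g \<in> Tgens k \<and> snd (snd g) > l})"

definition Ycar :: "nat \<Rightarrow> tgen fa set" where
  "Ycar k = fspan {w. set w \<subseteq> Tgens k}"

definition FY :: "nat \<Rightarrow> nat \<Rightarrow> tgen fa set" where
  "FY k d = fspan {w. set w \<subseteq> Tgens k \<and> sum_list (map (\<lambda>g. snd (snd g)) w) \<le> d}"

definition rho :: "nat \<Rightarrow> nat \<Rightarrow> nat \<Rightarrow> nat \<Rightarrow> complex" where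
  "rho m n l c = - of_int ((int l - int c) * (int m - int n))"

definition tilde_e :: "pty list \<Rightarrow> nat \<Rightarrow> nat \<Rightarrow> nat \<Rightarrow> box \<Rightarrow> box \<Rightarrow> (box \<times> box) fa" where
  "tilde_e bs m n l a b = fsmul (sgn (odd (int (snd b) - int (snd a))))
     (fadd (fgen (a, b)) (if a = b then fsmul (sgn (bpar bs a) * rho m n l (snd a)) fone else fzero))"

definition tseqs :: "nat \<Rightarrow> nat \<Rightarrow> nat \<Rightarrow> nat \<Rightarrow> nat \<Rightarrow> (box \<times> box) list set" where
  "tseqs k l i j r = {ps. 1 \<le> length ps \<and> length ps \<le> r \<and> set ps \<subseteq> Egens k l
      \<and> (\<forall>g \<in> set ps. snd (fst g) \<le> snd (snd g))
      \<and> sum_list (map (\<lambda>g. snd (snd g) - snd (fst g) + 1) ps) = r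
      \<and> (\<forall>t. t + 1 < length ps \<longrightarrow> snd (snd (ps ! t)) < snd (fst (ps ! (t + 1)))
                                   \<and> fst (snd (ps ! t)) = fst (fst (ps ! (t + 1))))
      \<and> fst (fst (hd ps)) = i \<and> fst (snd (last ps)) = j}"

definition t_elem :: "pty list \<Rightarrow> nat \<Rightarrow> nat \<Rightarrow> nat \<Rightarrow> nat \<Rightarrow> nat \<Rightarrow> nat \<Rightarrow> (box \<times> box) fa" where
  "t_elem bs m n l i j r = fsum (\<lambda>ps. fsmul (sgn (wpar (\<lambda>g. bpar bs (fst g)) ps))
        (fprod (map (\<lambda>g. tilde_e bs m n l (fst g) (snd g)) ps))) (tseqs (m + n) l i j r)"

definition sigma :: "pty list \<Rightarrow> nat \<Rightarrow> nat \<Rightarrow> nat \<Rightarrow> tgen \<Rightarrow> (box \<times> box) fa" where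
  "sigma bs m n l g = (case g of (i, j, r) \<Rightarrow> if r \<le> l then t_elem bs m n l i j r else fzero)"

end

theory Submission
  imports Defs "HOL-Library.Poly_Mapping" "HOL-Library.Multiset" "HOL-Library.Product_Lexorder"
begin

text \<open>The enveloping algebra \<open>U(\<gg>)\<close> acts on the super-polynomial (Fock) space in variables
  \<open>x\<^sub>a\<^sub>b\<close>, one for each matrix unit, by \<open>e\<^sub>a\<^sub>b \<mapsto> x\<^sub>a\<^sub>b + \<Sum>\<^sub>c x\<^sub>a\<^sub>c \<partial>\<^sub>b\<^sub>c\<close>. Applied to the vacuum a sorted
  word gives its own monomial up to sign and terms of lower Kazhdan degree; this is the PBW theorem, and
  it identifies \<open>U(\<gg>)\<close> with the Fock space. The left ideal \<open>I\<^sub>\<chi>\<close> and the condition defining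
  \<open>W\<^sub>\<pi>\<close> become linear conditions on vectors there.

  The elements \<open>t\<close> are handled through partial sums over chains of boxes that start in column \<open>\<ge> p\<close>.
  Induction on \<open>p\<close> computes how the simple lowering elements \<open>e - \<chi>(e)\<close> act on them modulo \<open>I\<^sub>\<chi>\<close>,
  and shows that every \<open>t\<close> preserves Whittaker vectors; the shifts \<open>\<rho>\<^sub>c\<close> are what makes the contributions of
  two neighbouring columns cancel.

  The parabolic \<open>\<pp>\<close> also acts on the polynomials in the variables whose first box lies in column 1.
  An element of \<open>U(\<pp>)\<close> that is Whittaker and kills the vacuum of this module vanishes: its top Kazhdan
  symbol is invariant under the lowering elements modulo \<open>\<chi>\<close> and has no term purely in column 1
  variables, and looking at terms with the fewest other variables shows that it is zero. Hence all
  identities between the \<open>t\<close> may be checked on the small module. There the products \<open>t t' vac\<close> are explicit and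
  give the Yangian relations, while sorted words in the \<open>t\<close> have the monomials as leading terms, which yields
  both injectivity (the truncated Yangian is spanned by the sorted words) and surjectivity with the right
  filtration degree.\<close>

section \<open>Linear operators and the Weyl--Clifford relations\<close>

text \<open>The action on the Fock space is the one attached to any associative product: with
  \<open>x\<close> multiplication by a variable and \<open>L\<close> the derivation extending left
  multiplication, the mixed commutators of \<open>x\<close> and \<open>L\<close> already give the
  Lie bracket, so \<open>x + L\<close> is a representation. Right multiplication gives a second
  action, supercommuting with the first and equal to it on the vacuum; the difference of the two is
  the adjoint action, and this is how the Whittaker condition reaches symbols. Equality in
  \<open>U(\<gg>)\<close> thus becomes equality of single vectors, and for Whittaker elements the
  vacuum of the small module is still enough. A Yangian relation is therefore checked on one vector,
  but only after products of the elements \<open>t\<close> are known to be Whittaker; hence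
  invariance is proved on an arbitrary Whittaker vector, and products follow by induction on words.
  The obstacle is cancellation: the top symbol of a sum in the left ideal need not come from the top
  symbols of its terms. What helps is that \<chi> is nonzero only on letters of Kazhdan degree 0,
  while letters of \<pp> have positive degree.\<close>

abbreviation lookup :: "('m \<Rightarrow>\<^sub>0 complex) \<Rightarrow> 'm \<Rightarrow> complex" where "lookup \<equiv> Poly_Mapping.lookup"
abbreviation keys :: "('m \<Rightarrow>\<^sub>0 complex) \<Rightarrow> 'm set" where "keys \<equiv> Poly_Mapping.keys"
abbreviation single :: "'m \<Rightarrow> complex \<Rightarrow> ('m \<Rightarrow>\<^sub>0 complex)" where "single \<equiv> Poly_Mapping.single"

definition scl :: "complex \<Rightarrow> ('m \<Rightarrow>\<^sub>0 complex) \<Rightarrow> ('m \<Rightarrow>\<^sub>0 complex)" where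
  "scl c v = Poly_Mapping.map ((*) c) v"

lemma lookup_scl [simp]: "lookup (scl c v) \<alpha> = c * lookup v \<alpha>"
  by (simp add: scl_def Poly_Mapping.map.rep_eq when_def)

lemma scl_single [simp]: "scl c (single \<alpha> b) = single \<alpha> (c * b)"
  by (rule poly_mapping_eqI) (simp add: lookup_single when_def)

interpretation cvs: vector_space scl
  by unfold_locales (rule poly_mapping_eqI; simp add: lookup_add algebra_simps)+

definition lin :: "('m \<Rightarrow> ('m \<Rightarrow>\<^sub>0 complex)) \<Rightarrow> ('m \<Rightarrow>\<^sub>0 complex) \<Rightarrow> ('m \<Rightarrow>\<^sub>0 complex)" where
  "lin F v = (\<Sum>\<alpha>\<in>keys v. scl (lookup v \<alpha>) (F \<alpha>))"

lemma lin_superset: "finite A \<Longrightarrow> keys v \<subseteq> A \<Longrightarrow> lin F v = (\<Sum>\<alpha>\<in>A. scl (lookup v \<alpha>) (F \<alpha>))"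
  unfolding lin_def by (rule sum.mono_neutral_left) (auto simp: in_keys_iff)

lemma lin_add: "lin F (u + v) = lin F u + lin F v"
proof -
  let ?A = "keys u \<union> keys v"
  have "keys (u + v) \<subseteq> ?A" by (rule keys_add)
  then show ?thesis
    by (simp add: lin_superset[of ?A] lookup_add cvs.scale_left_distrib sum.distrib)
qed

lemma lin_scl: "lin F (scl c v) = scl c (lin F v)"
proof -
  have "keys (scl c v) \<subseteq> keys v" by (auto simp: in_keys_iff)
  then show ?thesis
    by (simp add: lin_superset[of "keys v"] cvs.scale_sum_right)
qed

lemma lin_single [simp]: "lin F (single \<alpha> c) = scl c (F \<alpha>)"
  by (simp add: lin_def)

text \<open>Linear endomorphisms form a type so that they become an instance of
  \<open>ring_1\<close>: the commutator identities below are then ordinary ring algebra.\<close>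

typedef 'm op = "{F :: ('m \<Rightarrow>\<^sub>0 complex) \<Rightarrow> ('m \<Rightarrow>\<^sub>0 complex).
     (\<forall>u v. F (u + v) = F u + F v) \<and> (\<forall>c v. F (scl c v) = scl c (F v))}"
  morphisms app Op
  by (rule exI[of _ "\<lambda>v. 0"]) simp

setup_lifting type_definition_op

lemma app_add: "app A (u + v) = app A u + app A v"
  and app_scl: "app A (scl c v) = scl c (app A v)"
  using app[of A] by auto

lemma app_zero [simp]: "app A 0 = 0"
  using app_scl[of A 0 0] by simp

lemma app_uminus: "app A (- v) = - app A v"
  using app_add[of A v "- v"] by (simp add: eq_neg_iff_add_eq_0 add.commute)

lemma app_diff: "app A (u - v) = app A u - app A v"
  using app_add[of A u "- v"] by (simp add: app_uminus)

lemma app_sum: "app A (\<Sum>i\<in>I. f i) = (\<Sum>i\<in>I. app A (f i))"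
  by (induction I rule: infinite_finite_induct) (auto simp: app_add)

lemma op_ext: "(\<And>v. app A v = app B v) \<Longrightarrow> A = B"
  by (metis app_inject ext)

lemma vec_expand: "v = (\<Sum>\<alpha>\<in>keys v. scl (lookup v \<alpha>) (single \<alpha> 1))"
proof (rule poly_mapping_eqI)
  fix \<beta>
  show "lookup v \<beta> = lookup (\<Sum>\<alpha>\<in>keys v. scl (lookup v \<alpha>) (single \<alpha> 1)) \<beta>"
    by (cases "\<beta> \<in> keys v") (auto simp: lookup_sum lookup_single when_def in_keys_iff cong: if_cong)
qed

lemma op_eqI:
  assumes "\<And>\<alpha>. app A (single \<alpha> 1) = app B (single \<alpha> 1)"
  shows "A = B"
proof (rule op_ext)
  fix v
  show "app A v = app B v"
    by (subst (1 2) vec_expand) (simp only: app_sum app_scl assms)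
qed

instantiation op :: (type) ring_1
begin

lift_definition zero_op :: "'a op" is "\<lambda>v. 0" by simp
lift_definition one_op :: "'a op" is "\<lambda>v. v" by simp
lift_definition plus_op :: "'a op \<Rightarrow> 'a op \<Rightarrow> 'a op" is "\<lambda>A B v. A v + B v"
  by (simp add: cvs.scale_right_distrib)
lift_definition minus_op :: "'a op \<Rightarrow> 'a op \<Rightarrow> 'a op" is "\<lambda>A B v. A v - B v"
  by (simp add: cvs.scale_right_diff_distrib)
lift_definition uminus_op :: "'a op \<Rightarrow> 'a op" is "\<lambda>A v. - A v" by simp
lift_definition times_op :: "'a op \<Rightarrow> 'a op \<Rightarrow> 'a op" is "\<lambda>A B v. A (B v)" by simp

instance
proof
  show "(0 :: 'a op) \<noteq> 1"
  proof
    assume "(0 :: 'a op) = 1"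
    then have "app 0 (single undefined 1) = app (1 :: 'a op) (single undefined 1)"
      by simp
    then show False
      by (simp add: zero_op.rep_eq one_op.rep_eq) (metis lookup_single_eq lookup_zero zero_neq_one)
  qed
qed (transfer; simp add: algebra_simps)+

end

lemma app_simps [simp]:
  "app 0 v = 0" "app 1 v = v" "app (A + B) v = app A v + app B v"
  "app (A - B) v = app A v - app B v" "app (- A) v = - app A v" "app (A * B) v = app A (app B v)"
  by (transfer; simp)+

lemma app_sum_left: "app (\<Sum>i\<in>I. A i) v = (\<Sum>i\<in>I. app (A i) v)"
  by (induction I rule: infinite_finite_induct) auto

lift_definition sc :: "complex \<Rightarrow> 'm op" is "\<lambda>c v. scl c v"
  by (auto simp: cvs.scale_right_distrib cvs.scale_left_commute)

lemma app_sc [simp]: "app (sc c) v = scl c v"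
  by (transfer; simp)

lemma sc_simps: "sc 0 = 0" "sc 1 = 1" "sc (a + b) = sc a + sc b" "sc (a * b) = sc a * sc b"
  "sc (a - b) = sc a - sc b" "sc (- a) = - sc a"
  by (rule op_ext; simp add: cvs.scale_left_distrib cvs.scale_left_diff_distrib)+

lemma sc_comm: "A * sc c = sc c * A"
  by (rule op_ext) (simp add: app_scl)

definition lop :: "('m \<Rightarrow> ('m \<Rightarrow>\<^sub>0 complex)) \<Rightarrow> 'm op" where "lop F = Op (lin F)"

lemma app_lop: "app (lop F) v = lin F v"
  unfolding lop_def by (subst Op_inverse) (auto simp: lin_add lin_scl)

lemma app_lop_single [simp]: "app (lop F) (single \<alpha> c) = scl c (F \<alpha>)"
  by (simp add: app_lop)

definition sg :: "bool \<Rightarrow> 'a::ring_1" where "sg b = (if b then -1 else 1)"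

text \<open>The Koszul sign for putting \<open>g\<close> at its place in the sorted monomial: an odd
  \<open>g\<close> passes the smaller odd letters. Multisets thus stand for sorted monomials,
  without a quotient by commutation rules.\<close>

definition order_sign :: "('a::linorder \<Rightarrow> bool) \<Rightarrow> 'a \<Rightarrow> 'a multiset \<Rightarrow> complex" where
  "order_sign par g \<alpha> = (if par g \<and> odd (size {#h \<in># \<alpha>. h < g \<and> par h#}) then -1 else 1)"

lemma order_sign_add: "order_sign par g (add_mset h \<alpha>) = (if par g \<and> par h \<and> h < g then - order_sign par g \<alpha> else order_sign par g \<alpha>)"
  by (auto simp: order_sign_def)

lemma order_sign_diff: "h \<in># \<alpha> \<Longrightarrow> order_sign par g (\<alpha> - {#h#}) = (if par g \<and> par h \<and> h < g then - order_sign par g \<alpha> else order_sign par g \<alpha>)"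
  by (metis (no_types, lifting) add.inverse_inverse insert_DiffM order_sign_add)

lemma order_sign_sq [simp]: "order_sign par g \<alpha> * order_sign par g \<alpha> = 1"
  by (auto simp: order_sign_def)

lemma order_sign_even [simp]: "\<not> par g \<Longrightarrow> order_sign par g \<alpha> = 1"
  by (simp add: order_sign_def)

lemma order_sign_nz [simp]: "order_sign par g \<alpha> \<noteq> 0"
  by (auto simp: order_sign_def)

text \<open>For odd letters only the parity of the multiplicity matters; this makes the
  Weyl--Clifford relations hold on the whole space, including the monomials in which an odd
  letter is repeated.\<close>

definition cr :: "('a::linorder \<Rightarrow> bool) \<Rightarrow> 'a \<Rightarrow> 'a multiset op" where
  "cr par g = lop (\<lambda>\<alpha>. if par g \<and> odd (count \<alpha> g) then 0
                        else single (add_mset g \<alpha>) (order_sign par g \<alpha>))"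

definition an :: "('a::linorder \<Rightarrow> bool) \<Rightarrow> 'a \<Rightarrow> 'a multiset op" where
  "an par g = lop (\<lambda>\<alpha>. single (\<alpha> - {#g#})
     (if par g then if odd (count \<alpha> g) then order_sign par g \<alpha> else 0 else of_nat (count \<alpha> g)))"

lemma cr_single: "app (cr par g) (single \<alpha> c) =
   (if par g \<and> odd (count \<alpha> g) then 0 else single (add_mset g \<alpha>) (c * order_sign par g \<alpha>))"
  by (simp add: cr_def)

lemma an_single: "app (an par g) (single \<alpha> c) = single (\<alpha> - {#g#})
     (c * (if par g then if odd (count \<alpha> g) then order_sign par g \<alpha> else 0 else of_nat (count \<alpha> g)))"
  by (simp add: an_def)

text \<open>Of two distinct odd letters exactly one sees the other as smaller, so just one order of
  insertion acquires the sign.\<close>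

lemma cr_cr: "cr par g * cr par h = sg (par g \<and> par h) * (cr par h * cr par g)"
proof (cases "g = h")
  case True
  show ?thesis unfolding True by (rule op_eqI) (auto simp: cr_single sg_def order_sign_add)
next
  case False
  then consider "h < g" "\<not> g < h" | "g < h" "\<not> h < g" by fastforce
  then show ?thesis
    by cases (rule op_eqI; use False in \<open>simp add: cr_single sg_def order_sign_add add_mset_commute[of h g] mult.commute single_uminus\<close>)+
qed

lemma an_an: "an par g * an par h = sg (par g \<and> par h) * (an par h * an par g)"
proof (cases "g = h")
  case True
  show ?thesis unfolding True by (rule op_eqI) (auto simp: an_single sg_def order_sign_diff)
next
  case F: False
  show ?thesis
  proof (rule op_eqI)
    fix \<alpha>
    show "app (an par g * an par h) (single \<alpha> 1) =
       app (sg (par g \<and> par h) * (an par h * an par g)) (single \<alpha> 1)"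
    proof (cases "g \<in># \<alpha> \<and> h \<in># \<alpha>")
      case True
      have e: "{#h, g#} = {#g, h#}" by (rule add_mset_commute)
      have n: "order_sign par h (\<alpha> - {#g#}) = (if par h \<and> par g \<and> g < h then - order_sign par h \<alpha> else order_sign par h \<alpha>)"
        "order_sign par g (\<alpha> - {#h#}) = (if par g \<and> par h \<and> h < g then - order_sign par g \<alpha> else order_sign par g \<alpha>)"
        using True order_sign_diff by blast+
      have c: "count (\<alpha> - {#g#}) h = count \<alpha> h" "count (\<alpha> - {#h#}) g = count \<alpha> g" using F by auto
      consider "h < g" "\<not> g < h" | "g < h" "\<not> h < g" using F by fastforce
      then show ?thesis
        by cases (use F in \<open>simp_all add: an_single sg_def e n c mult.commute single_uminus\<close>)
    next
      case False
      then consider "count \<alpha> g = 0" | "count \<alpha> h = 0" by (auto simp: not_in_iff)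
      then show ?thesis
        by cases (use F in \<open>simp_all add: an_single sg_def\<close>)
    qed
  qed
qed

lemma an_cr: "an par g * cr par h = sg (par g \<and> par h) * (cr par h * an par g) + (if g = h then 1 else 0)"
proof (cases "g = h")
  case True
  show ?thesis unfolding True
  proof (rule op_eqI)
    fix \<alpha>
    show "app (an par h * cr par h) (single \<alpha> 1) =
       app (sg (par h \<and> par h) * (cr par h * an par h) + (if h = h then 1 else 0)) (single \<alpha> 1)"
    proof (cases "h \<in># \<alpha>")
      case True
      then obtain \<beta> where b: "\<alpha> = add_mset h \<beta>" by (metis insert_DiffM)
      have "single \<alpha> (of_nat (count \<alpha> h) + 1) = single \<alpha> (of_nat (count \<alpha> h)) + single \<alpha> 1"
        by (rule single_add)
      then show ?thesis
        by (cases "par h") (simp_all add: an_single cr_single sg_def b order_sign_add algebra_simps)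
    next
      case False
      then have "count \<alpha> h = 0" by (simp add: not_in_iff)
      then show ?thesis by (auto simp: an_single cr_single sg_def order_sign_diff order_sign_add)
    qed
  qed
next
  case F: False
  show ?thesis
  proof (rule op_eqI)
    fix \<alpha>
    show "app (an par g * cr par h) (single \<alpha> 1) =
       app (sg (par g \<and> par h) * (cr par h * an par g) + (if g = h then 1 else 0)) (single \<alpha> 1)"
    proof (cases "g \<in># \<alpha>")
      case True
      have e: "add_mset h \<alpha> - {#g#} = add_mset h (\<alpha> - {#g#})" using F by (auto simp: multiset_eq_iff)
      have n: "order_sign par h (\<alpha> - {#g#}) = (if par h \<and> par g \<and> g < h then - order_sign par h \<alpha> else order_sign par h \<alpha>)"
        using True by (rule order_sign_diff)
      have c: "count (\<alpha> - {#g#}) h = count \<alpha> h" "count (add_mset h \<alpha>) g = count \<alpha> g" using F by auto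
      consider "h < g" "\<not> g < h" | "g < h" "\<not> h < g" using F by fastforce
      then show ?thesis
        by cases (use F in \<open>simp_all add: an_single cr_single sg_def e n c order_sign_add mult.commute single_uminus\<close>)
    next
      case False
      then have z: "count \<alpha> g = 0" "count (add_mset h \<alpha>) g = 0" using F by (simp_all add: not_in_iff)
      show ?thesis using F by (simp add: an_single cr_single sg_def z)
    qed
  qed
qed

section \<open>Free algebras and straightening of words\<close>

lemma fspan_fzero [simp]: "fzero \<in> fspan S"
  by (simp add: fspan_def fzero_def)

lemma fspan_fmono [simp]: "fmono w \<in> fspan S \<longleftrightarrow> w \<in> S"
  by (auto simp: fspan_def fmono_def)

lemma fspan_fone [simp]: "fone \<in> fspan S \<longleftrightarrow> [] \<in> S"
  by (auto simp: fspan_def fone_def)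

lemma fspan_fadd [intro]: "f \<in> fspan S \<Longrightarrow> g \<in> fspan S \<Longrightarrow> fadd f g \<in> fspan S"
  unfolding fspan_def fadd_def
  by (auto intro: finite_subset[of _ "{w. f w \<noteq> 0} \<union> {w. g w \<noteq> 0}"]) (metis add_0)

lemma fspan_fsmul [intro]: "f \<in> fspan S \<Longrightarrow> fsmul c f \<in> fspan S"
  unfolding fspan_def fsmul_def
  by (auto intro: finite_subset[of _ "{w. f w \<noteq> 0}"])

lemma fsub_fadd: "fsub f g = fadd f (fsmul (-1) g)"
  by (simp add: fsub_def fadd_def fsmul_def)

lemma fspan_fsub [intro]: "f \<in> fspan S \<Longrightarrow> g \<in> fspan S \<Longrightarrow> fsub f g \<in> fspan S"
  unfolding fsub_fadd by auto

lemma fspan_mono: "f \<in> fspan S \<Longrightarrow> S \<subseteq> T \<Longrightarrow> f \<in> fspan T"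
  by (auto simp: fspan_def)

lemma fspan_UNIV: "f \<in> fspan S \<Longrightarrow> f \<in> fspan UNIV"
  by (auto simp: fspan_def)

lemma fsum_empty [simp]: "fsum F {} = fzero"
  by (simp add: fsum_def fzero_def)

lemma fsum_insert [simp]: "finite I \<Longrightarrow> i \<notin> I \<Longrightarrow> fsum F (insert i I) = fadd (F i) (fsum F I)"
  by (simp add: fsum_def fadd_def)

lemma fspan_fsum: "finite I \<Longrightarrow> (\<And>i. i \<in> I \<Longrightarrow> F i \<in> fspan S) \<Longrightarrow> fsum F I \<in> fspan S"
  by (induction I rule: finite_induct) auto

lemma fspan_induct [consumes 1, case_names zero mono add smul]:
  assumes f: "f \<in> fspan S"
    and zero: "P fzero"
    and mono: "\<And>w. w \<in> S \<Longrightarrow> P (fmono w)"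
    and add: "\<And>f g. f \<in> fspan S \<Longrightarrow> g \<in> fspan S \<Longrightarrow> P f \<Longrightarrow> P g \<Longrightarrow> P (fadd f g)"
    and smul: "\<And>c f. f \<in> fspan S \<Longrightarrow> P f \<Longrightarrow> P (fsmul c f)"
  shows "P f"
proof -
  have fin: "finite {w. f w \<noteq> 0}" and S: "{w. f w \<noteq> 0} \<subseteq> S" using f by (auto simp: fspan_def)
  have "P (fsum (\<lambda>w. fsmul (c w) (fmono w)) A) \<and> fsum (\<lambda>w. fsmul (c w) (fmono w)) A \<in> fspan S"
    if "finite A" "A \<subseteq> S" for A c using that
    by (induction A rule: finite_induct) (auto intro!: zero add smul mono fspan_fadd fspan_fsmul)
  from this[OF fin S, of f] have "P (fsum (\<lambda>w. fsmul (f w) (fmono w)) {w. f w \<noteq> 0})" by blast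
  also have "fsum (\<lambda>w. fsmul (f w) (fmono w)) {w. f w \<noteq> 0} = f"
    using fin by (auto simp: fsum_def fsmul_def fmono_def if_distrib[of "\<lambda>x. _ * x"] cong: if_cong)
  finally show ?thesis .
qed

lemma fmul_simps:
  "fmul (fadd a b) c = fadd (fmul a c) (fmul b c)" "fmul c (fadd a b) = fadd (fmul c a) (fmul c b)"
  "fmul (fsub a b) c = fsub (fmul a c) (fmul b c)" "fmul c (fsub a b) = fsub (fmul c a) (fmul c b)"
  "fmul (fsmul z a) c = fsmul z (fmul a c)" "fmul c (fsmul z a) = fsmul z (fmul c a)"
  "fmul fzero c = fzero" "fmul c fzero = fzero"
  by (auto simp: fmul_def fadd_def fsub_def fsmul_def fzero_def algebra_simps sum.distrib
      sum_subtractf sum_distrib_left)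

lemma fmul_fmono [simp]: "fmul (fmono u) (fmono v) = fmono (u @ v)"
proof
  fix w
  have eq: "fmono u (take k w) * fmono v (drop k w) = (if k = length u \<and> w = u @ v then 1 else 0)"
    if "k \<le> length w" for k
    using that append_take_drop_id[of k w] by (auto simp: fmono_def)
  show "fmul (fmono u) (fmono v) w = fmono (u @ v) w"
  proof (cases "w = u @ v")
    case True
    have "fmul (fmono u) (fmono v) w = (\<Sum>k\<le>length w. if k = length u then 1 else 0)"
      unfolding fmul_def by (rule sum.cong[OF refl]) (use True eq in auto)
    then show ?thesis using True by (simp add: fmono_def)
  next
    case False
    have "fmul (fmono u) (fmono v) w = (\<Sum>k\<le>length w. 0)"
      unfolding fmul_def by (rule sum.cong[OF refl]) (use False eq in auto)
    then show ?thesis using False by (simp add: fmono_def)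
  qed
qed

lemma fone_fmono: "fone = fmono []"
  by (simp add: fone_def fmono_def)

lemma fmul_one [simp]: "fmul (fmono []) f = f"
proof
  fix w
  have "fmul (fmono []) f w = (\<Sum>k\<le>length w. if k = 0 then f w else 0)"
    unfolding fmul_def fmono_def by (rule sum.cong[OF refl]) auto
  then show "fmul (fmono []) f w = f w" by simp
qed

lemma fspan_fmul_gen:
  assumes "f \<in> fspan S" "g \<in> fspan T" "\<And>u v. u \<in> S \<Longrightarrow> v \<in> T \<Longrightarrow> u @ v \<in> R"
  shows "fmul f g \<in> fspan R"
  using assms(1)
proof (induction rule: fspan_induct)
  case (mono u)
  show ?case using assms(2)
    by (induction rule: fspan_induct) (use mono assms(3) in \<open>auto simp: fmul_simps\<close>)
qed (auto simp: fmul_simps)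

lemma fspan_fmul [intro]: "f \<in> fspan UNIV \<Longrightarrow> g \<in> fspan UNIV \<Longrightarrow> fmul f g \<in> fspan UNIV"
  by (rule fspan_fmul_gen) auto

lemma fspan_fmul_letters: "f \<in> fspan {w. set w \<subseteq> A} \<Longrightarrow> g \<in> fspan {w. set w \<subseteq> A} \<Longrightarrow> fmul f g \<in> fspan {w. set w \<subseteq> A}"
  by (rule fspan_fmul_gen) auto

lemma fprod_simps [simp]: "fprod [] = fone" "fprod (f # fs) = fmul f (fprod fs)"
  by (simp_all add: fprod_def)

lemma fspan_fprod_letters: "(\<And>f. f \<in> set fs \<Longrightarrow> f \<in> fspan {w. set w \<subseteq> A}) \<Longrightarrow> fprod fs \<in> fspan {w. set w \<subseteq> A}"
  by (induction fs) (auto intro: fspan_fmul_letters)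

lemma fspan_hom_ext_letters:
  assumes "f \<in> fspan {w. set w \<subseteq> B}" "\<And>x. x \<in> B \<Longrightarrow> \<sigma> x \<in> fspan {w. set w \<subseteq> A}"
  shows "hom_ext \<sigma> f \<in> fspan {w. set w \<subseteq> A}"
proof -
  have "finite {w. f w \<noteq> 0}" "\<And>w. f w \<noteq> 0 \<Longrightarrow> set w \<subseteq> B" using assms(1) by (auto simp: fspan_def)
  then show ?thesis unfolding hom_ext_def
    by (intro fspan_fsum fspan_fsmul fspan_fprod_letters) (use assms(2) in auto)
qed

section \<open>Evaluation of noncommutative polynomials at operators\<close>

definition ev :: "('x \<Rightarrow> 'm op) \<Rightarrow> 'x fa \<Rightarrow> 'm op" where
  "ev E f = (\<Sum>w | f w \<noteq> 0. sc (f w) * prod_list (map E w))"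

lemma ev_superset: "finite A \<Longrightarrow> {w. f w \<noteq> 0} \<subseteq> A \<Longrightarrow> ev E f = (\<Sum>w\<in>A. sc (f w) * prod_list (map E w))"
  unfolding ev_def by (rule sum.mono_neutral_left) (auto simp: sc_simps)

lemma ev_fzero [simp]: "ev E fzero = 0"
  by (simp add: ev_def fzero_def)

lemma ev_fmono [simp]: "ev E (fmono w) = prod_list (map E w)"
  by (subst ev_superset[of "{w}"]) (auto simp: fmono_def sc_simps)

lemma ev_fone [simp]: "ev E fone = 1"
  by (simp add: fone_fmono)

lemma ev_fadd: assumes "f \<in> fspan UNIV" "g \<in> fspan UNIV" shows "ev E (fadd f g) = ev E f + ev E g"
proof -
  let ?A = "{w. f w \<noteq> 0} \<union> {w. g w \<noteq> 0}"
  have "finite ?A" using assms by (auto simp: fspan_def)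
  moreover have "{w. fadd f g w \<noteq> 0} \<subseteq> ?A" by (auto simp: fadd_def)
  ultimately show ?thesis
    by (simp add: ev_superset[of ?A]) (simp add: fadd_def sc_simps algebra_simps sum.distrib)
qed

lemma ev_fsmul: assumes "f \<in> fspan UNIV" shows "ev E (fsmul c f) = sc c * ev E f"
proof -
  let ?A = "{w. f w \<noteq> 0}"
  have "finite ?A" using assms by (auto simp: fspan_def)
  moreover have "{w. fsmul c f w \<noteq> 0} \<subseteq> ?A" by (auto simp: fsmul_def)
  ultimately show ?thesis
    by (simp add: ev_superset[of ?A]) (simp add: fsmul_def sc_simps mult.assoc sum_distrib_left)
qed

lemma ev_fsub: "f \<in> fspan UNIV \<Longrightarrow> g \<in> fspan UNIV \<Longrightarrow> ev E (fsub f g) = ev E f - ev E g"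
  unfolding fsub_fadd by (simp add: ev_fadd ev_fsmul fspan_fsmul sc_simps)

lemma ev_fsum: "finite I \<Longrightarrow> (\<And>i. i \<in> I \<Longrightarrow> F i \<in> fspan UNIV) \<Longrightarrow> ev E (fsum F I) = (\<Sum>i\<in>I. ev E (F i))"
proof (induction I rule: finite_induct)
  case (insert i I)
  then have "fsum F I \<in> fspan UNIV" by (intro fspan_fsum) auto
  then show ?case using insert by (simp add: ev_fadd)
qed simp

lemma ev_fmul:
  assumes "f \<in> fspan UNIV" "g \<in> fspan UNIV"
  shows "ev E (fmul f g) = ev E f * ev E g"
  using assms(1)
proof (induction rule: fspan_induct)
  case (mono u)
  show ?case using assms(2)
  proof (induction rule: fspan_induct)
    case (add f g)
    then show ?case by (simp add: fmul_simps ev_fadd fspan_fmul algebra_simps)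
  next
    case (smul c f)
    then show ?case by (simp add: fmul_simps ev_fsmul fspan_fmul) (metis mult.assoc sc_comm)
  qed (auto simp: fmul_simps)
next
  case (add f g)
  then show ?case using assms(2) by (simp add: fmul_simps ev_fadd fspan_fmul algebra_simps)
next
  case (smul c f)
  then show ?case using assms(2) by (simp add: fmul_simps ev_fsmul fspan_fmul mult.assoc)
qed (auto simp: fmul_simps)

lemma fspan_fprod [intro]: "(\<And>f. f \<in> set fs \<Longrightarrow> f \<in> fspan UNIV) \<Longrightarrow> fprod fs \<in> fspan UNIV"
  using fspan_fprod_letters[of fs UNIV] by simp

lemma ev_fprod: "(\<And>f. f \<in> set fs \<Longrightarrow> f \<in> fspan UNIV) \<Longrightarrow> ev E (fprod fs) = prod_list (map (ev E) fs)"
  by (induction fs) (simp_all add: ev_fmul fspan_fprod)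

lemma ev_hom_ext:
  assumes "f \<in> fspan {w. set w \<subseteq> B}" "\<And>x. x \<in> B \<Longrightarrow> \<sigma> x \<in> fspan UNIV"
  shows "ev E (hom_ext \<sigma> f) = ev (\<lambda>x. ev E (\<sigma> x)) f"
proof -
  have f: "finite {w. f w \<noteq> 0}" "\<And>w. f w \<noteq> 0 \<Longrightarrow> set w \<subseteq> B" using assms(1) by (auto simp: fspan_def)
  have s: "fprod (map \<sigma> w) \<in> fspan UNIV" "ev E (fprod (map \<sigma> w)) = prod_list (map (\<lambda>x. ev E (\<sigma> x)) w)"
    if "f w \<noteq> 0" for w
  proof -
    have "\<And>x. x \<in> set (map \<sigma> w) \<Longrightarrow> x \<in> fspan UNIV" using f(2)[OF that] assms(2) by auto
    then show "fprod (map \<sigma> w) \<in> fspan UNIV" "ev E (fprod (map \<sigma> w)) = prod_list (map (\<lambda>x. ev E (\<sigma> x)) w)"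
      by (auto simp: ev_fprod comp_def simp del: set_map)
  qed
  have "ev E (hom_ext \<sigma> f) = (\<Sum>w | f w \<noteq> 0. ev E (fsmul (f w) (fprod (map \<sigma> w))))"
    unfolding hom_ext_def by (rule ev_fsum) (use f s in \<open>auto intro!: fspan_fsmul\<close>)
  also have "\<dots> = ev (\<lambda>x. ev E (\<sigma> x)) f"
    unfolding ev_def[of "\<lambda>x. ev E (\<sigma> x)"] by (rule sum.cong) (use s in \<open>auto simp: ev_fsmul\<close>)
  finally show ?thesis .
qed

lemma ev_cong:
  assumes "f \<in> fspan {w. set w \<subseteq> B}" "\<And>x. x \<in> B \<Longrightarrow> E x = E' x"
  shows "ev E f = ev E' f"
  unfolding ev_def
proof (intro sum.cong refl arg_cong2[of _ _ _ _ "(*)"] arg_cong[of _ _ prod_list] map_cong)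
  fix w x assume "w \<in> {w. f w \<noteq> 0}" "x \<in> set w"
  then show "E x = E' x" using assms by (auto simp: fspan_def)
qed

lemma two_ideal_ev:
  assumes "a \<in> two_ideal G" "\<And>g. g \<in> G \<Longrightarrow> g \<in> fspan UNIV \<and> ev E g = 0"
  shows "a \<in> fspan UNIV \<and> ev E a = 0"
  using assms(1)
proof induction
  case (gen g u v)
  then show ?case using assms(2)[OF gen] by (auto simp: ev_fmul fspan_fmul intro!: fspan_fmul)
qed (auto simp: ev_fadd ev_fsmul)

section \<open>Sorted words\<close>

definition good :: "('a::linorder \<Rightarrow> bool) \<Rightarrow> 'a list \<Rightarrow> bool" where
  "good par w \<longleftrightarrow> sorted_wrt (\<lambda>a b. a < b \<or> (a = b \<and> \<not> par a)) w"

lemma good_Nil [simp]: "good par []"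
  by (simp add: good_def)

lemma good_sorted: "good par w \<Longrightarrow> sorted w"
  by (auto simp: good_def elim!: sorted_wrt_mono_rel[rotated])

lemma good_mset_inj: "good par w \<Longrightarrow> good par w' \<Longrightarrow> mset w = mset w' \<Longrightarrow> w = w'"
  by (metis good_sorted properties_for_sort)

lemma good_count: "good par w \<Longrightarrow> par g \<Longrightarrow> count (mset w) g \<le> 1"
proof (induction w)
  case (Cons a w)
  show ?case
  proof (cases "a = g")
    case True
    have "g \<notin> set w" using Cons True by (auto simp: good_def)
    then show ?thesis using True by (simp add: not_in_iff[symmetric])
  next
    case False
    then show ?thesis using Cons by (auto simp: good_def)
  qed
qed simp

text \<open>Failure of sortedness shows at two neighbours, so swapping neighbours and rewriting odd
  squares are the only steps of straightening.\<close>

lemma not_good_split: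
  "\<not> good par w \<Longrightarrow> \<exists>u a b v. w = u @ [a, b] @ v \<and> (b < a \<or> (a = b \<and> par a))"
proof (induction w)
  case (Cons a w)
  show ?case
  proof (cases "good par w")
    case False
    then obtain u b c v where "w = u @ [b, c] @ v" "c < b \<or> (b = c \<and> par b)" using Cons by blast
    then have "a # w = (a # u) @ [b, c] @ v" by simp
    then show ?thesis using \<open>c < b \<or> _\<close> by blast
  next
    case True
    then obtain c where c: "c \<in> set w" "\<not> (a < c \<or> (a = c \<and> \<not> par a))" using Cons(2) by (auto simp: good_def)
    then obtain b v where w: "w = b # v" by (cases w) auto
    have "b < a \<or> (a = b \<and> par a)"
    proof (rule ccontr)
      assume "\<not> ?thesis"
      then have "a < b \<or> (a = b \<and> \<not> par a)" by auto
      moreover have "c = b \<or> b < c \<or> (b = c \<and> \<not> par b)" using True c w by (auto simp: good_def)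
      ultimately show False using c(2) by auto
    qed
    then show ?thesis using w by (intro exI[of _ "[]"]) auto
  qed
qed simp

text \<open>One induction serves both algebras: a swap keeps \<open>meas\<close> and makes the word
  lexicographically smaller, while the correction terms of a relation have smaller
  \<open>meas\<close> (the length for \<open>U(\<gg>)\<close>, the total degree for the Yangian).
  The square of an odd letter is half a supercommutator, so it reduces to correction terms
  alone.\<close>

lemma word_sort_induct [case_names good swap dup]:
  fixes w :: "'a::wellorder list" and meas :: "'a list \<Rightarrow> nat"
  assumes good: "\<And>w. good par w \<Longrightarrow> P w"
    and swap: "\<And>u a b v. (\<And>w'. meas w' < meas (u @ [a, b] @ v) \<Longrightarrow> P w') \<Longrightarrow> b < a \<Longrightarrow>
       P (u @ [b, a] @ v) \<Longrightarrow> P (u @ [a, b] @ v)"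
    and dup: "\<And>u a v. (\<And>w'. meas w' < meas (u @ [a, a] @ v) \<Longrightarrow> P w') \<Longrightarrow> par a \<Longrightarrow> P (u @ [a, a] @ v)"
    and meas: "\<And>u a b v. meas (u @ [a, b] @ v) = meas (u @ [b, a] @ v)"
  shows "P w"
proof -
  let ?r = "inv_image (less_than <*lex*> lenlex {(x, y :: 'a). x < y}) (\<lambda>w. (meas w, w))"
  have "wf ?r" by (intro wf_inv_image wf_lex_prod wf_less_than wf_lenlex) (rule wf)
  then show ?thesis
  proof (induction w rule: wf_induct_rule)
    case (less w)
    show ?case
    proof (cases "good par w")
      case True then show ?thesis by (rule good)
    next
      case False
      then obtain u a b v where w: "w = u @ [a, b] @ v" and ab: "b < a \<or> (a = b \<and> par a)"
        using not_good_split by blast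
      have sm: "P w'" if "meas w' < meas (u @ [a, b] @ v)" for w'
        by (rule less) (use that w in auto)
      show ?thesis
      proof (cases "b < a")
        case True
        have "(u @ [b, a] @ v, u @ [a, b] @ v) \<in> lenlex {(x, y). x < y}"
          unfolding lenlex_conv lex_conv using True
          by (auto intro!: exI[of _ u])
        then have "P (u @ [b, a] @ v)" by (intro less) (simp add: w meas[of u a b v, simplified])
        then show ?thesis unfolding w using swap[OF sm True] by blast
      next
        case False
        then show ?thesis using ab dup sm unfolding w by blast
      qed
    qed
  qed
qed

definition vac :: "'a multiset \<Rightarrow>\<^sub>0 complex" where "vac = single {#} 1"

text \<open>The word need not be sorted: as long as no odd letter repeats, each insertion
  contributes only a sign. For triangularity it matters only that the coefficient is
  nonzero.\<close>

lemma cr_word: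
  assumes "\<And>g. par g \<Longrightarrow> count (mset w) g \<le> 1"
  shows "\<exists>\<epsilon>. \<epsilon> \<noteq> 0 \<and> app (prod_list (map (cr par) w)) vac = single (mset w) \<epsilon>"
  using assms
proof (induction w)
  case Nil
  then show ?case by (intro exI[of _ 1]) (simp add: vac_def del: single_one)
next
  case (Cons a w)
  have "count (mset w) g \<le> 1" if "par g" for g
    by (rule order_trans[OF _ Cons(2)[OF that]]) simp
  then obtain \<epsilon> where e: "\<epsilon> \<noteq> 0" "app (prod_list (map (cr par) w)) vac = single (mset w) \<epsilon>"
    using Cons(1) by blast
  have "count (mset w) a = 0" if "par a" using Cons(2)[OF that] by simp
  then have "even (count (mset w) a)" if "par a" using that by (metis even_zero)
  then have "app (prod_list (map (cr par) (a # w))) vac = single (mset (a # w)) (\<epsilon> * order_sign par a (mset w))"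
    by (auto simp: e cr_single)
  then show ?case using e by (intro exI[of _ "\<epsilon> * order_sign par a (mset w)"]) simp
qed

section \<open>Coefficients, filtrations and triangularity\<close>

lemma lookup_lin: "lookup (lin F v) \<beta> = (\<Sum>\<alpha>\<in>keys v. lookup v \<alpha> * lookup (F \<alpha>) \<beta>)"
  by (simp add: lin_def lookup_sum)

lemma lookup_lin_one:
  assumes "\<And>\<alpha>. \<alpha> \<noteq> \<gamma> \<Longrightarrow> lookup (F \<alpha>) \<beta> = 0"
  shows "lookup (lin F v) \<beta> = lookup v \<gamma> * lookup (F \<gamma>) \<beta>"
proof -
  have "lookup (lin F v) \<beta> = (\<Sum>\<alpha>\<in>keys v. if \<alpha> = \<gamma> then lookup v \<gamma> * lookup (F \<gamma>) \<beta> else 0)"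
    unfolding lookup_lin by (rule sum.cong) (use assms in auto)
  then show ?thesis by (auto simp: in_keys_iff)
qed

lemma lookup_an: "lookup (app (an par h) v) \<beta> =
  (if par h then if even (count \<beta> h) then order_sign par h \<beta> else 0 else of_nat (count \<beta> h + 1)) * lookup v (add_mset h \<beta>)"
proof -
  have "lookup (app (an par h) v) \<beta> = lookup v (add_mset h \<beta>) * lookup (single (add_mset h \<beta> - {#h#})
     (if par h then if odd (count (add_mset h \<beta>) h) then order_sign par h (add_mset h \<beta>) else 0 else of_nat (count (add_mset h \<beta>) h))) \<beta>"
    unfolding an_def app_lop
  proof (rule lookup_lin_one)
    fix \<alpha> assume ne: "\<alpha> \<noteq> add_mset h \<beta>"
    show "lookup (single (\<alpha> - {#h#}) (if par h then if odd (count \<alpha> h) then order_sign par h \<alpha> else 0 else of_nat (count \<alpha> h))) \<beta> = 0"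
    proof (cases "h \<in># \<alpha>")
      case True
      then have "\<alpha> - {#h#} \<noteq> \<beta>" using ne by (metis insert_DiffM)
      then show ?thesis by (simp add: lookup_single)
    next
      case False
      then have "count \<alpha> h = 0" by (simp add: not_in_iff)
      then show ?thesis by (simp add: lookup_single)
    qed
  qed
  then show ?thesis by (simp add: order_sign_add lookup_single)
qed

lemma lookup_cr_notin: "h \<notin># \<beta> \<Longrightarrow> lookup (app (cr par h) v) \<beta> = 0"
  unfolding cr_def app_lop lookup_lin by (rule sum.neutral) (auto simp: lookup_single when_def)

lemma lookup_cr_add: "lookup (app (cr par h) v) (add_mset h \<beta>) =
  (if par h \<and> odd (count \<beta> h) then 0 else order_sign par h \<beta> * lookup v \<beta>)"
  unfolding cr_def app_lop
  by (subst lookup_lin_one[of \<beta>]) (auto simp: lookup_single when_def)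

definition rst :: "('m \<Rightarrow> bool) \<Rightarrow> 'm op" where
  "rst P = lop (\<lambda>\<alpha>. if P \<alpha> then single \<alpha> 1 else 0)"

lemma lookup_rst [simp]: "lookup (app (rst P) v) \<alpha> = (if P \<alpha> then lookup v \<alpha> else 0)"
  unfolding rst_def app_lop by (subst lookup_lin_one[of \<alpha>]) (auto simp: lookup_single when_def)

lemma rst_single [simp]: "app (rst P) (single \<alpha> c) = (if P \<alpha> then single \<alpha> c else 0)"
  by (simp add: rst_def)

definition Fil :: "('m \<Rightarrow> int) \<Rightarrow> int \<Rightarrow> ('m \<Rightarrow>\<^sub>0 complex) set" where
  "Fil D d = {v. \<forall>\<alpha>\<in>keys v. D \<alpha> \<le> d}"

lemma Fil_iff: "v \<in> Fil D d \<longleftrightarrow> (\<forall>\<alpha>. lookup v \<alpha> \<noteq> 0 \<longrightarrow> D \<alpha> \<le> d)"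
  by (auto simp: Fil_def in_keys_iff)

lemma Fil_subspace: "cvs.subspace (Fil D d)"
proof (rule cvs.subspaceI)
  fix u v assume "u \<in> Fil D d" "v \<in> Fil D d"
  then show "u + v \<in> Fil D d" unfolding Fil_iff lookup_add by (metis add_0)
qed (auto simp: Fil_iff)

lemma Fil_mono: "v \<in> Fil D d \<Longrightarrow> d \<le> e \<Longrightarrow> v \<in> Fil D e"
  by (fastforce simp: Fil_iff)

lemma rst_Fil: "v \<in> Fil D d \<Longrightarrow> app (rst P) v \<in> Fil D d"
  by (auto simp: Fil_iff)

lemma Fil_top_zero: "v \<in> Fil D d \<Longrightarrow> app (rst (\<lambda>\<alpha>. D \<alpha> = d)) v = 0 \<longleftrightarrow> v \<in> Fil D (d - 1)"
  unfolding Fil_iff poly_mapping_eq_iff fun_eq_iff lookup_rst lookup_zero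
  by (smt (verit))

text \<open>Among the terms with \<open>c w \<noteq> 0\<close> take one of maximal degree: its
  leading monomial differs from the other leading monomials and is too high for their tails, so it
  cannot cancel. The conclusion is a degree bound rather than linear independence, which is what
  rules out hidden cancellation in filtered statements.\<close>

lemma triangular:
  assumes fin: "finite A" and inj: "inj_on \<mu> A"
    and lead: "\<And>w. w \<in> A \<Longrightarrow> \<exists>\<epsilon>. \<epsilon> \<noteq> 0 \<and> b w - single (\<mu> w) \<epsilon> \<in> Fil D (D (\<mu> w) - 1)"
    and sum: "(\<Sum>w\<in>A. scl (c w) (b w)) \<in> Fil D d"
    and w: "w \<in> A" "c w \<noteq> 0"
  shows "D (\<mu> w) \<le> d"
proof (rule ccontr)
  assume "\<not> D (\<mu> w) \<le> d"
  define B where "B = {w \<in> A. c w \<noteq> 0}"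
  have B: "finite B" "w \<in> B" using fin w by (auto simp: B_def)
  have "Max ((\<lambda>w. D (\<mu> w)) ` B) \<in> (\<lambda>w. D (\<mu> w)) ` B" by (rule Max_in) (use B in auto)
  moreover have "D (\<mu> u) \<le> Max ((\<lambda>w. D (\<mu> w)) ` B)" if "u \<in> B" for u using B that by simp
  ultimately have "\<exists>w0\<in>B. \<forall>u\<in>B. D (\<mu> u) \<le> D (\<mu> w0)" by force
  then obtain w0 where w0: "w0 \<in> B" "\<And>u. u \<in> B \<Longrightarrow> D (\<mu> u) \<le> D (\<mu> w0)" by blast
  have z: "lookup (b u) (\<mu> w0) = 0" if "u \<in> B" "u \<noteq> w0" for u
  proof -
    have "u \<in> A" using that by (simp add: B_def)
    then obtain \<epsilon> where e: "b u - single (\<mu> u) \<epsilon> \<in> Fil D (D (\<mu> u) - 1)" using lead by meson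
    have "\<mu> u \<noteq> \<mu> w0" using inj that w0 by (auto simp: B_def inj_on_def)
    then have "lookup (b u) (\<mu> w0) = lookup (b u - single (\<mu> u) \<epsilon>) (\<mu> w0)"
      by (simp add: lookup_minus lookup_single)
    moreover have "D (\<mu> u) \<le> D (\<mu> w0)" using w0 that by blast
    ultimately show ?thesis using e unfolding Fil_iff by (smt (verit))
  qed
  have "w0 \<in> A" using w0 by (simp add: B_def)
  then obtain \<epsilon> where e: "\<epsilon> \<noteq> 0" "b w0 - single (\<mu> w0) \<epsilon> \<in> Fil D (D (\<mu> w0) - 1)" using lead by meson
  then have "lookup (b w0 - single (\<mu> w0) \<epsilon>) (\<mu> w0) = 0" unfolding Fil_iff by (smt (verit))
  then have nz: "lookup (b w0) (\<mu> w0) = \<epsilon>" by (simp add: lookup_minus)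
  have "lookup (\<Sum>w\<in>A. scl (c w) (b w)) (\<mu> w0) = (\<Sum>u\<in>A. if u = w0 then c w0 * \<epsilon> else 0)"
    unfolding lookup_sum by (rule sum.cong[OF refl]) (use z nz in \<open>auto simp: B_def\<close>)
  also have "\<dots> = c w0 * \<epsilon>" using w0 fin by (simp add: B_def)
  finally have "lookup (\<Sum>w\<in>A. scl (c w) (b w)) (\<mu> w0) \<noteq> 0" using e w0 by (simp add: B_def)
  then have "D (\<mu> w0) \<le> d" using sum unfolding Fil_iff by blast
  then show False using w0(2)[OF B(2)] \<open>\<not> D (\<mu> w) \<le> d\<close> by simp
qed

text \<open>The sign is an argument: \<open>s\<close> is the conjunction of the two parities, as
  operators carry no parity of their own. Addition of parities becomes \<open>\<noteq>\<close> in
  the Leibniz rules below.\<close>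

definition br :: "bool \<Rightarrow> 'a::ring_1 \<Rightarrow> 'a \<Rightarrow> 'a" where "br s A B = A * B - sg s * (B * A)"

lemma br_mult_right: "br (s \<noteq> t) A (B * C) = br s A B * C + sg s * (B * br t A C)"
  by (cases s; cases t) (simp_all add: br_def sg_def algebra_simps)

lemma br_mult_left: "br (s \<noteq> t) (A * B) C = A * br t B C + sg t * (br s A C * B)"
  by (cases s; cases t) (simp_all add: br_def sg_def algebra_simps)

lemma br_add_right: "br s A (B + C) = br s A B + br s A C"
  by (simp add: br_def algebra_simps)

lemma br_add_left: "br s (A + B) C = br s A C + br s B C"
  by (simp add: br_def algebra_simps)

lemma br_uminus_right [simp]: "br s A (- B) = - br s A B"
  by (simp add: br_def algebra_simps)

lemma br_uminus_left [simp]: "br s (- A) B = - br s A B"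
  by (simp add: br_def algebra_simps)

lemma br_zero [simp]: "br s A 0 = 0" "br s 0 A = 0"
  by (simp_all add: br_def)

lemma br_sum_right: "br s A (\<Sum>i\<in>I. f i) = (\<Sum>i\<in>I. br s A (f i))"
  by (induction I rule: infinite_finite_induct) (simp_all add: br_add_right)

lemma br_sum_left: "br s (\<Sum>i\<in>I. f i) A = (\<Sum>i\<in>I. br s (f i) A)"
  by (induction I rule: infinite_finite_induct) (simp_all add: br_add_left)

lemma br_sg_right: "br s A (sg t * B) = sg t * br s A B"
  by (cases t) (simp_all add: br_def sg_def)

lemma br_sg_left: "br s (sg t * A) B = sg t * br s A B"
  by (cases t) (simp_all add: br_def sg_def)

lemma br_swap: "br s A B = - (sg s * br s B A)"
  by (cases s) (simp_all add: br_def sg_def)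

lemma br_swap_cong: "s = t \<Longrightarrow> br s A B = - (sg t * br t B A)"
  using br_swap by blast

lemma sc_sgn: "sc (sgn b) = sg b"
  by (simp add: sgn_def sg_def sc_simps)

section \<open>The actions of the general linear superalgebra and of the parabolic\<close>

type_synonym fock = "(box \<times> box) multiset \<Rightarrow>\<^sub>0 complex"

locale rect =
  fixes bs :: "pty list" and m n l :: nat
  assumes lenD: "length (filter (\<lambda>x. x = Delta) bs) = m"
    and lenE: "length (filter (\<lambda>x. x = Eps) bs) = n"
begin

abbreviation "k \<equiv> m + n"
abbreviation "B \<equiv> boxes k l"
abbreviation "bp \<equiv> bpar bs"
abbreviation "X a b \<equiv> cr (epar bs) (a, b)"
abbreviation "DD a b \<equiv> an (epar bs) (a, b)"
definition ep :: "box \<Rightarrow> box \<Rightarrow> bool" where "ep a b \<longleftrightarrow> bp a \<noteq> bp b"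

lemma finite_boxes [simp, intro]: "finite B"
  by (simp add: boxes_def)

lemma epar_pair: "epar bs (a, b) = ep a b"
  by (simp add: epar_def ep_def)

text \<open>\<open>X + Lop\<close> and \<open>X + Rop\<close> are left and (super) right multiplication of \<open>U(\<gg>)\<close> by matrix units,
  transported to the Fock space.\<close>

definition Lop :: "box \<Rightarrow> box \<Rightarrow> (box \<times> box) multiset op" where
  "Lop a b = (\<Sum>c\<in>B. X a c * DD b c)"

definition Rop :: "box \<Rightarrow> box \<Rightarrow> (box \<times> box) multiset op" where
  "Rop a b = (\<Sum>c\<in>B. sg (ep c a \<and> ep a b) * (X c b * DD c a))"

lemma br_X_X: "br (ep a b \<and> ep c e) (X a b) (X c e) = 0"
  unfolding br_def using cr_cr[of "epar bs" "(a, b)" "(c, e)"] by (simp add: epar_pair)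

lemma br_D_D: "br (ep a b \<and> ep c e) (DD a b) (DD c e) = 0"
  unfolding br_def using an_an[of "epar bs" "(a, b)" "(c, e)"] by (simp add: epar_pair)

lemma br_D_X: "br (ep a b \<and> ep c e) (DD a b) (X c e) = (if a = c \<and> b = e then 1 else 0)"
  unfolding br_def using an_cr[of "epar bs" "(a, b)" "(c, e)"] by (simp add: epar_pair)

lemma br_X_D: "br (ep a b \<and> ep c e) (X a b) (DD c e) = (if a = c \<and> b = e then - sg (ep a b) else 0)"
proof -
  have "br (ep a b \<and> ep c e) (X a b) (DD c e) = - (sg (ep c e \<and> ep a b) * br (ep c e \<and> ep a b) (DD c e) (X a b))"
    by (rule br_swap_cong) (rule conj_commute)
  then show ?thesis unfolding br_D_X by (auto simp: sg_def ep_def)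
qed

text \<open>\<open>Lop a b\<close> is the derivation extending left multiplication by a matrix unit
  to polynomials: it replaces the first index \<open>b\<close> of a variable by
  \<open>a\<close>.\<close>

lemma br_L_X: "e \<in> B \<Longrightarrow> br (ep a b \<and> ep c e) (Lop a b) (X c e) = (if b = c then X a e else 0)"
proof -
  assume e: "e \<in> B"
  have "br (ep a b \<and> ep c e) (X a f * DD b f) (X c e) = (if f = e then if b = c then X a e else 0 else 0)" for f
  proof -
    have s: "(ep a b \<and> ep c e) = ((ep a f \<and> ep c e) \<noteq> (ep b f \<and> ep c e))" by (auto simp: ep_def)
    show ?thesis unfolding s br_mult_left br_D_X br_X_X by auto
  qed
  then show ?thesis using e by (simp add: Lop_def br_sum_left)
qed

lemma br_L_D: "e \<in> B \<Longrightarrow> br (ep a b \<and> ep c e) (Lop a b) (DD c e) = (if a = c then - (sg (ep a b \<and> ep c e) * DD b e) else 0)"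
proof -
  assume e: "e \<in> B"
  have "br (ep a b \<and> ep c e) (X a f * DD b f) (DD c e)
     = (if f = e then if a = c then - (sg (ep a b \<and> ep c e) * DD b e) else 0 else 0)" for f
  proof -
    have s: "(ep a b \<and> ep c e) = ((ep a f \<and> ep c e) \<noteq> (ep b f \<and> ep c e))" by (auto simp: ep_def)
    show ?thesis unfolding s br_mult_left br_D_D br_X_D
      by (cases "bp a"; cases "bp b"; cases "bp e") (auto simp: sg_def ep_def)
  qed
  then show ?thesis using e by (simp add: Lop_def br_sum_left)
qed

lemma br_R_X: "c \<in> B \<Longrightarrow> br (ep a b \<and> ep c e) (Rop a b) (X c e) = (if e = a then sg (ep c a \<and> ep a b) * X c b else 0)"
proof -
  assume c: "c \<in> B"
  have "br (ep a b \<and> ep c e) (sg (ep f a \<and> ep a b) * (X f b * DD f a)) (X c e)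
     = (if f = c then if e = a then sg (ep c a \<and> ep a b) * X c b else 0 else 0)" for f
  proof -
    have s: "(ep a b \<and> ep c e) = ((ep f b \<and> ep c e) \<noteq> (ep f a \<and> ep c e))" by (auto simp: ep_def)
    show ?thesis unfolding br_sg_left unfolding s br_mult_left br_D_X br_X_X by (auto simp: sg_def)
  qed
  then show ?thesis using c by (simp add: Rop_def br_sum_left)
qed

lemma br_R_D: "c \<in> B \<Longrightarrow> br (ep a b \<and> ep c e) (Rop a b) (DD c e) =
   (if e = b then - (sg ((ep c a \<and> ep a b) \<noteq> (ep a b \<and> ep c b)) * DD c a) else 0)"
proof -
  assume c: "c \<in> B"
  have "br (ep a b \<and> ep c e) (sg (ep f a \<and> ep a b) * (X f b * DD f a)) (DD c e)
     = (if f = c then if e = b then - (sg ((ep c a \<and> ep a b) \<noteq> (ep a b \<and> ep c b)) * DD c a) else 0 else 0)" for f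
  proof -
    have s: "(ep a b \<and> ep c e) = ((ep f b \<and> ep c e) \<noteq> (ep f a \<and> ep c e))" by (auto simp: ep_def)
    show ?thesis unfolding br_sg_left unfolding s br_mult_left br_D_D br_X_D
      by (cases "bp a"; cases "bp b"; cases "bp c") (auto simp: sg_def ep_def)
  qed
  then show ?thesis using c by (simp add: Rop_def br_sum_left)
qed

lemma br_X_L: assumes "b \<in> B" shows "br (ep a b \<and> ep c e) (X a b) (Lop c e) = (if a = e then - (sg (ep a b \<and> ep c e) * X c b) else 0)"
proof -
  have "br (ep a b \<and> ep c e) (X a b) (Lop c e) = - (sg (ep c e \<and> ep a b) * br (ep c e \<and> ep a b) (Lop c e) (X a b))"
    by (rule br_swap_cong) (rule conj_commute)
  then show ?thesis unfolding br_L_X[OF assms] by (auto simp: sg_def ep_def)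
qed

lemma br_X_R: assumes "a \<in> B" shows "br (ep a b \<and> ep c e) (X a b) (Rop c e) =
   (if b = c then - X a e else 0)"
proof -
  have "br (ep a b \<and> ep c e) (X a b) (Rop c e) = - (sg (ep c e \<and> ep a b) * br (ep c e \<and> ep a b) (Rop c e) (X a b))"
    by (rule br_swap_cong) (rule conj_commute)
  then show ?thesis unfolding br_R_X[OF assms] by (auto simp: sg_def ep_def)
qed

lemma br_L_L:
  "br (ep a b \<and> ep c e) (Lop a b) (Lop c e) =
   (if b = c then Lop a e else 0) - sg (ep a b \<and> ep c e) * (if a = e then Lop c b else 0)"
proof -
  have "br (ep a b \<and> ep c e) (Lop a b) (X c f * DD e f) =
     (if b = c then X a f * DD e f else 0) - sg (ep a b \<and> ep c e) * (if a = e then X c f * DD b f else 0)"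
    if f: "f \<in> B" for f
  proof -
    have s: "(ep a b \<and> ep c e) = ((ep a b \<and> ep c f) \<noteq> (ep a b \<and> ep e f))" by (auto simp: ep_def)
    show ?thesis
      by (subst s, unfold br_mult_right br_L_X[OF f] br_L_D[OF f])
        (cases "bp a"; cases "bp b"; cases "bp c"; cases "bp e"; cases "bp f"; auto simp: sg_def ep_def)
  qed
  then show ?thesis unfolding Lop_def[of c e] br_sum_right
    by (auto simp: Lop_def sum_subtractf sum_distrib_left)
qed

text \<open>Left and right multiplication commute: the two surviving terms, from
  \<open>f = b\<close> and \<open>f = a\<close>, are equal and cancel.\<close>

lemma br_L_R:
  assumes "a \<in> B" "b \<in> B" "c \<in> B" "e \<in> B"
  shows "br (ep a b \<and> ep c e) (Lop a b) (Rop c e) = 0"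
proof -
  have "br (ep a b \<and> ep c e) (Lop a b) (sg (ep f c \<and> ep c e) * (X f e * DD f c)) =
     (if f = b then sg (ep b c \<and> ep c e) * (X a e * DD b c) else 0) -
     (if f = a then sg (ep b c \<and> ep c e) * (X a e * DD b c) else 0)" if "f \<in> B" for f
  proof -
    have s: "(ep a b \<and> ep c e) = ((ep a b \<and> ep f e) \<noteq> (ep a b \<and> ep f c))" by (auto simp: ep_def)
    show ?thesis
      by (subst br_sg_right, subst s, unfold br_mult_right br_L_X[OF assms(4)] br_L_D[OF assms(3)])
        (cases "bp a"; cases "bp b"; cases "bp c"; cases "bp e"; cases "bp f"; auto simp: sg_def ep_def)
  qed
  then show ?thesis unfolding Rop_def br_sum_right using assms by (simp add: sum_subtractf)
qed

lemma br_R_R: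
  assumes "a \<in> B" "b \<in> B" "c \<in> B" "e \<in> B"
  shows "br (ep a b \<and> ep c e) (Rop a b) (Rop c e) =
   - (if b = c then Rop a e else 0) + sg (ep a b \<and> ep c e) * (if a = e then Rop c b else 0)"
proof -
  have "br (ep a b \<and> ep c e) (Rop a b) (sg (ep f c \<and> ep c e) * (X f e * DD f c)) =
     - (if b = c then sg (ep f a \<and> ep a e) * (X f e * DD f a) else 0)
     + sg (ep a b \<and> ep c e) * (if a = e then sg (ep f c \<and> ep c b) * (X f b * DD f c) else 0)"
    if f: "f \<in> B" for f
  proof -
    have s: "(ep a b \<and> ep c e) = ((ep a b \<and> ep f e) \<noteq> (ep a b \<and> ep f c))" by (auto simp: ep_def)
    show ?thesis
      by (subst br_sg_right, subst s, unfold br_mult_right br_R_X[OF f] br_R_D[OF f])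
        (cases "bp a"; cases "bp b"; cases "bp c"; cases "bp e"; cases "bp f"; auto simp: sg_def ep_def)
  qed
  then show ?thesis unfolding Rop_def[of c e] br_sum_right
    by (auto simp: Rop_def sum.distrib sum_negf sum_distrib_left sum_subtractf)
qed

section \<open>Left and right regular actions\<close>

definition EE :: "box \<Rightarrow> box \<Rightarrow> (box \<times> box) multiset op" where
  "EE a b = X a b + Lop a b"

definition RR :: "box \<Rightarrow> box \<Rightarrow> (box \<times> box) multiset op" where
  "RR a b = X a b + Rop a b"

text \<open>The brackets of \<open>X\<close> with \<open>Lop\<close>, taken in both orders, give the
  two halves of the bracket in the variables, and \<open>br_L_L\<close> gives the bracket of the
  derivations.\<close>

lemma br_E_E:
  assumes "a \<in> B" "b \<in> B" "c \<in> B" "e \<in> B"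
  shows "br (ep a b \<and> ep c e) (EE a b) (EE c e) =
    (if b = c then EE a e else 0) - sg (ep a b \<and> ep c e) * (if a = e then EE c b else 0)"
  unfolding EE_def br_add_left br_add_right br_X_X br_X_L[OF assms(2)] br_L_X[OF assms(4)] br_L_L
  by (simp add: algebra_simps)

text \<open>For \<open>b = c\<close> the variable \<open>X a e\<close> arises once from
  \<open>Lop a b\<close> and once from \<open>Rop c e\<close>, with opposite signs.\<close>

lemma br_E_R:
  assumes "a \<in> B" "b \<in> B" "c \<in> B" "e \<in> B"
  shows "br (ep a b \<and> ep c e) (EE a b) (RR c e) = 0"
  unfolding EE_def RR_def br_add_left br_add_right br_X_X br_X_R[OF assms(1)] br_L_X[OF assms(4)] br_L_R[OF assms]
  by simp

lemma DD_vac [simp]: "app (DD a b) vac = 0"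
  by (simp add: vac_def an_single del: single_one)

lemma Lop_vac [simp]: "app (Lop a b) vac = 0"
  by (simp add: Lop_def app_sum_left)

lemma Rop_vac [simp]: "app (Rop a b) vac = 0"
  by (simp add: Rop_def app_sum_left sg_def)

lemma E_vac: "app (EE a b) vac = app (X a b) vac"
  by (simp add: EE_def)

lemma R_vac: "app (RR a b) vac = app (X a b) vac"
  by (simp add: RR_def)

abbreviation "EG \<equiv> Egens k l"
abbreviation "PG \<equiv> Pgens k l"
abbreviation "MG \<equiv> Mgens k l"

definition EV :: "box \<times> box \<Rightarrow> (box \<times> box) multiset op" where
  "EV g = (if g \<in> EG then EE (fst g) (snd g) else 0)"

lemma EV_br:
  assumes "g \<in> EG" "h \<in> EG"
  shows "br (epar bs g \<and> epar bs h) (EV g) (EV h) =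
    (if snd g = fst h then EV (fst g, snd h) else 0)
    - sg (epar bs g \<and> epar bs h) * (if fst g = snd h then EV (fst h, snd g) else 0)"
  using br_E_E[of "fst g" "snd g" "fst h" "snd h"] assms
  by (auto simp: EV_def Egens_def epar_def ep_def mem_Times_iff)

text \<open>The module of \<open>\<pp>\<close> induced from the trivial module of the span of the \<open>e\<^sub>a\<^sub>b\<close> with \<open>a\<close> in columns \<open>\<ge> 2\<close>,
  twisted by the character \<open>\<psi>\<close> so that the shift in \<open>tilde_e\<close> cancels.\<close>

definition \<psi> :: "box \<Rightarrow> complex" where "\<psi> a = - (sgn (bp a) * rho m n l (snd a))"

definition MO :: "box \<Rightarrow> box \<Rightarrow> (box \<times> box) multiset op" where
  "MO a b = (if snd a = 1 then X a b + (if snd b = 1 then Lop a b else 0) else - Rop a b)"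

definition MV :: "box \<times> box \<Rightarrow> (box \<times> box) multiset op" where
  "MV g = (if g \<in> PG then MO (fst g) (snd g) + (if fst g = snd g then sc (\<psi> (fst g)) else 0) else 0)"

text \<open>The letters starting in column 1 span an ideal of \<pp>, on which the other letters act
  by minus right multiplication. For \<open>b\<close> outside column 1 the operator
  \<open>Lop a b\<close> kills polynomials in column 1 variables; leaving it out makes the relations
  hold on the whole Fock space.\<close>

lemma br_MO:
  assumes "a \<in> B" "b \<in> B" "c \<in> B" "e \<in> B" "snd a \<le> snd b" "snd c \<le> snd e"
  shows "br (ep a b \<and> ep c e) (MO a b) (MO c e) =
    (if b = c then MO a e else 0) - sg (ep a b \<and> ep c e) * (if a = e then MO c b else 0)"
proof -
  have "1 \<le> snd a" "1 \<le> snd c" using assms by (auto simp: boxes_def)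
  note eqs = br_X_X br_X_L[OF assms(2)] br_L_X[OF assms(4)] br_L_L br_X_R[OF assms(1)] br_L_R[OF assms(1-4)]
    br_R_R[OF assms(1-4)] br_R_X[OF assms(3)]
  have s: "(ep a b \<and> ep c e) = (ep c e \<and> ep a b)" by (rule conj_commute)
  have XR: "br (ep a b \<and> ep c e) (X c e) (Rop a b) = (if e = a then - X c b else 0)"
    by (subst s) (rule br_X_R[OF assms(3)])
  have LR: "br (ep a b \<and> ep c e) (Lop c e) (Rop a b) = 0"
    by (subst s) (rule br_L_R[OF assms(3,4,1,2)])
  have RX: "br (ep a b \<and> ep c e) (Rop a b) (X c e) = sg (ep a b \<and> ep c e) * (if e = a then X c b else 0)"
    unfolding br_swap[of _ "Rop a b"] XR by simp
  have RL: "br (ep a b \<and> ep c e) (Rop a b) (Lop c e) = 0"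
    unfolding br_swap[of _ "Rop a b"] LR by simp
  have L: "br (ep a b \<and> ep c e) (X a b) (Lop c e) = - (sg (ep a b \<and> ep c e) * (if a = e then X c b else 0))"
    unfolding br_X_L[OF assms(2)] by simp
  \<comment> \<open>\<open>c\<close> marks a letter starting in column 1 and \<open>q\<close> one
    starting further right. The latter also ends outside column 1, so a mixed product is nonzero in
    one order only.\<close>
  consider (cc) "snd a = 1" "snd c = 1" | (cq) "snd a = 1" "snd c \<noteq> 1" "snd e \<noteq> 1" "c \<noteq> a"
    | (qc) "snd a \<noteq> 1" "snd b \<noteq> 1" "snd c = 1" "c \<noteq> a" | (qq) "snd a \<noteq> 1" "snd b \<noteq> 1" "snd c \<noteq> 1" "snd e \<noteq> 1"
    using assms(5,6) \<open>1 \<le> snd a\<close> \<open>1 \<le> snd c\<close> by force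
  then show ?thesis
  proof cases
    case cc
    then show ?thesis
      by (cases "snd b = 1"; cases "snd e = 1"; simp only: MO_def if_True if_False br_add_left br_add_right
           L br_X_X br_L_X[OF assms(4)] br_L_L; auto simp: algebra_simps)
  next
    case cq
    then show ?thesis
      by (cases "snd b = 1"; simp only: MO_def if_True if_False br_add_left br_uminus_right eqs; auto)
  next
    case qc
    then show ?thesis
      by (cases "snd e = 1"; simp only: MO_def if_True if_False br_add_right br_uminus_left RX RL; auto)
  next
    case qq
    then show ?thesis
      by (simp only: MO_def if_True if_False br_uminus_left br_uminus_right eqs; auto)
  qed
qed

lemma PG_sub: "g \<in> PG \<Longrightarrow> g \<in> EG" and MG_sub: "g \<in> MG \<Longrightarrow> g \<in> EG"
  by (auto simp: Pgens_def Mgens_def)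

lemma EG_iff: "(a, b) \<in> EG \<longleftrightarrow> a \<in> B \<and> b \<in> B"
  and PG_iff: "(a, b) \<in> PG \<longleftrightarrow> a \<in> B \<and> b \<in> B \<and> snd a \<le> snd b"
  and MG_iff: "(a, b) \<in> MG \<longleftrightarrow> a \<in> B \<and> b \<in> B \<and> snd b < snd a"
  by (auto simp: Egens_def Pgens_def Mgens_def)

lemma br_sc: "br s A (sc c) = (if s then 2 * sc c * A else 0)" "br s (sc c) A = (if s then 2 * sc c * A else 0)"
  by (simp_all add: br_def sg_def sc_comm[of A] algebra_simps mult_2)

text \<open>Adding \<psi> keeps the relations: a bracket has a diagonal part only if
  \<open>b = c\<close> and \<open>a = e\<close>, then both boxes lie in one column, and there \<psi>
  is a multiple of the supertrace, which vanishes on brackets.\<close>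

lemma MV_br:
  assumes "g \<in> PG" "h \<in> PG"
  shows "br (epar bs g \<and> epar bs h) (MV g) (MV h) =
    (if snd g = fst h then MV (fst g, snd h) else 0)
    - sg (epar bs g \<and> epar bs h) * (if fst g = snd h then MV (fst h, snd g) else 0)"
proof -
  obtain a b c e where gh: "g = (a, b)" "h = (c, e)" by (metis surj_pair)
  have B: "a \<in> B" "b \<in> B" "c \<in> B" "e \<in> B" "snd a \<le> snd b" "snd c \<le> snd e"
    using assms by (auto simp: gh PG_iff)
  have z: "br (ep a b \<and> ep c e) A (if c = e then sc (\<psi> c) else 0) = 0"
    "br (ep a b \<and> ep c e) (if a = b then sc (\<psi> a) else 0) A = 0" for A
    by (auto simp: br_sc ep_def)
  have "br (ep a b \<and> ep c e) (MV g) (MV h) = br (ep a b \<and> ep c e) (MO a b) (MO c e)"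
    using B by (simp only: MV_def gh fst_conv snd_conv PG_iff simp_thms if_True br_add_left br_add_right z add_0_right)
  also have "\<dots> = (if b = c then MO a e else 0) - sg (ep a b \<and> ep c e) * (if a = e then MO c b else 0)"
    by (rule br_MO[OF B])
  also have "\<dots> = (if b = c then MV (a, e) else 0) - sg (ep a b \<and> ep c e) * (if a = e then MV (c, b) else 0)"
  proof (cases "b = c \<and> a = e")
    case True
    then have "snd a = snd b" using B by simp
    then have "(sc (\<psi> a) :: (box \<times> box) multiset op) = sg (ep a b) * sc (\<psi> b)"
      by (cases "bp a"; cases "bp b") (simp_all add: \<psi>_def ep_def sg_def sgn_def sc_simps)
    moreover have "b = c" "a = e" using True by auto
    ultimately show ?thesis using B by (cases "bp a"; cases "bp b") (simp_all add: MV_def PG_iff ep_def sg_def algebra_simps)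
  next
    case False
    then show ?thesis using B by (auto simp: MV_def PG_iff)
  qed
  finally show ?thesis by (simp add: gh epar_pair)
qed

lemma fspan_U_rel: "U_rel bs x y \<in> fspan UNIV"
  by (auto simp: U_rel_def fgen_def intro!: fspan_fsub fspan_fsmul split: prod.splits)

lemma ev_U_rel: "ev F (U_rel bs x y) = br (epar bs x \<and> epar bs y) (F x) (F y)
    - ((if snd x = fst y then F (fst x, snd y) else 0)
    - sg (epar bs x \<and> epar bs y) * (if snd y = fst x then F (fst y, snd x) else 0))"
proof -
  obtain a b c e where gh: "x = (a, b)" "y = (c, e)" by (metis surj_pair)
  have i: "(if P then fgen z else fzero) \<in> fspan UNIV" "ev F (if P then fgen z else fzero) = (if P then F z else 0)"
    for P and z :: "box \<times> box" by (auto simp: fgen_def)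
  have j: "fgen z \<in> fspan UNIV" "ev F (fgen z) = F z" for z :: "box \<times> box" by (auto simp: fgen_def)
  show ?thesis
    unfolding gh U_rel_def prod.case fst_conv snd_conv
    by (simp add: ev_fsub ev_fsmul ev_fmul i j fspan_fsub fspan_fsmul fspan_fmul br_def sc_sgn)
qed

lemma EV_U_rel: "x \<in> EG \<Longrightarrow> y \<in> EG \<Longrightarrow> ev EV (U_rel bs x y) = 0"
  unfolding ev_U_rel using EV_br[of x y] by auto

lemma MV_U_rel: "x \<in> PG \<Longrightarrow> y \<in> PG \<Longrightarrow> ev MV (U_rel bs x y) = 0"
  unfolding ev_U_rel using MV_br[of x y] by auto

end

section \<open>The PBW theorem\<close>

text \<open>Congruence to some combination of words in \<open>S\<close>. For two-sided ideals it is
  stable under linear combinations, so straightening can be followed without naming normal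
  forms.\<close>

definition reducible :: "'x list set \<Rightarrow> 'x fa set \<Rightarrow> 'x fa \<Rightarrow> bool" where
  "reducible S I h \<longleftrightarrow> (\<exists>f \<in> fspan S. fsub h f \<in> I)"

lemma reducible_fmono: "w \<in> S \<Longrightarrow> reducible S (two_ideal G) (fmono w)"
  unfolding reducible_def
  by (rule bexI[of _ "fmono w"]) (auto simp: fsub_def two_ideal.zero fzero_def[symmetric])

lemma reducible_ideal: "h \<in> I \<Longrightarrow> reducible S I h"
  unfolding reducible_def by (rule bexI[of _ fzero]) (simp_all, simp add: fsub_def fzero_def)

lemma reducible_fadd:
  assumes "reducible S (two_ideal G) h" "reducible S (two_ideal G) h'"
  shows "reducible S (two_ideal G) (fadd h h')"
proof -
  obtain f f' where f: "f \<in> fspan S" "f' \<in> fspan S" "fsub h f \<in> two_ideal G" "fsub h' f' \<in> two_ideal G"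
    using assms by (auto simp: reducible_def)
  have "fsub (fadd h h') (fadd f f') = fadd (fsub h f) (fsub h' f')"
    by (auto simp: fsub_def fadd_def)
  then show ?thesis unfolding reducible_def using f
    by (intro bexI[of _ "fadd f f'"]) (auto intro: two_ideal.add)
qed

lemma reducible_fsmul:
  assumes "reducible S (two_ideal G) h"
  shows "reducible S (two_ideal G) (fsmul c h)"
proof -
  obtain f where f: "f \<in> fspan S" "fsub h f \<in> two_ideal G"
    using assms by (auto simp: reducible_def)
  have "fsub (fsmul c h) (fsmul c f) = fsmul c (fsub h f)"
    by (auto simp: fsub_def fsmul_def algebra_simps)
  then show ?thesis unfolding reducible_def using f
    by (intro bexI[of _ "fsmul c f"]) (auto intro: two_ideal.smul)
qed

lemma reducible_fsub:
  "reducible S (two_ideal G) h \<Longrightarrow> reducible S (two_ideal G) h' \<Longrightarrow> reducible S (two_ideal G) (fsub h h')"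
  unfolding fsub_fadd by (intro reducible_fadd reducible_fsmul)

lemma reducible_fspan:
  assumes "f \<in> fspan T" "\<And>w. w \<in> T \<Longrightarrow> reducible S (two_ideal G) (fmono w)"
  shows "reducible S (two_ideal G) f"
  using assms(1)
  by (induction rule: fspan_induct)
    (auto intro: assms(2) reducible_fadd reducible_fsmul reducible_ideal two_ideal.zero)

section \<open>Degrees of words, monomials and operators\<close>

definition wdeg :: "('x \<Rightarrow> int) \<Rightarrow> 'x list \<Rightarrow> int" where "wdeg D w = sum_list (map D w)"
definition mdeg :: "('x \<Rightarrow> int) \<Rightarrow> 'x multiset \<Rightarrow> int" where "mdeg D \<alpha> = (\<Sum>g\<in>#\<alpha>. D g)"

lemma mdeg_simps [simp]: "mdeg D {#} = 0" "mdeg D (add_mset g \<alpha>) = D g + mdeg D \<alpha>"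
  by (simp_all add: mdeg_def)

lemma wdeg_simps [simp]: "wdeg D [] = 0" "wdeg D (g # w) = D g + wdeg D w" "wdeg D (u @ v) = wdeg D u + wdeg D v"
  by (simp_all add: wdeg_def)

lemma mdeg_mset [simp]: "mdeg D (mset w) = wdeg D w"
  by (induction w) auto

definition odeg :: "('x \<Rightarrow> int) \<Rightarrow> int \<Rightarrow> 'x multiset op \<Rightarrow> bool" where
  "odeg D e A \<longleftrightarrow> (\<forall>d. \<forall>v \<in> Fil (mdeg D) d. app A v \<in> Fil (mdeg D) (d + e))"

lemmas Fil_closed = cvs.subspace_0[OF Fil_subspace] cvs.subspace_add[OF Fil_subspace]
  cvs.subspace_diff[OF Fil_subspace] cvs.subspace_neg[OF Fil_subspace] cvs.subspace_scale[OF Fil_subspace]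

lemma Fil_sum: "(\<And>i. i \<in> I \<Longrightarrow> f i \<in> Fil D d) \<Longrightarrow> (\<Sum>i\<in>I. f i) \<in> Fil D d"
  by (induction I rule: infinite_finite_induct) (auto intro: Fil_closed)

lemma odeg_cr: "odeg D (D g) (cr par g)"
  unfolding odeg_def
proof (intro allI ballI)
  fix d v assume v: "v \<in> Fil (mdeg D) d"
  show "app (cr par g) v \<in> Fil (mdeg D) (d + D g)"
    unfolding Fil_iff
  proof (intro allI impI)
    fix \<alpha> assume nz: "lookup (app (cr par g) v) \<alpha> \<noteq> 0"
    then have "g \<in># \<alpha>" using lookup_cr_notin by blast
    then obtain \<beta> where a: "\<alpha> = add_mset g \<beta>" by (metis insert_DiffM)
    then have "lookup v \<beta> \<noteq> 0" using nz by (auto simp: lookup_cr_add split: if_splits)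
    then show "mdeg D \<alpha> \<le> d + D g" using v a by (auto simp: Fil_iff)
  qed
qed

lemma odeg_an: "odeg D (- D g) (an par g)"
  unfolding odeg_def
proof (intro allI ballI)
  fix d v assume v: "v \<in> Fil (mdeg D) d"
  show "app (an par g) v \<in> Fil (mdeg D) (d + - D g)"
    unfolding Fil_iff
  proof (intro allI impI)
    fix \<alpha> assume nz: "lookup (app (an par g) v) \<alpha> \<noteq> 0"
    then have "lookup v (add_mset g \<alpha>) \<noteq> 0" by (auto simp: lookup_an split: if_splits)
    then show "mdeg D \<alpha> \<le> d + - D g" using v by (force simp: Fil_iff)
  qed
qed

lemma odeg_mult: "odeg D e A \<Longrightarrow> odeg D f B \<Longrightarrow> odeg D (e + f) (A * B)"
  unfolding odeg_def by (metis app_simps(6) add.commute add.left_commute)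

lemma odeg_add: "odeg D e A \<Longrightarrow> odeg D e B \<Longrightarrow> odeg D e (A + B)"
  unfolding odeg_def by (auto intro: Fil_closed)

lemma odeg_uminus: "odeg D e A \<Longrightarrow> odeg D e (- A)"
  unfolding odeg_def by (auto intro: Fil_closed)

lemma odeg_zero [simp]: "odeg D e 0"
  unfolding odeg_def by (auto intro: Fil_closed)

lemma odeg_sc: "odeg D 0 (sc c)"
  unfolding odeg_def by (auto intro: Fil_closed)

lemma odeg_mono: "odeg D e A \<Longrightarrow> e \<le> f \<Longrightarrow> odeg D f A"
  unfolding odeg_def by (meson Fil_mono add_left_mono)

lemma odeg_sum: "(\<And>i. i \<in> I \<Longrightarrow> odeg D e (A i)) \<Longrightarrow> odeg D e (\<Sum>i\<in>I. A i)"
  by (induction I rule: infinite_finite_induct) (auto intro: odeg_add)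

lemma odeg_sg: "odeg D e A \<Longrightarrow> odeg D e (sg s * A)"
  by (auto simp: sg_def odeg_uminus)

lemma odegD: "odeg D e A \<Longrightarrow> v \<in> Fil (mdeg D) d \<Longrightarrow> d + e = d' \<Longrightarrow> app A v \<in> Fil (mdeg D) d'"
  unfolding odeg_def by auto

lemma vac_Fil: "vac \<in> Fil (mdeg D) 0"
  unfolding vac_def Fil_iff by (auto simp: lookup_single when_def simp del: single_one)

text \<open>Replacing the operators one after another by their leading parts, every difference
  contains one factor \<open>A g - Bo g\<close> and so loses a degree. Used for the actions on both
  modules and for the elements \<open>t\<close>.\<close>

lemma lead_word:
  assumes "\<And>g. g \<in> S \<Longrightarrow> odeg D (D g) (Bo g)" "\<And>g. g \<in> S \<Longrightarrow> odeg D (D g - 1) (A g - Bo g)" "set w \<subseteq> S"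
  shows "app (prod_list (map A w)) vac \<in> Fil (mdeg D) (wdeg D w) \<and>
         app (prod_list (map Bo w)) vac \<in> Fil (mdeg D) (wdeg D w) \<and>
         app (prod_list (map A w)) vac - app (prod_list (map Bo w)) vac \<in> Fil (mdeg D) (wdeg D w - 1)"
  using assms(3)
proof (induction w)
  case Nil
  then show ?case by (simp add: vac_Fil Fil_closed)
next
  case (Cons g w)
  let ?a = "app (prod_list (map A w)) vac" and ?b = "app (prod_list (map Bo w)) vac"
  have IH: "?a \<in> Fil (mdeg D) (wdeg D w)" "?b \<in> Fil (mdeg D) (wdeg D w)" "?a - ?b \<in> Fil (mdeg D) (wdeg D w - 1)"
    and g: "g \<in> S" using Cons by auto
  note g = assms(1)[OF g] assms(2)[OF g]
  have 1: "app (Bo g) ?b \<in> Fil (mdeg D) (D g + wdeg D w)" by (rule odegD[OF g(1) IH(2)]) simp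
  have 2: "app (Bo g) (?a - ?b) \<in> Fil (mdeg D) (D g + wdeg D w - 1)" by (rule odegD[OF g(1) IH(3)]) simp
  have 3: "app (A g - Bo g) ?a \<in> Fil (mdeg D) (D g + wdeg D w - 1)" by (rule odegD[OF g(2) IH(1)]) simp
  have eq: "app (A g) ?a - app (Bo g) ?b = app (A g - Bo g) ?a + app (Bo g) (?a - ?b)" by (simp add: app_diff)
  have 4: "app (A g) ?a - app (Bo g) ?b \<in> Fil (mdeg D) (D g + wdeg D w - 1)" unfolding eq by (rule Fil_closed(2)[OF 3 2])
  then have "(app (A g) ?a - app (Bo g) ?b) + app (Bo g) ?b \<in> Fil (mdeg D) (D g + wdeg D w)"
    by (intro Fil_closed(2) 1 Fil_mono[OF 4]) simp
  then show ?case using 1 4 by simp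
qed

context rect
begin

text \<open>Stability under the matrix product, hence under brackets. Straightening is needed inside
  \<gg>, \<pp> and \<mm> separately: \<open>MV\<close> respects the relations only inside \<pp>, and
  \<chi> only inside \<mm>, so the ideal must not leave the subalgebra.\<close>

definition closed_gens :: "(box \<times> box) set \<Rightarrow> bool" where
  "closed_gens G \<longleftrightarrow> (\<forall>g\<in>G. \<forall>h\<in>G. snd g = fst h \<longrightarrow> (fst g, snd h) \<in> G)"

lemma closed_gens [simp]: "closed_gens EG" "closed_gens PG" "closed_gens MG"
  by (auto simp: closed_gens_def EG_iff PG_iff MG_iff)

definition Urels :: "(box \<times> box) set \<Rightarrow> (box \<times> box) fa set" where
  "Urels G = {U_rel bs x y |x y. x \<in> G \<and> y \<in> G}"

lemma Urels_I: "x \<in> G \<Longrightarrow> y \<in> G \<Longrightarrow> U_rel bs x y \<in> Urels G"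
  unfolding Urels_def by blast

lemma IU_eq: "IU bs k l = two_ideal (Urels EG)"
  by (simp add: IU_def Urels_def)

lemma U_rel_word: "fmul (fmul (fmono u) (U_rel bs x y)) (fmono v) =
   fsub (fsub (fmono (u @ [x, y] @ v)) (fsmul (sgn (epar bs x \<and> epar bs y)) (fmono (u @ [y, x] @ v))))
     (fsub (if snd x = fst y then fmono (u @ [(fst x, snd y)] @ v) else fzero)
        (fsmul (sgn (epar bs x \<and> epar bs y)) (if snd y = fst x then fmono (u @ [(fst y, snd x)] @ v) else fzero)))"
  by (cases x; cases y) (simp add: U_rel_def fgen_def fmul_simps)

lemma U_reducible:
  assumes "closed_gens G" "set w \<subseteq> G"
  shows "reducible {w. set w \<subseteq> G \<and> good (epar bs) w} (two_ideal (Urels G)) (fmono w)"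
proof -
  let ?R = "reducible {w. set w \<subseteq> G \<and> good (epar bs) w} (two_ideal (Urels G))"
  have "set w \<subseteq> G \<longrightarrow> ?R (fmono w)"
  proof (induction w rule: word_sort_induct[where par = "epar bs" and meas = length])
    case (good w)
    then show ?case by (auto intro: reducible_fmono)
  next
    case (swap u x y v)
    show ?case
    proof
      assume sub: "set (u @ [x, y] @ v) \<subseteq> G"
      let ?r = "fmul (fmul (fmono u) (U_rel bs x y)) (fmono v)" and ?s = "sgn (epar bs x \<and> epar bs y)"
      let ?p = "fsub (if snd x = fst y then fmono (u @ [(fst x, snd y)] @ v) else fzero)
        (fsmul ?s (if snd y = fst x then fmono (u @ [(fst y, snd x)] @ v) else fzero))"
      have r: "?R ?r" by (intro reducible_ideal two_ideal.gen Urels_I) (use sub in auto)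
      have "?R (if snd x = fst y then fmono (u @ [(fst x, snd y)] @ v) else fzero)"
        using swap(1)[of "u @ [(fst x, snd y)] @ v"] sub assms(1)
        by (auto simp: closed_gens_def intro: reducible_ideal two_ideal.zero)
      moreover have "?R (if snd y = fst x then fmono (u @ [(fst y, snd x)] @ v) else fzero)"
        using swap(1)[of "u @ [(fst y, snd x)] @ v"] sub assms(1)
        by (auto simp: closed_gens_def intro: reducible_ideal two_ideal.zero)
      ultimately have p: "?R ?p" by (intro reducible_fsub reducible_fsmul)
      have q: "?R (fmono (u @ [y, x] @ v))" using swap(2) sub by auto
      have "fmono (u @ [x, y] @ v) = fadd ?r (fadd (fsmul ?s (fmono (u @ [y, x] @ v))) ?p)"
        unfolding U_rel_word by (simp add: fadd_def fsub_def fsmul_def)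
      then show "?R (fmono (u @ [x, y] @ v))"
        using reducible_fadd[OF r reducible_fadd[OF reducible_fsmul[OF q] p]] by simp
    qed
  next
    case (dup u x v)
    show ?case
    proof
      assume sub: "set (u @ [x, x] @ v) \<subseteq> G"
      let ?r = "fmul (fmul (fmono u) (U_rel bs x x)) (fmono v)"
      have r: "?R ?r" by (intro reducible_ideal two_ideal.gen Urels_I) (use sub in auto)
      \<comment> \<open>An odd matrix unit is off-diagonal, so \<open>[x, x]\<close> has no
        correction term and twice the square lies in the ideal.\<close>
      have "fst x \<noteq> snd x" using dup(2) by (auto simp: epar_def)
      then have "fmono (u @ [x, x] @ v) = fsmul (1/2) ?r"
        unfolding U_rel_word using dup(2) by (simp add: fadd_def fsub_def fsmul_def sgn_def fzero_def)
      then show "?R (fmono (u @ [x, x] @ v))" using reducible_fsmul[OF r] by simp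
    qed
  qed simp
  then show ?thesis using assms by simp
qed

lemma U_reducible_fspan:
  assumes "closed_gens G" "f \<in> fspan {w. set w \<subseteq> G}"
  obtains f' where "f' \<in> fspan {w. set w \<subseteq> G \<and> good (epar bs) w}" "fsub f f' \<in> two_ideal (Urels G)"
  using reducible_fspan[OF assms(2) U_reducible[OF assms(1)]] by (auto simp: reducible_def)

lemma ev_Urels:
  assumes "a \<in> two_ideal (Urels G)" "\<And>x y. x \<in> G \<Longrightarrow> y \<in> G \<Longrightarrow> ev F (U_rel bs x y) = 0"
  shows "a \<in> fspan UNIV" "ev F a = 0"
proof -
  have "g \<in> fspan UNIV \<and> ev F g = 0" if "g \<in> Urels G" for g
    using that assms(2) fspan_U_rel unfolding Urels_def by blast
  from two_ideal_ev[OF assms(1) this] show "a \<in> fspan UNIV" "ev F a = 0" by auto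
qed

lemma kdeg_pair: "kdeg (a, b) = int (snd b) - int (snd a) + 1"
  by (simp add: kdeg_def)

abbreviation "F \<equiv> Fil (mdeg kdeg)"

text \<open>For every \<open>c\<close>, \<open>kdeg (a, c) - kdeg (b, c) = kdeg (a, b) - 1\<close>.
  This one degree separates multiplication by the variable from the derivation.\<close>

lemma odeg_L: "odeg kdeg (kdeg (a, b) - 1) (Lop a b)"
  unfolding Lop_def
proof (rule odeg_sum)
  fix c
  show "odeg kdeg (kdeg (a, b) - 1) (X a c * DD b c)"
    by (rule odeg_mono[OF odeg_mult[OF odeg_cr odeg_an]]) (simp add: kdeg_pair)
qed

lemma odeg_R: "odeg kdeg (kdeg (a, b) - 1) (Rop a b)"
  unfolding Rop_def
proof (intro odeg_sum odeg_sg)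
  fix c
  show "odeg kdeg (kdeg (a, b) - 1) (X c b * DD c a)"
    by (rule odeg_mono[OF odeg_mult[OF odeg_cr odeg_an]]) (simp add: kdeg_pair)
qed

text \<open>The leading part of \<open>MV\<close>: letters starting outside column 1 act as
  derivations or scalars and have none.\<close>

definition MB :: "box \<times> box \<Rightarrow> (box \<times> box) multiset op" where
  "MB g = (if snd (fst g) = 1 then cr (epar bs) g else 0)"

lemma EV_lead: "g \<in> EG \<Longrightarrow> odeg kdeg (kdeg g - 1) (EV g - cr (epar bs) g)"
  using odeg_L[of "fst g" "snd g"] by (simp add: EV_def EE_def)

lemma MB_odeg: "odeg kdeg (kdeg g) (MB g)"
  by (simp add: MB_def odeg_cr)

lemma MV_lead: assumes "g \<in> PG" shows "odeg kdeg (kdeg g - 1) (MV g - MB g)"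
proof -
  have "odeg kdeg (kdeg g - 1) (if fst g = snd g then sc (\<psi> (fst g)) else 0)"
    using odeg_mono[OF odeg_sc] by (auto simp: kdeg_def)
  moreover have "odeg kdeg (kdeg g - 1) (MO (fst g) (snd g) - MB g)"
    using odeg_L[of "fst g" "snd g"] odeg_R[of "fst g" "snd g"] by (auto simp: MO_def MB_def intro: odeg_uminus)
  ultimately have "odeg kdeg (kdeg g - 1) ((MO (fst g) (snd g) - MB g) + (if fst g = snd g then sc (\<psi> (fst g)) else 0))"
    by (rule odeg_add[rotated])
  then show ?thesis using assms by (simp add: MV_def algebra_simps)
qed

abbreviation "XW w \<equiv> app (prod_list (map (cr (epar bs)) w)) vac"
abbreviation "EW w \<equiv> app (prod_list (map EV w)) vac"
abbreviation "MW w \<equiv> app (prod_list (map MV w)) vac"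

lemma EW_lead: "set w \<subseteq> EG \<Longrightarrow> EW w \<in> F (wdeg kdeg w) \<and> XW w \<in> F (wdeg kdeg w) \<and> EW w - XW w \<in> F (wdeg kdeg w - 1)"
  using lead_word[where S = EG and A = EV and Bo = "cr (epar bs)" and D = kdeg and w = w] EV_lead odeg_cr
  by blast

lemma MW_lead: "set w \<subseteq> PG \<Longrightarrow> MW w \<in> F (wdeg kdeg w) \<and> MW w - app (prod_list (map MB w)) vac \<in> F (wdeg kdeg w - 1)"
  using lead_word[where S = PG and A = MV and Bo = MB and D = kdeg and w = w] MV_lead MB_odeg
  by blast

lemma good_cr_word: "good (epar bs) w \<Longrightarrow> \<exists>\<epsilon>. \<epsilon> \<noteq> 0 \<and> XW w = single (mset w) \<epsilon>"
  by (rule cr_word) (rule good_count)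

lemma app_ev: "app (ev E f) v = (\<Sum>w | f w \<noteq> 0. scl (f w) (app (prod_list (map E w)) v))"
  by (simp add: ev_def app_sum_left)

text \<open>With \<open>d\<close> below all degrees this is linear independence; in general, no
  combination of sorted words has smaller degree than a word occurring in it.\<close>

lemma good_independent:
  assumes f: "f \<in> fspan {w. set w \<subseteq> EG \<and> good (epar bs) w}" and d: "app (ev EV f) vac \<in> F d" and w: "f w \<noteq> 0"
  shows "wdeg kdeg w \<le> d"
proof -
  have fin: "finite {w. f w \<noteq> 0}" and S: "\<And>w. f w \<noteq> 0 \<Longrightarrow> set w \<subseteq> EG \<and> good (epar bs) w"
    using f by (auto simp: fspan_def)
  have "mdeg kdeg (mset w) \<le> d"
  proof (rule triangular[where A = "{w. f w \<noteq> 0}" and b = EW and c = f])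
    show "inj_on mset {w. f w \<noteq> 0}" using S by (auto intro!: inj_onI dest: good_mset_inj)
    show "(\<Sum>w\<in>{w. f w \<noteq> 0}. scl (f w) (EW w)) \<in> F d" using d by (simp add: app_ev)
    fix w assume "w \<in> {w. f w \<noteq> 0}"
    then have w: "set w \<subseteq> EG" "good (epar bs) w" using S by auto
    from good_cr_word[OF w(2)] obtain \<epsilon> where "\<epsilon> \<noteq> 0" "XW w = single (mset w) \<epsilon>" by blast
    then show "\<exists>\<epsilon>. \<epsilon> \<noteq> 0 \<and> EW w - single (mset w) \<epsilon> \<in> F (mdeg kdeg (mset w) - 1)"
      using EW_lead[OF w(1)] by (intro exI[of _ \<epsilon>]) simp
  qed (use fin w in auto)
  then show ?thesis by simp
qed

text \<open>Sorted words span modulo the ideal and have distinct leading monomials. In particular an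
  element that kills the vacuum lies in the ideal and hence acts as zero on the whole Fock
  space.\<close>

lemma IU_iff:
  assumes "f \<in> Ucar k l"
  shows "f \<in> IU bs k l \<longleftrightarrow> app (ev EV f) vac = 0" and "app (ev EV f) vac = 0 \<longleftrightarrow> ev EV f = 0"
proof -
  have f: "f \<in> fspan {w. set w \<subseteq> EG}" using assms by (simp add: Ucar_def)
  have 1: "ev EV f = 0" if "f \<in> IU bs k l"
    using that EV_U_rel unfolding IU_eq by (rule ev_Urels(2))
  have 2: "f \<in> IU bs k l" if z: "app (ev EV f) vac = 0"
  proof -
    obtain f' where f': "f' \<in> fspan {w. set w \<subseteq> EG \<and> good (epar bs) w}" "fsub f f' \<in> two_ideal (Urels EG)"
      using U_reducible_fspan[OF closed_gens(1) f] .
    have "ev EV f = ev EV f'"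
      using ev_Urels(2)[OF f'(2), of EV] EV_U_rel fspan_UNIV[OF f] fspan_UNIV[OF f'(1)] by (simp add: ev_fsub)
    then have z': "app (ev EV f') vac = 0" using z by simp
    have "f' w = 0" for w
    proof (rule ccontr)
      assume w: "f' w \<noteq> 0"
      have "app (ev EV f') vac \<in> F (wdeg kdeg w - 1)" using z' by (simp add: Fil_closed)
      from good_independent[OF f'(1) this w] show False by simp
    qed
    then have "fsub f f' = f" by (simp add: fsub_def)
    then show ?thesis using f' by (simp add: IU_eq)
  qed
  show "f \<in> IU bs k l \<longleftrightarrow> app (ev EV f) vac = 0" using 1 2 by auto
  show "app (ev EV f) vac = 0 \<longleftrightarrow> ev EV f = 0" using 1 2 by auto
qed

section \<open>Symbols in the small module\<close>

definition cpart :: "(box \<times> box) multiset op" where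
  "cpart = rst (\<lambda>\<alpha>. \<forall>g\<in>#\<alpha>. snd (fst g) = 1)"

lemma MB_cpart: "MB g * cpart = cpart * cr (epar bs) g"
  by (rule op_eqI) (simp add: MB_def cpart_def cr_single)

lemma MB_word: "app (prod_list (map MB w)) vac = app cpart (XW w)"
proof (induction w)
  case Nil
  then show ?case by (simp add: cpart_def vac_def del: single_one)
next
  case (Cons g w)
  have "app (prod_list (map MB (g # w))) vac = app (MB g * cpart) (XW w)" using Cons by simp
  then show ?case unfolding MB_cpart by simp
qed

abbreviation cmp where "cmp d \<equiv> rst (\<lambda>\<alpha>. mdeg kdeg \<alpha> = d)"

lemma comp_low: "v \<in> F (d - 1) \<Longrightarrow> app (cmp d) v = 0"
  using Fil_top_zero[of v "mdeg kdeg" d] Fil_mono[of v "mdeg kdeg" "d - 1" d] by auto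

lemma comp_cpart: "cmp d * cpart = cpart * cmp d"
  by (rule op_eqI) (simp add: cpart_def)

text \<open>Both actions are evaluated on one combination \<open>f'\<close> of sorted words, whose
  degrees \<open>good_independent\<close> bounds by \<open>d\<close>. So no higher terms are hidden
  in \<open>f'\<close>, only words of degree exactly \<open>d\<close> count, and on these
  \<open>MB\<close> keeps the column 1 variables.\<close>

lemma M_symbol:
  assumes f: "f \<in> fspan {w. set w \<subseteq> PG}" and d: "app (ev EV f) vac \<in> F d"
  shows "app (ev MV f) vac \<in> F d" "app (cmp d) (app (ev MV f) vac) = app cpart (app (cmp d) (app (ev EV f) vac))"
proof -
  obtain f' where f': "f' \<in> fspan {w. set w \<subseteq> PG \<and> good (epar bs) w}" "fsub f f' \<in> two_ideal (Urels PG)"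
    using U_reducible_fspan[OF closed_gens(2) f] .
  have e: "ev EV f = ev EV f'" "ev MV f = ev MV f'"
    using ev_Urels(2)[OF f'(2), of EV] EV_U_rel PG_sub MV_U_rel ev_Urels(2)[OF f'(2), of MV]
      fspan_UNIV[OF f] fspan_UNIV[OF f'(1)] by (simp_all add: ev_fsub)
  have f'E: "f' \<in> fspan {w. set w \<subseteq> EG \<and> good (epar bs) w}"
    by (rule fspan_mono[OF f'(1)]) (auto dest: PG_sub)
  have deg: "wdeg kdeg w \<le> d" if "f' w \<noteq> 0" for w
    by (rule good_independent[OF f'E _ that]) (use d e in simp)
  have S: "set w \<subseteq> PG" "set w \<subseteq> EG" if "f' w \<noteq> 0" for w using f'(1) that by (auto simp: fspan_def dest: PG_sub)
  show "app (ev MV f) vac \<in> F d"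
    unfolding e app_ev
  proof (intro Fil_sum Fil_closed(5))
    fix w assume "w \<in> {w. f' w \<noteq> 0}"
    then show "MW w \<in> F d" using MW_lead[OF S(1), of w] deg[of w] Fil_mono by blast
  qed
  have w: "app (cmp d) (MW w) = app cpart (app (cmp d) (EW w))" if nz: "f' w \<noteq> 0" for w
  proof (cases "wdeg kdeg w = d")
    case True
    have "app (cmp d) (MW w - app cpart (XW w)) = 0" "app (cmp d) (EW w - XW w) = 0"
      using MW_lead[OF S(1)[OF nz]] EW_lead[OF S(2)[OF nz]] True by (auto simp: MB_word intro!: comp_low)
    then have "app (cmp d) (MW w) = app (cmp d) (app cpart (XW w))" "app (cmp d) (EW w) = app (cmp d) (XW w)"
      by (simp_all add: app_diff)
    then show ?thesis using comp_cpart[of d] by (metis app_simps(6))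
  next
    case False
    then have "wdeg kdeg w \<le> d - 1" using deg[OF nz] by simp
    then have "MW w \<in> F (d - 1)" "EW w \<in> F (d - 1)"
      using MW_lead[OF S(1)[OF nz]] EW_lead[OF S(2)[OF nz]] Fil_mono by blast+
    then show ?thesis by (simp add: comp_low)
  qed
  show "app (cmp d) (app (ev MV f) vac) = app cpart (app (cmp d) (app (ev EV f) vac))"
    unfolding e app_ev app_sum app_scl using w by (intro sum.cong) auto
qed

section \<open>Whittaker vectors\<close>

abbreviation "ch \<equiv> chi bs k l"

lemma ch_eq:
  assumes "a \<in> B" "b \<in> B"
  shows "ch (a, b) = (if fst a = fst b \<and> snd a = snd b + 1 then sgn (bp a) else 0)"
proof -
  have "ch (a, b) = (\<Sum>c\<in>B. sgn (bp c) * (\<Sum>d\<in>B. (if (c, d) = (a, b) then 1 else 0) * e_mat k l (d, c)))"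
    by (simp add: chi_def str_def matmul_def unit_mat_def)
  also have "\<dots> = (\<Sum>c\<in>B. if c = a then sgn (bp a) * e_mat k l (b, a) else 0)"
  proof (rule sum.cong[OF refl])
    fix c
    have "(\<Sum>d\<in>B. (if (c, d) = (a, b) then 1 else 0) * e_mat k l (d, c)) = (\<Sum>d\<in>B. if d = b then (if c = a then e_mat k l (b, a) else 0) else 0)"
      by (rule sum.cong) auto
    then show "sgn (bp c) * (\<Sum>d\<in>B. (if (c, d) = (a, b) then 1 else 0) * e_mat k l (d, c)) = (if c = a then sgn (bp a) * e_mat k l (b, a) else 0)"
      using assms by simp
  qed
  also have "\<dots> = (if fst a = fst b \<and> snd a = snd b + 1 then sgn (bp a) else 0)"
    using assms by (auto simp: e_mat_def)
  finally show ?thesis .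
qed

text \<open>The first of three facts on which \<chi> rests: it is even, so signs disappear wherever
  it is nonzero; it lives in Kazhdan degree 0; it vanishes on products of two letters of \<mm>,
  hence on brackets.\<close>

lemma ch_odd: "g \<in> MG \<Longrightarrow> epar bs g \<Longrightarrow> ch g = 0"
  by (cases g) (auto simp: MG_iff ch_eq epar_def bpar_def)

lemma ch_kdeg: "g \<in> MG \<Longrightarrow> ch g \<noteq> 0 \<Longrightarrow> kdeg g = 0"
  by (cases g) (auto simp: MG_iff ch_eq kdeg_def split: if_splits)

lemma ch_bracket: "(a, b) \<in> MG \<Longrightarrow> (b, e) \<in> MG \<Longrightarrow> ch (a, e) = 0"
  by (auto simp: MG_iff ch_eq)

text \<open>The image of \<open>I\<^sub>\<chi>\<close> under the PBW identification with the Fock space.\<close>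

definition IV :: "fock set" where
  "IV = cvs.span {app (prod_list (map EV u)) (app (EV g - sc (ch g)) vac) |u g. set u \<subseteq> EG \<and> g \<in> MG}"

lemma IV_subspace: "cvs.subspace IV"
  unfolding IV_def by (rule cvs.subspace_span)

lemmas IV_closed = cvs.subspace_0[OF IV_subspace] cvs.subspace_add[OF IV_subspace]
  cvs.subspace_diff[OF IV_subspace] cvs.subspace_neg[OF IV_subspace] cvs.subspace_scale[OF IV_subspace]
  cvs.subspace_sum[OF IV_subspace]

lemma EV_word_zero: "\<not> set u \<subseteq> EG \<Longrightarrow> prod_list (map EV u) = 0"
  by (induction u) (auto simp: EV_def)

lemma IV_gen: "g \<in> MG \<Longrightarrow> app (prod_list (map EV u)) (app (EV g - sc (ch g)) vac) \<in> IV"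
proof (cases "set u \<subseteq> EG")
  case True
  assume "g \<in> MG"
  then show ?thesis unfolding IV_def by (intro cvs.span_base) (use True in blast)
next
  case False
  then show ?thesis by (simp add: EV_word_zero IV_closed)
qed

lemma IV_EV: "v \<in> IV \<Longrightarrow> app (EV g) v \<in> IV"
  unfolding IV_def
proof (induction rule: cvs.span_induct)
  case base
  show ?case by (rule cvs.subspaceI) (auto simp: app_add app_scl intro: cvs.span_zero cvs.span_add cvs.span_scale)
next
  case (step v)
  then obtain u h where v: "v = app (prod_list (map EV u)) (app (EV h - sc (ch h)) vac)" "h \<in> MG" by blast
  have "app (EV g) v = app (prod_list (map EV (g # u))) (app (EV h - sc (ch h)) vac)" using v by simp
  then show ?case using IV_gen[OF v(2), of "g # u"] unfolding IV_def by simp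
qed

lemma IV_word: "v \<in> IV \<Longrightarrow> app (prod_list (map EV u)) v \<in> IV"
  by (induction u) (auto intro: IV_EV)

lemma IV_ev: "v \<in> IV \<Longrightarrow> app (ev EV f) v \<in> IV"
  unfolding app_ev by (intro IV_closed IV_word)

lemma Ichi_IV: "f \<in> Ichi bs k l \<Longrightarrow> f \<in> fspan UNIV \<and> app (ev EV f) vac \<in> IV"
  unfolding Ichi_def
proof (induction rule: left_ideal.induct)
  case (gen g u)
  show ?case
  proof (cases "g \<in> IU bs k l")
    case True
    then have "g \<in> fspan UNIV" "ev EV g = 0" using ev_Urels EV_U_rel unfolding IU_eq by blast+
    then show ?thesis by (auto simp: ev_fmul IV_closed)
  next
    case False
    then obtain h where g: "g = fsub (fgen h) (fsmul (ch h) fone)" "h \<in> MG" using gen by blast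
    have "g \<in> fspan UNIV" "ev EV g = EV h - sc (ch h)"
      by (auto simp: g fgen_def ev_fsub ev_fsmul fspan_fsmul)
    then show ?thesis using IV_gen[OF g(2), of u] by (auto simp: ev_fmul)
  qed
qed (auto simp: ev_fadd ev_fsmul app_add IV_closed)

text \<open>The left ideal of the free algebra admits arbitrary prefixes; the preimage is taken with
  letters of the rectangle so that \<open>IU_iff\<close> applies to differences.\<close>

lemma IV_Ichi:
  assumes "v \<in> IV"
  shows "\<exists>f. f \<in> Ucar k l \<and> f \<in> Ichi bs k l \<and> app (ev EV f) vac = v"
  using assms unfolding IV_def
proof (induction rule: cvs.span_induct)
  case base
  show ?case
  proof (rule cvs.subspaceI)
    show "0 \<in> {v. \<exists>f. f \<in> Ucar k l \<and> f \<in> Ichi bs k l \<and> app (ev EV f) vac = v}"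
      by (auto intro!: exI[of _ fzero] simp: Ucar_def Ichi_def left_ideal.zero)
  next
    fix v w assume "v \<in> {v. \<exists>f. f \<in> Ucar k l \<and> f \<in> Ichi bs k l \<and> app (ev EV f) vac = v}"
      "w \<in> {v. \<exists>f. f \<in> Ucar k l \<and> f \<in> Ichi bs k l \<and> app (ev EV f) vac = v}"
    then obtain f g where "f \<in> Ucar k l \<and> f \<in> Ichi bs k l \<and> app (ev EV f) vac = v"
      "g \<in> Ucar k l \<and> g \<in> Ichi bs k l \<and> app (ev EV g) vac = w" by blast
    then show "v + w \<in> {v. \<exists>f. f \<in> Ucar k l \<and> f \<in> Ichi bs k l \<and> app (ev EV f) vac = v}"
      by (auto intro!: exI[of _ "fadd f g"] fspan_fadd left_ideal.add simp: Ucar_def Ichi_def ev_fadd fspan_UNIV)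
  next
    fix c v assume "v \<in> {v. \<exists>f. f \<in> Ucar k l \<and> f \<in> Ichi bs k l \<and> app (ev EV f) vac = v}"
    then obtain f where "f \<in> Ucar k l \<and> f \<in> Ichi bs k l \<and> app (ev EV f) vac = v" by blast
    then show "scl c v \<in> {v. \<exists>f. f \<in> Ucar k l \<and> f \<in> Ichi bs k l \<and> app (ev EV f) vac = v}"
      by (auto intro!: exI[of _ "fsmul c f"] fspan_fsmul left_ideal.smul simp: Ucar_def Ichi_def ev_fsmul fspan_UNIV)
  qed
next
  case (step v)
  then obtain u g where v: "v = app (prod_list (map EV u)) (app (EV g - sc (ch g)) vac)" "set u \<subseteq> EG" "g \<in> MG" by blast
  let ?g = "fsub (fgen g) (fsmul (ch g) fone)"
  have g: "?g \<in> fspan {w. set w \<subseteq> EG}" using MG_sub[OF v(3)] by (auto simp: fgen_def intro!: fspan_fsub fspan_fsmul)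
  have e: "ev EV ?g = EV g - sc (ch g)" by (simp add: fgen_def ev_fsub ev_fsmul fspan_fsmul)
  show ?case
  proof (intro exI conjI)
    show "fmul (fmono u) ?g \<in> Ucar k l" unfolding Ucar_def using v by (intro fspan_fmul_letters g) simp
    show "fmul (fmono u) ?g \<in> Ichi bs k l" unfolding Ichi_def using v by (intro left_ideal.gen) blast
    show "app (ev EV (fmul (fmono u) ?g)) vac = v" using v fspan_UNIV[OF g] e by (simp add: ev_fmul)
  qed
qed

lemma IU_Ichi: "f \<in> IU bs k l \<Longrightarrow> f \<in> Ichi bs k l"
  unfolding Ichi_def using left_ideal.gen[of f _ "[]"] by simp

lemma Ichi_iff:
  assumes "f \<in> Ucar k l"
  shows "f \<in> Ichi bs k l \<longleftrightarrow> app (ev EV f) vac \<in> IV"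
proof
  assume "app (ev EV f) vac \<in> IV"
  then obtain f' where f': "f' \<in> Ucar k l" "f' \<in> Ichi bs k l" "app (ev EV f') vac = app (ev EV f) vac"
    using IV_Ichi by blast
  have "fsub f f' \<in> Ucar k l" using assms f' by (auto simp: Ucar_def)
  moreover have "app (ev EV (fsub f f')) vac = 0"
    using assms f' by (simp add: ev_fsub Ucar_def fspan_UNIV)
  ultimately have "fsub f f' \<in> Ichi bs k l" using IU_iff(1) IU_Ichi by blast
  then have "fadd (fsub f f') f' \<in> Ichi bs k l" using f'(2) unfolding Ichi_def by (rule left_ideal.add)
  then show "f \<in> Ichi bs k l" by (simp add: fadd_def fsub_def)
qed (use Ichi_IV in blast)

definition WV :: "fock set" where
  "WV = {v. \<forall>g\<in>MG. app (EV g - sc (ch g)) v \<in> IV}"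

lemma WV_subspace: "cvs.subspace WV"
proof (rule cvs.subspaceI)
  fix u v assume "u \<in> WV" "v \<in> WV"
  then show "u + v \<in> WV" unfolding WV_def using IV_closed(2) by (auto simp only: mem_Collect_eq app_add)
next
  fix c v assume "v \<in> WV"
  then show "scl c v \<in> WV" unfolding WV_def using IV_closed(5) by (auto simp only: mem_Collect_eq app_scl)
qed (auto simp: WV_def IV_closed)

lemmas WV_closed = cvs.subspace_0[OF WV_subspace] cvs.subspace_add[OF WV_subspace]
  cvs.subspace_diff[OF WV_subspace] cvs.subspace_neg[OF WV_subspace] cvs.subspace_scale[OF WV_subspace]
  cvs.subspace_sum[OF WV_subspace]

section \<open>Supercommutators modulo the left ideal\<close>

lemma hpart_fspan: "y \<in> fspan S \<Longrightarrow> hpart par p y \<in> fspan S"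
  unfolding fspan_def hpart_def by (auto intro: finite_subset[of _ "{w. y w \<noteq> 0}"])

lemma hpart_split: "y = fadd (hpart par False y) (hpart par True y)"
  by (auto simp: fadd_def hpart_def)

lemma UNIV_bool2: "(UNIV :: (bool \<times> bool) set) = {(False, False), (False, True), (True, False), (True, True)}"
  by auto

lemma scomm_expand: "scomm par x y =
   fadd (fsub (fmul (hpart par False x) (hpart par False y)) (fmul (hpart par False y) (hpart par False x)))
  (fadd (fsub (fmul (hpart par False x) (hpart par True y)) (fmul (hpart par True y) (hpart par False x)))
  (fadd (fsub (fmul (hpart par True x) (hpart par False y)) (fmul (hpart par False y) (hpart par True x)))
        (fsub (fmul (hpart par True x) (hpart par True y)) (fsmul (-1) (fmul (hpart par True y) (hpart par True x))))))"
  unfolding scomm_def UNIV_bool2 by (simp add: sgn_def fsmul_def fadd_def fzero_def)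

lemma scomm_add: "scomm par (fadd x x') y = fadd (scomm par x y) (scomm par x' y)"
proof -
  have h: "hpart par p (fadd x x') = fadd (hpart par p x) (hpart par p x')" for p
    by (auto simp: hpart_def fadd_def)
  show ?thesis unfolding scomm_expand h fmul_simps by (auto simp: fadd_def fsub_def fsmul_def)
qed

lemma scomm_smul: "scomm par (fsmul c x) y = fsmul c (scomm par x y)"
proof -
  have h: "hpart par p (fsmul c x) = fsmul c (hpart par p x)" for p
    by (auto simp: hpart_def fsmul_def)
  show ?thesis unfolding scomm_expand h fmul_simps by (auto simp: fadd_def fsub_def fsmul_def algebra_simps)
qed

lemma hpart_gen: "hpart par p (fmono [g]) = (if par g = p then fmono [g] else fzero)"
  by (auto simp: hpart_def fmono_def fzero_def wpar_def)

text \<open>Modulo the left ideal \<open>y g\<close> is \<open>\<chi>(g) y\<close>, so the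
  supercommutator with \<open>g\<close> becomes left multiplication by \<open>g - \<chi>(g)\<close>.
  The sign for odd \<open>g\<close> is harmless, since then \<open>\<chi>(g) = 0\<close>.\<close>

lemma scomm_gen:
  assumes y: "y \<in> Ucar k l" and g: "g \<in> MG"
  shows "scomm (epar bs) (fmono [g]) y \<in> Ucar k l"
    and "app (ev EV (scomm (epar bs) (fmono [g]) y)) vac \<in> IV \<longleftrightarrow> app (EV g - sc (ch g)) (app (ev EV y) vac) \<in> IV"
proof -
  let ?y = "\<lambda>p. hpart (epar bs) p y"
  have yU: "?y p \<in> fspan {w. set w \<subseteq> EG}" for p using y by (auto simp: Ucar_def intro: hpart_fspan)
  have yu: "?y p \<in> fspan UNIV" for p using yU fspan_UNIV by blast
  have gU: "fmono [g] \<in> fspan {w. set w \<subseteq> EG}" using MG_sub[OF g] by simp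
  have ey: "ev EV y = ev EV (?y False) + ev EV (?y True)"
    by (subst hpart_split[of y "epar bs"]) (simp add: ev_fadd yu)
  have sc: "scomm (epar bs) (fmono [g]) y = fadd (fsub (fmul (fmono [g]) (?y False)) (fmul (?y False) (fmono [g])))
      (fsub (fmul (fmono [g]) (?y True)) (fsmul (sgn (epar bs g)) (fmul (?y True) (fmono [g]))))"
    by (cases "epar bs g") (simp_all add: scomm_expand hpart_gen fmul_simps, auto simp: fadd_def fsub_def fsmul_def fzero_def sgn_def)
  show "scomm (epar bs) (fmono [g]) y \<in> Ucar k l"
    unfolding sc Ucar_def by (intro fspan_fadd fspan_fsub fspan_fsmul fspan_fmul_letters yU gU)
  let ?c = "\<lambda>p. app (ev EV (?y p)) (app (EV g - sc (ch g)) vac)"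
  have c: "?c p \<in> IV" for p by (intro IV_ev) (use IV_gen[OF g, of "[]"] in simp)
  have z: "sgn (epar bs g) * ch g = ch g" using ch_odd[OF g] by (auto simp: sgn_def)
  have "app (ev EV (scomm (epar bs) (fmono [g]) y)) vac
      = app (EV g) (app (ev EV y) vac) - app (ev EV (?y False)) (app (EV g) vac) - scl (sgn (epar bs g)) (app (ev EV (?y True)) (app (EV g) vac))"
    unfolding sc ey by (simp add: ev_fadd ev_fsub ev_fsmul ev_fmul fspan_fmul fspan_fsub fspan_fsmul yu app_add app_diff)
  also have "\<dots> = app (EV g - sc (ch g)) (app (ev EV y) vac) - ?c False - scl (sgn (epar bs g)) (?c True)"
    unfolding ey by (simp add: app_add app_diff app_scl cvs.scale_right_distrib cvs.scale_right_diff_distrib z)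
  finally have eq: "app (ev EV (scomm (epar bs) (fmono [g]) y)) vac = app (EV g - sc (ch g)) (app (ev EV y) vac) - (?c False + scl (sgn (epar bs g)) (?c True))"
    by simp
  have i: "?c False + scl (sgn (epar bs g)) (?c True) \<in> IV" by (intro IV_closed c)
  show "app (ev EV (scomm (epar bs) (fmono [g]) y)) vac \<in> IV \<longleftrightarrow> app (EV g - sc (ch g)) (app (ev EV y) vac) \<in> IV"
    unfolding eq using IV_closed(2)[OF _ i] IV_closed(3)[OF _ i] by (metis diff_add_cancel)
qed

lemma Whittaker_iff:
  assumes y: "y \<in> Ucar k l"
  shows "(\<forall>x\<in>mspan k l. scomm (epar bs) x y \<in> Ichi bs k l) \<longleftrightarrow> app (ev EV y) vac \<in> WV"
proof
  assume *: "\<forall>x\<in>mspan k l. scomm (epar bs) x y \<in> Ichi bs k l"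
  show "app (ev EV y) vac \<in> WV"
    unfolding WV_def
  proof (intro CollectI ballI)
    fix g assume g: "g \<in> MG"
    then have "fmono [g] \<in> mspan k l" unfolding mspan_def fspan_fmono by blast
    then have "scomm (epar bs) (fmono [g]) y \<in> Ichi bs k l" using * by blast
    then show "app (EV g - sc (ch g)) (app (ev EV y) vac) \<in> IV"
      using Ichi_IV scomm_gen(2)[OF y g] by blast
  qed
next
  assume w: "app (ev EV y) vac \<in> WV"
  show "\<forall>x\<in>mspan k l. scomm (epar bs) x y \<in> Ichi bs k l"
  proof
    fix x assume "x \<in> mspan k l"
    then show "scomm (epar bs) x y \<in> Ichi bs k l" unfolding mspan_def
    proof (induction rule: fspan_induct)
      case zero
      have "scomm (epar bs) fzero y = fzero"
        using scomm_smul[of "epar bs" 0 fzero y] by (simp add: fsmul_def fzero_def)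
      then show ?case by (simp add: Ichi_def left_ideal.zero)
    next
      case (mono v)
      then obtain g where g: "v = [g]" "g \<in> MG" by blast
      then show ?case using scomm_gen[OF y g(2)] w Ichi_iff by (simp add: WV_def)
    qed (simp_all add: scomm_add scomm_smul Ichi_def left_ideal.add left_ideal.smul)
  qed
qed

end

section \<open>Top symbols of the left ideal\<close>

lemma prod_list_sc: "prod_list (map (\<lambda>g. sc (c g)) w) = sc (prod_list (map c w))"
  by (induction w) (simp_all add: sc_simps)

context rect
begin

text \<open>The spanning half of \<open>U(\<gg>) = U(\<pp>) U(\<mm>)\<close>, on an arbitrary vector
  \<open>z\<close>. A letter moved past a letter of \<pp> leaves single letters of \<gg>, which the
  induction absorbs because it treats all \<open>h\<close> at once.\<close>

lemma triangular_words:
  assumes "set v \<subseteq> EG"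
  shows "app (prod_list (map EV v)) z \<in>
    cvs.span {app (prod_list (map EV (u @ w))) z |u w. set u \<subseteq> PG \<and> set w \<subseteq> MG}" (is "_ \<in> cvs.span ?G")
proof -
  let ?S = "cvs.span ?G"
  have PS: "app (EV h) x \<in> ?S" if "h \<in> PG" "x \<in> ?S" for h x
    using that(2)
  proof (induction rule: cvs.span_induct)
    case base
    show ?case by (rule cvs.subspaceI) (auto simp: app_add app_scl intro: cvs.span_zero cvs.span_add cvs.span_scale)
  next
    case (step x)
    then obtain u w where x: "x = app (prod_list (map EV (u @ w))) z" "set u \<subseteq> PG" "set w \<subseteq> MG" by blast
    have "app (EV h) x = app (prod_list (map EV ((h # u) @ w))) z" using x by simp
    moreover have "set (h # u) \<subseteq> PG" using that(1) x by simp
    ultimately have "app (EV h) x \<in> ?G" using x(3) by blast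
    then show ?case by (rule cvs.span_base)
  qed
  have E: "app (EV h) (app (prod_list (map EV (u @ w))) z) \<in> ?S"
    if "h \<in> EG" "set u \<subseteq> PG" "set w \<subseteq> MG" for h u w
    using that
  proof (induction u arbitrary: h)
    case Nil
    have "(h \<in> PG) \<or> (h \<in> MG)" using Nil(1) by (auto simp: Pgens_def Mgens_def)
    then consider "set [h] \<subseteq> PG" | "set (h # w) \<subseteq> MG" using Nil(3) by auto
    then have "app (EV h) (app (prod_list (map EV ([] @ w))) z) \<in> ?G"
    proof cases
      case 1
      have "app (EV h) (app (prod_list (map EV ([] @ w))) z) = app (prod_list (map EV ([h] @ w))) z" by simp
      then show ?thesis using 1 Nil(3) by blast
    next
      case 2
      have "app (EV h) (app (prod_list (map EV ([] @ w))) z) = app (prod_list (map EV ([] @ (h # w)))) z" by simp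
      then show ?thesis using 2 by (metis (mono_tags, lifting) empty_set empty_subsetI mem_Collect_eq)
    qed
    then show ?case by (rule cvs.span_base)
  next
    case (Cons a u)
    let ?x = "app (prod_list (map EV (u @ w))) z"
    have a: "a \<in> PG" and u: "set u \<subseteq> PG" using Cons by auto
    have IH: "app (EV h') ?x \<in> ?S" if "h' \<in> EG" for h' using Cons.IH[OF that u Cons.prems(3)] .
    have "app (EV h * EV a) ?x = app (sg (epar bs h \<and> epar bs a) * (EV a * EV h) +
        ((if snd h = fst a then EV (fst h, snd a) else 0)
         - sg (epar bs h \<and> epar bs a) * (if fst h = snd a then EV (fst a, snd h) else 0))) ?x"
      using EV_br[OF Cons(2) PG_sub[OF a]] unfolding br_def by (metis add.commute diff_add_cancel)
    moreover have "(fst h, snd a) \<in> EG" "(fst a, snd h) \<in> EG" using Cons(2) PG_sub[OF a] by (auto simp: Egens_def)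
    then have "app (EV (fst h, snd a)) ?x \<in> ?S" "app (EV (fst a, snd h)) ?x \<in> ?S"
      using IH by blast+
    moreover have "app (EV a) (app (EV h) ?x) \<in> ?S" by (rule PS[OF a IH[OF Cons(2)]])
    ultimately have "app (EV h * EV a) ?x \<in> ?S"
      by (auto simp: sg_def intro!: cvs.span_add cvs.span_diff cvs.span_neg cvs.span_zero)
    then show ?case by simp
  qed
  have ES: "app (EV h) x \<in> ?S" if "h \<in> EG" "x \<in> ?S" for h x
    using that(2)
  proof (induction rule: cvs.span_induct)
    case base
    show ?case by (rule cvs.subspaceI) (auto simp: app_add app_scl intro: cvs.span_zero cvs.span_add cvs.span_scale)
  next
    case (step x)
    then show ?case using E[OF that(1)] by blast
  qed
  show ?thesis using assms
  proof (induction v)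
    case Nil
    have "app (prod_list (map EV [])) z = app (prod_list (map EV ([] @ []))) z" by simp
    then have "app (prod_list (map EV [])) z \<in> ?G" by (metis (mono_tags, lifting) empty_set empty_subsetI mem_Collect_eq)
    then show ?case by (rule cvs.span_base)
  next
    case (Cons h v)
    then show ?case using ES[of h] by simp
  qed
qed

abbreviation "chw w \<equiv> prod_list (map ch w)"

text \<open>For \<open>w\<close> in \<mm> the differences \<open>w - \<chi>(w)\<close> span the
  kernel of the character \<chi> of \<open>U(\<mm>)\<close>, so \<open>KV\<close> below is
  \<open>U(\<pp>)\<close> times this kernel. An empty \<open>w\<close> gives 0.\<close>

definition Kg :: "(box \<times> box) list \<Rightarrow> (box \<times> box) list \<Rightarrow> fock" where
  "Kg u w = app (prod_list (map EV u)) (app (prod_list (map EV w) - sc (chw w)) vac)"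

text \<open>A spanning set of \<open>IV\<close> adapted to the triangular decomposition: unlike for the generators of \<open>IV\<close>, the
  top symbol of a combination of these vectors can be controlled.\<close>

definition KV :: "fock set" where
  "KV = cvs.span {Kg u w |u w. set u \<subseteq> PG \<and> good (epar bs) u \<and> set w \<subseteq> MG \<and> good (epar bs) w}"

lemma KV_closed: "cvs.subspace KV"
  unfolding KV_def by (rule cvs.subspace_span)

text \<open>Makes \<chi> a character of \<open>U(\<mm>)\<close>, so that \<open>w\<close> can be
  straightened together with the scalar \<open>\<chi>(w)\<close>.\<close>

lemma ch_U_rel: "x \<in> MG \<Longrightarrow> y \<in> MG \<Longrightarrow> ev (\<lambda>g. sc (ch g)) (U_rel bs x y) = 0"
proof -
  assume xy: "x \<in> MG" "y \<in> MG"
  obtain a b c e where gh: "x = (a, b)" "y = (c, e)" by (metis surj_pair)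
  have 1: "br (epar bs x \<and> epar bs y) (sc (ch x)) (sc (ch y)) = 0"
    using ch_odd[OF xy(1)] by (auto simp: br_sc sc_simps)
  have "snd x = fst y \<Longrightarrow> ch (fst x, snd y) = 0" "snd y = fst x \<Longrightarrow> ch (fst y, snd x) = 0"
    using ch_bracket xy by (auto simp: gh)
  then show ?thesis unfolding ev_U_rel 1 by (auto simp: sc_simps)
qed

lemma Kg_KV:
  assumes u: "set u \<subseteq> PG" and w: "set w \<subseteq> MG"
  shows "Kg u w \<in> KV"
proof -
  have "fmono u \<in> fspan {w. set w \<subseteq> PG}" "fmono w \<in> fspan {w. set w \<subseteq> MG}" using u w by auto
  note red = U_reducible_fspan[OF closed_gens(2) this(1)] U_reducible_fspan[OF closed_gens(3) this(2)]
  obtain f where f: "f \<in> fspan {w. set w \<subseteq> PG \<and> good (epar bs) w}" "fsub (fmono u) f \<in> two_ideal (Urels PG)"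
    using red(1) .
  obtain g where g: "g \<in> fspan {w. set w \<subseteq> MG \<and> good (epar bs) w}" "fsub (fmono w) g \<in> two_ideal (Urels MG)"
    using red(2) .
  have eu: "prod_list (map EV u) = ev EV f"
    using ev_Urels(2)[OF f(2), of EV] EV_U_rel PG_sub fspan_UNIV[OF f(1)] by (simp add: ev_fsub)
  have ew: "prod_list (map EV w) = ev EV g"
    using ev_Urels(2)[OF g(2), of EV] EV_U_rel MG_sub fspan_UNIV[OF g(1)] by (simp add: ev_fsub)
  have cw: "sc (chw w) = ev (\<lambda>g. sc (ch g) :: (box \<times> box) multiset op) g"
    using ev_Urels(2)[OF g(2) ch_U_rel] fspan_UNIV[OF g(1)] by (simp add: ev_fsub prod_list_sc)
  have a: "app (prod_list (map EV w) - sc (chw w)) vac =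
     (\<Sum>w | g w \<noteq> 0. scl (g w) (app (prod_list (map EV w) - sc (chw w)) vac))"
    unfolding ew cw by (simp add: app_ev prod_list_sc sum_subtractf cvs.scale_right_diff_distrib)
  have "Kg u w = app (ev EV f) (app (prod_list (map EV w) - sc (chw w)) vac)" by (simp only: Kg_def eu)
  also have "\<dots> = (\<Sum>u | f u \<noteq> 0. scl (f u) (app (prod_list (map EV u)) (app (prod_list (map EV w) - sc (chw w)) vac)))"
    by (rule app_ev)
  also have "\<dots> = (\<Sum>u | f u \<noteq> 0. scl (f u) (\<Sum>w | g w \<noteq> 0. scl (g w) (Kg u w)))"
    by (subst a) (simp only: app_sum app_scl Kg_def)
  also have "\<dots> \<in> KV"
  proof (intro cvs.subspace_sum[OF KV_closed] cvs.subspace_scale[OF KV_closed])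
    fix u w assume "u \<in> {u. f u \<noteq> 0}" "w \<in> {w. g w \<noteq> 0}"
    then have "set u \<subseteq> PG \<and> good (epar bs) u \<and> set w \<subseteq> MG \<and> good (epar bs) w"
      using f(1) g(1) by (auto simp: fspan_def)
    then show "Kg u w \<in> KV" unfolding KV_def by (intro cvs.span_base) blast
  qed
  finally show ?thesis .
qed

lemma IV_sub_KV: "v \<in> IV \<Longrightarrow> v \<in> KV"
proof -
  have "app (prod_list (map EV u)) (app (EV g - sc (ch g)) vac) \<in> KV" if "set u \<subseteq> EG" "g \<in> MG" for u g
  proof -
    let ?z = "app (EV g - sc (ch g)) vac"
    have "app (prod_list (map EV (u @ w))) ?z \<in> KV" if "set u \<subseteq> PG" "set w \<subseteq> MG" for u w
    proof -
      \<comment> \<open>This is \<open>w (g - \<chi>(g)) = (w g - \<chi>(w g)) - \<chi>(g) (w -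
        \<chi>(w))\<close>.\<close>
      have "app (prod_list (map EV (u @ w))) ?z = Kg u (w @ [g]) - scl (ch g) (Kg u w)"
        by (simp add: Kg_def app_diff app_scl cvs.scale_right_diff_distrib mult.commute)
      moreover have "set (w @ [g]) \<subseteq> MG" using that \<open>g \<in> MG\<close> by simp
      then have "Kg u (w @ [g]) \<in> KV" "Kg u w \<in> KV" using that Kg_KV by blast+
      ultimately show ?thesis
        using cvs.subspace_diff[OF KV_closed] cvs.subspace_scale[OF KV_closed] by metis
    qed
    then have "cvs.span {app (prod_list (map EV (u @ w))) ?z |u w. set u \<subseteq> PG \<and> set w \<subseteq> MG} \<subseteq> KV"
      by (intro cvs.span_minimal KV_closed) auto
    then show ?thesis using triangular_words[OF that(1), of ?z] by blast
  qed
  then have "IV \<subseteq> KV" unfolding IV_def by (intro cvs.span_minimal KV_closed) auto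
  then show "v \<in> IV \<Longrightarrow> v \<in> KV" by blast
qed

text \<open>Genuine super-polynomials in the letters of \<open>S\<close>. The Fock space also
  contains monomials repeating an odd letter, which words never produce from the vacuum and on which
  derivatives do not detect coefficients.\<close>

definition VQ :: "(box \<times> box) set \<Rightarrow> fock set" where
  "VQ S = {v. \<forall>\<alpha>\<in>keys v. set_mset \<alpha> \<subseteq> S \<and> (\<forall>g. epar bs g \<longrightarrow> count \<alpha> g \<le> 1)}"

abbreviation "VP \<equiv> VQ PG"

lemma VQ_iff: "v \<in> VQ S \<longleftrightarrow> (\<forall>\<alpha>. lookup v \<alpha> \<noteq> 0 \<longrightarrow> set_mset \<alpha> \<subseteq> S \<and> (\<forall>g. epar bs g \<longrightarrow> count \<alpha> g \<le> 1))"
  by (auto simp: VQ_def in_keys_iff)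

lemma VQ_subspace: "cvs.subspace (VQ S)"
proof (rule cvs.subspaceI)
  fix u v assume "u \<in> VQ S" "v \<in> VQ S"
  then show "u + v \<in> VQ S" unfolding VQ_iff lookup_add by (metis add_0)
qed (auto simp: VQ_iff)

lemmas VQ_closed = cvs.subspace_0[OF VQ_subspace] cvs.subspace_add[OF VQ_subspace]
  cvs.subspace_diff[OF VQ_subspace] cvs.subspace_neg[OF VQ_subspace] cvs.subspace_scale[OF VQ_subspace]
  cvs.subspace_sum[OF VQ_subspace]

lemma VQ_vac: "vac \<in> VQ S"
  by (auto simp: VQ_iff vac_def lookup_single when_def simp del: single_one)

lemma VQ_cr: assumes "g \<in> S" "v \<in> VQ S" shows "app (cr (epar bs) g) v \<in> VQ S"
  unfolding VQ_iff
proof (intro allI impI)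
  fix \<alpha> assume nz: "lookup (app (cr (epar bs) g) v) \<alpha> \<noteq> 0"
  then have "g \<in># \<alpha>" using lookup_cr_notin by blast
  then obtain \<beta> where a: "\<alpha> = add_mset g \<beta>" by (metis insert_DiffM)
  then have b: "lookup v \<beta> \<noteq> 0" and o: "\<not> (epar bs g \<and> odd (count \<beta> g))" using nz by (auto simp: lookup_cr_add split: if_splits)
  have sub: "set_mset \<beta> \<subseteq> S" and c: "\<And>h. epar bs h \<Longrightarrow> count \<beta> h \<le> 1" using assms(2) b by (auto simp: VQ_iff)
  have "count \<alpha> h \<le> 1" if h: "epar bs h" for h
  proof (cases "h = g")
    case True
    then have "even (count \<beta> g)" using o h by blast
    moreover have "count \<beta> g \<le> 1" using c h True by blast
    ultimately have "count \<beta> g = 0" by (metis le_eq_less_or_eq less_one odd_one)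
    then show ?thesis using True a by simp
  next
    case False
    then show ?thesis using c[OF h] a by simp
  qed
  then show "set_mset \<alpha> \<subseteq> S \<and> (\<forall>g. epar bs g \<longrightarrow> count \<alpha> g \<le> 1)" using sub assms(1) a by auto
qed

lemma VQ_an: assumes "v \<in> VQ S" shows "app (an (epar bs) g) v \<in> VQ S"
  unfolding VQ_iff
proof (intro allI impI)
  fix \<alpha> assume "lookup (app (an (epar bs) g) v) \<alpha> \<noteq> 0"
  then have "lookup v (add_mset g \<alpha>) \<noteq> 0" by (auto simp: lookup_an)
  then have "set_mset (add_mset g \<alpha>) \<subseteq> S" and c: "\<And>h. epar bs h \<Longrightarrow> count (add_mset g \<alpha>) h \<le> 1"
    using assms unfolding VQ_iff by blast+
  moreover have "count \<alpha> h \<le> 1" if "epar bs h" for h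
    by (rule order_trans[OF _ c[OF that]]) simp
  ultimately show "set_mset \<alpha> \<subseteq> S \<and> (\<forall>g. epar bs g \<longrightarrow> count \<alpha> g \<le> 1)"
    by simp
qed

lemma VQ_an_zero: assumes "v \<in> VQ S" "g \<notin> S" shows "app (an (epar bs) g) v = 0"
proof (rule poly_mapping_eqI)
  fix \<beta>
  have "lookup v (add_mset g \<beta>) = 0" using assms by (force simp: VQ_iff)
  then show "lookup (app (an (epar bs) g) v) \<beta> = lookup 0 \<beta>" by (simp add: lookup_an)
qed

lemma VQ_EV: assumes "g \<in> PG" "v \<in> VP" shows "app (EV g) v \<in> VP"
proof -
  obtain a b where g: "g = (a, b)" by (metis surj_pair)
  have "app (X a c * DD b c) v \<in> VP" if "c \<in> B" for c
  proof (cases "(b, c) \<in> PG")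
    case True
    then have "(a, c) \<in> PG" using assms g by (auto simp: PG_iff)
    then show ?thesis by (simp add: VQ_cr VQ_an assms)
  next
    case False
    then show ?thesis by (simp add: VQ_an_zero[OF assms(2) False] VQ_closed)
  qed
  then have "app (Lop a b) v \<in> VP" unfolding Lop_def app_sum_left by (rule VQ_closed(6))
  then have "app (EE a b) v \<in> VP" using VQ_cr[OF assms] by (simp add: EE_def g VQ_closed)
  then show ?thesis using PG_sub[OF assms(1)] by (simp add: EV_def g)
qed

lemma VQ_EW: "set u \<subseteq> PG \<Longrightarrow> EW u \<in> VP"
  by (induction u) (auto simp: VQ_vac VQ_EV)

text \<open>The substitution \<open>x\<^sub>g \<mapsto> \<chi>(g)\<close> for \<open>g\<close> in \<open>\<mm>\<close>.\<close>

definition Sb :: "(box \<times> box) multiset op" where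
  "Sb = lop (\<lambda>\<alpha>. single (filter_mset (\<lambda>g. g \<notin> MG) \<alpha>) (\<Prod>g\<in>#filter_mset (\<lambda>g. g \<in> MG) \<alpha>. ch g))"

lemma Sb_single: "app Sb (single \<alpha> c) = single (filter_mset (\<lambda>g. g \<notin> MG) \<alpha>) (c * (\<Prod>g\<in>#filter_mset (\<lambda>g. g \<in> MG) \<alpha>. ch g))"
  by (simp add: Sb_def)

lemma Sb_cr_M: assumes "g \<in> MG" shows "Sb * cr (epar bs) g = sc (ch g) * Sb"
proof (rule op_eqI)
  fix \<alpha>
  show "app (Sb * cr (epar bs) g) (single \<alpha> 1) = app (sc (ch g) * Sb) (single \<alpha> 1)"
    using ch_odd[OF assms] assms by (cases "epar bs g") (simp_all add: cr_single Sb_single)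
qed

text \<open>Deleting letters of \<mm> can change the order sign only through odd ones, and a
  monomial containing an odd letter of \<mm> is sent to 0.\<close>

lemma Sb_cr_P: assumes "g \<notin> MG" shows "Sb * cr (epar bs) g = cr (epar bs) g * Sb"
proof (rule op_eqI)
  fix \<alpha>
  let ?\<alpha> = "filter_mset (\<lambda>g. g \<notin> MG) \<alpha>" and ?c = "\<Prod>g\<in>#filter_mset (\<lambda>g. g \<in> MG) \<alpha>. ch g"
  have c: "count ?\<alpha> g = count \<alpha> g" using assms by simp
  have n: "order_sign (epar bs) g ?\<alpha> = order_sign (epar bs) g \<alpha>" if "?c \<noteq> 0"
  proof -
    have "h \<notin> MG" if "h \<in># \<alpha>" "epar bs h" for h
      using that \<open>?c \<noteq> 0\<close> ch_odd[of h] by (auto simp: prod_mset_zero_iff)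
    then have "{#h \<in># ?\<alpha>. h < g \<and> epar bs h#} = {#h \<in># \<alpha>. h < g \<and> epar bs h#}"
      unfolding filter_filter_mset by (intro filter_mset_cong) auto
    then show ?thesis by (simp add: order_sign_def)
  qed
  have s: "app Sb (single \<alpha> 1) = single ?\<alpha> ?c" "app Sb (single (add_mset g \<alpha>) z) = single (add_mset g ?\<alpha>) (z * ?c)" for z
    using assms by (simp_all add: Sb_single)
  show "app (Sb * cr (epar bs) g) (single \<alpha> 1) = app (cr (epar bs) g * Sb) (single \<alpha> 1)"
  proof (cases "?c = 0")
    case True
    show ?thesis by (simp only: app_simps cr_single s c if_distrib[of "app Sb"] True) simp
  next
    case False
    show ?thesis by (simp only: app_simps cr_single s c if_distrib[of "app Sb"] n[OF False] app_zero mult.commute mult_1)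
  qed
qed

lemma Sb_VP: assumes "v \<in> VP" shows "app Sb v = v"
proof -
  have "app Sb (single \<alpha> (lookup v \<alpha>)) = single \<alpha> (lookup v \<alpha>)" if "\<alpha> \<in> keys v" for \<alpha>
  proof -
    have "set_mset \<alpha> \<subseteq> PG" using assms that by (auto simp: VQ_def)
    then have m: "\<forall>g\<in>#\<alpha>. g \<notin> MG" by (auto simp: Pgens_def Mgens_def)
    have e1: "filter_mset (\<lambda>g. g \<notin> MG) \<alpha> = filter_mset (\<lambda>g. True) \<alpha>"
      by (rule filter_mset_cong) (use m in auto)
    have e2: "filter_mset (\<lambda>g. g \<in> MG) \<alpha> = filter_mset (\<lambda>g. False) \<alpha>"
      by (rule filter_mset_cong) (use m in auto)
    show ?thesis unfolding Sb_single e1 e2 by simp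
  qed
  then have "(\<Sum>\<alpha>\<in>keys v. app Sb (scl (lookup v \<alpha>) (single \<alpha> 1))) = (\<Sum>\<alpha>\<in>keys v. scl (lookup v \<alpha>) (single \<alpha> 1))"
    by (intro sum.cong) auto
  then show ?thesis using vec_expand[of v] by (metis app_sum)
qed

lemma Sb_word:
  assumes "set u \<subseteq> PG" "set w \<subseteq> MG"
  shows "app Sb (XW (u @ w)) = scl (chw w) (XW u)"
proof -
  have "app Sb (XW w) = scl (chw w) vac" using assms(2)
  proof (induction w)
    case Nil
    then show ?case using Sb_VP[OF VQ_vac] by simp
  next
    case (Cons g w)
    have "app Sb (XW (g # w)) = app (Sb * cr (epar bs) g) (XW w)" by simp
    also have "\<dots> = app (sc (ch g) * Sb) (XW w)" using Cons by (simp only: Sb_cr_M list.set insert_subset)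
    finally show ?case using Cons by simp
  qed
  with assms(1) show ?thesis
  proof (induction u)
    case (Cons g u)
    then have "g \<notin> MG" by (auto simp: Pgens_def Mgens_def)
    have "app Sb (XW ((g # u) @ w)) = app (Sb * cr (epar bs) g) (XW (u @ w))" by simp
    also have "\<dots> = app (cr (epar bs) g * Sb) (XW (u @ w))" by (simp only: Sb_cr_P[OF \<open>g \<notin> MG\<close>])
    finally show ?case using Cons by (simp add: app_scl)
  qed simp
qed

lemma PG_MG: "g \<in> PG \<Longrightarrow> g \<notin> MG"
  by (auto simp: Pgens_def Mgens_def)

lemma good_disjoint_count:
  assumes "set u \<subseteq> PG" "good (epar bs) u" "set w \<subseteq> MG" "good (epar bs) w" "epar bs g"
  shows "count (mset (u @ w)) g \<le> 1"
proof -
  have "g \<notin> set u \<or> g \<notin> set w" using assms(1,3) PG_MG by blast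
  then have "count (mset u) g = 0 \<or> count (mset w) g = 0" by (simp add: not_in_iff[symmetric])
  moreover have "count (mset (u @ w)) g = count (mset u) g + count (mset w) g" by simp
  ultimately show ?thesis using good_count[OF assms(2,5)] good_count[OF assms(4,5)] by linarith
qed

lemma filter_PM: assumes "set u \<subseteq> PG" "set w \<subseteq> MG" shows "filter_mset (\<lambda>g. g \<in> MG) (mset (u @ w)) = mset w"
    "filter_mset (\<lambda>g. g \<notin> MG) (mset (u @ w)) = mset u"
proof -
  have 1: "\<forall>g\<in>set u. g \<notin> MG" "\<forall>g\<in>set w. g \<in> MG" using assms PG_MG by blast+
  have "filter (\<lambda>g. g \<in> MG) (u @ w) = w" "filter (\<lambda>g. g \<notin> MG) (u @ w) = u"
    using 1 by (auto simp: filter_empty_conv)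
  then show "filter_mset (\<lambda>g. g \<in> MG) (mset (u @ w)) = mset w" "filter_mset (\<lambda>g. g \<notin> MG) (mset (u @ w)) = mset u"
    by (metis mset_filter)+
qed

lemma chw_wdeg: "set w \<subseteq> MG \<Longrightarrow> chw w \<noteq> 0 \<Longrightarrow> wdeg kdeg w = 0"
  by (induction w) (auto simp: ch_kdeg)

text \<open>In degree \<open>d\<close> the symbol is the commutative polynomial
  \<open>u (w - \<chi>(w))\<close>, which the substitution kills. It is homogeneous because
  \<open>\<chi>(w)\<close> is nonzero only for \<open>w\<close> of degree 0.\<close>

lemma Kg_symbol:
  assumes w: "set u \<subseteq> PG" "good (epar bs) u" "set w \<subseteq> MG" "good (epar bs) w"
    and d: "wdeg kdeg (u @ w) \<le> d"
  shows "app Sb (app (cmp d) (Kg u w)) = 0"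
proof -
  have uE: "set u \<subseteq> EG" and uwE: "set (u @ w) \<subseteq> EG" using w PG_sub MG_sub by auto
  have K: "Kg u w = EW (u @ w) - scl (chw w) (EW u)" by (simp add: Kg_def app_diff app_scl)
  show ?thesis
  proof (cases "wdeg kdeg (u @ w) = d")
    case True
    have 1: "app (cmp d) (EW (u @ w)) = app (cmp d) (XW (u @ w))"
    proof -
      have "app (cmp d) (EW (u @ w) - XW (u @ w)) = 0"
        by (rule comp_low) (use EW_lead[OF uwE] True in simp)
      then show ?thesis by (simp add: app_diff)
    qed
    obtain \<epsilon> where "XW (u @ w) = single (mset (u @ w)) \<epsilon>"
      using cr_word[of "epar bs" "u @ w"] good_disjoint_count[OF w] by blast
    moreover have "mdeg kdeg (mset (u @ w)) = d" using True by (simp only: mdeg_mset)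
    ultimately have 2: "app (cmp d) (XW (u @ w)) = XW (u @ w)" by simp
    have 3: "scl (chw w) (app (cmp d) (EW u)) = scl (chw w) (XW u)"
    proof (cases "chw w = 0")
      case False
      then have du: "wdeg kdeg u = d" using True chw_wdeg[OF w(3)] by simp
      have "app (cmp d) (EW u - XW u) = 0"
        by (rule comp_low) (use EW_lead[OF uE] du in simp)
      moreover obtain \<epsilon> where "XW u = single (mset u) \<epsilon>" using good_cr_word[OF w(2)] by blast
      then have "app (cmp d) (XW u) = XW u" using du by simp
      ultimately show ?thesis by (simp add: app_diff)
    qed simp
    have "app Sb (XW u) = XW u"
      using Sb_word[OF w(1), of "[]"] by simp
    then show ?thesis unfolding K app_diff app_scl 1 2 3
      using Sb_word[OF w(1,3)] by (simp add: app_diff app_scl)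
  next
    case False
    then have d': "wdeg kdeg (u @ w) \<le> d - 1" using d by simp
    have "app (cmp d) (EW (u @ w)) = 0"
      by (rule comp_low) (use EW_lead[OF uwE] d' Fil_mono in blast)
    moreover have "scl (chw w) (app Sb (app (cmp d) (EW u))) = 0"
    proof (cases "chw w = 0")
      case False
      then have "wdeg kdeg u \<le> d - 1" using d' chw_wdeg[OF w(3)] by simp
      then have "app (cmp d) (EW u) = 0"
        by (intro comp_low) (use EW_lead[OF uE] Fil_mono in blast)
      then show ?thesis by simp
    qed simp
    ultimately show ?thesis unfolding K app_diff app_scl by (simp only: app_zero diff_zero)
  qed
qed

text \<open>A vector of degree at most \<open>d\<close> could be a sum of vectors
  \<open>Kg u w\<close> of higher degree. The projection \<open>Q\<close> to monomials containing a
  letter of \<mm> kills the part \<open>\<chi>(w) u\<close>, so each nonzero \<open>Kg u w\<close>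
  keeps the leading monomial of \<open>u w\<close>; these are distinct, and
  \<open>triangular\<close> bounds every term by \<open>d\<close>.\<close>

lemma KV_symbol:
  assumes v: "v \<in> KV" and d: "v \<in> F d"
  shows "app Sb (app (cmp d) v) = 0"
proof -
  let ?J = "{(u, w). set u \<subseteq> PG \<and> good (epar bs) u \<and> set w \<subseteq> MG \<and> good (epar bs) w}"
  have "v \<in> cvs.span ((\<lambda>(u, w). Kg u w) ` ?J)"
    using v unfolding KV_def by (rule subst[where P = "\<lambda>A. v \<in> cvs.span A", rotated]) auto
  then obtain t r where t: "finite t" "t \<subseteq> (\<lambda>(u, w). Kg u w) ` ?J" "v = (\<Sum>a\<in>t. scl (r a) a)"
    unfolding cvs.span_explicit by blast
  have "\<forall>a\<in>t. \<exists>p. p \<in> ?J \<and> (case p of (u, w) \<Rightarrow> Kg u w) = a" using t(2) by blast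
  from bchoice[OF this] obtain p where "\<forall>a\<in>t. p a \<in> ?J \<and> (case p a of (u, w) \<Rightarrow> Kg u w) = a" by blast
  then have p: "set (fst (p a)) \<subseteq> PG" "good (epar bs) (fst (p a))" "set (snd (p a)) \<subseteq> MG"
      "good (epar bs) (snd (p a))" "Kg (fst (p a)) (snd (p a)) = a" if "a \<in> t" for a
    using that by (auto simp: case_prod_beta)
  define \<mu> where "\<mu> a = mset (fst (p a) @ snd (p a))" for a
  define Q :: "(box \<times> box) multiset op" where "Q = rst (\<lambda>\<alpha>. \<exists>g\<in>#\<alpha>. g \<in> MG)"
  \<comment> \<open>This removes the pairs with empty \<open>w\<close>, for which \<open>Q\<close>
    would leave no leading monomial.\<close>
  define A where "A = {a \<in> t. a \<noteq> 0}"
  have vA: "v = (\<Sum>a\<in>A. scl (r a) a)"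
    unfolding t(3) A_def by (rule sum.mono_neutral_right) (use t(1) in auto)
  have deg: "mdeg kdeg (\<mu> a) \<le> d" if "a \<in> A" "r a \<noteq> 0" for a
  proof (rule triangular[where A = A and \<mu> = \<mu> and b = "app Q" and c = r])
    show "inj_on \<mu> A"
    proof (rule inj_onI)
      fix a b assume ab: "a \<in> A" "b \<in> A" "\<mu> a = \<mu> b"
      then have t: "a \<in> t" "b \<in> t" by (auto simp: A_def)
      have "filter_mset (\<lambda>g. g \<in> MG) (\<mu> c) = mset (snd (p c))" "filter_mset (\<lambda>g. g \<notin> MG) (\<mu> c) = mset (fst (p c))"
        if "c \<in> t" for c unfolding \<mu>_def by (rule filter_PM[OF p(1)[OF that] p(3)[OF that]])+
      from this[OF t(1)] this[OF t(2)] have "mset (snd (p a)) = mset (snd (p b))" "mset (fst (p a)) = mset (fst (p b))"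
        unfolding ab(3) by simp_all
      then have e: "snd (p a) = snd (p b)" "fst (p a) = fst (p b)"
        using good_mset_inj[OF p(4)[OF t(1)] p(4)[OF t(2)]] good_mset_inj[OF p(2)[OF t(1)] p(2)[OF t(2)]] by blast+
      have "a = Kg (fst (p a)) (snd (p a))" by (rule p(5)[OF t(1), symmetric])
      also have "\<dots> = Kg (fst (p b)) (snd (p b))" unfolding e by (rule refl)
      also have "\<dots> = b" by (rule p(5)[OF t(2)])
      finally show "a = b" .
    qed
    show "(\<Sum>a\<in>A. scl (r a) (app Q a)) \<in> F d"
      using rst_Fil[OF d, of "\<lambda>\<alpha>. \<exists>g\<in>#\<alpha>. g \<in> MG"] unfolding vA Q_def by (simp add: app_sum app_scl)
    fix a assume a: "a \<in> A"
    then have at: "a \<in> t" and nz: "a \<noteq> 0" by (auto simp: A_def)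
    let ?u = "fst (p a)" and ?w = "snd (p a)"
    note pa = p(1-4)[OF at]
    have uwE: "set (?u @ ?w) \<subseteq> EG" using pa PG_sub MG_sub by auto
    have "?w \<noteq> []"
    proof
      assume "?w = []"
      then have "a = 0" using p(5)[OF at] by (simp add: Kg_def sc_simps)
      then show False using nz by simp
    qed
    then obtain g where g: "g \<in> set ?w" by (cases ?w) auto
    then have gM: "\<exists>g\<in>#\<mu> a. g \<in> MG" using pa unfolding \<mu>_def by auto
    obtain \<epsilon> where e: "\<epsilon> \<noteq> 0" "XW (?u @ ?w) = single (\<mu> a) \<epsilon>"
      using cr_word[of "epar bs" "?u @ ?w"] good_disjoint_count[OF pa] unfolding \<mu>_def by blast
    have Q0: "app Q (EW ?u) = 0"
    proof (rule poly_mapping_eqI)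
      fix \<alpha>
      have "lookup (EW ?u) \<alpha> = 0" if "\<exists>g\<in>#\<alpha>. g \<in> MG"
      proof (rule ccontr)
        assume "lookup (EW ?u) \<alpha> \<noteq> 0"
        then have "set_mset \<alpha> \<subseteq> PG" using VQ_EW[OF pa(1)] by (auto simp: VQ_iff)
        then show False using that by (auto simp: Pgens_def Mgens_def)
      qed
      then show "lookup (app Q (EW ?u)) \<alpha> = lookup 0 \<alpha>" by (simp add: Q_def)
    qed
    have aeq: "a = EW (?u @ ?w) - scl (chw ?w) (EW ?u)"
      by (subst p(5)[OF at, symmetric]) (simp add: Kg_def app_diff app_scl)
    have "app Q a = app Q (EW (?u @ ?w) - scl (chw ?w) (EW ?u))" by (rule arg_cong[OF aeq])
    also have "\<dots> = app Q (EW (?u @ ?w))" by (simp only: app_diff app_scl Q0 cvs.scale_zero_right diff_zero)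
    finally have "app Q a = app Q (EW (?u @ ?w))" .
    moreover have "app Q (single (\<mu> a) \<epsilon>) = single (\<mu> a) \<epsilon>" using gM by (simp add: Q_def)
    ultimately have "app Q a - single (\<mu> a) \<epsilon> = app Q (EW (?u @ ?w) - XW (?u @ ?w))"
      using e by (simp add: app_diff)
    also have "\<dots> \<in> F (wdeg kdeg (?u @ ?w) - 1)" unfolding Q_def
      by (rule rst_Fil) (use EW_lead[OF uwE] in blast)
    also have "wdeg kdeg (?u @ ?w) = mdeg kdeg (\<mu> a)" unfolding \<mu>_def by (simp only: mdeg_mset)
    finally show "\<exists>\<epsilon>. \<epsilon> \<noteq> 0 \<and> app Q a - single (\<mu> a) \<epsilon> \<in> F (mdeg kdeg (\<mu> a) - 1)" using e(1) by blast
  qed (use t(1) that in \<open>auto simp: A_def\<close>)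
  have z: "scl (r a) (app Sb (app (cmp d) a)) = 0" if "a \<in> A" for a
  proof (cases "r a = 0")
    case False
    have at: "a \<in> t" using that by (simp add: A_def)
    have "wdeg kdeg (fst (p a) @ snd (p a)) \<le> d" using deg[OF that False] unfolding \<mu>_def by (simp only: mdeg_mset)
    from Kg_symbol[OF p(1-4)[OF at] this] p(5)[OF at] show ?thesis by simp
  qed simp
  have "app Sb (app (cmp d) v) = (\<Sum>a\<in>A. scl (r a) (app Sb (app (cmp d) a)))"
    by (simp only: vA app_sum app_scl)
  then show ?thesis using z by simp
qed

section \<open>The adjoint action on symbols\<close>

lemma cr_cmp: "cr (epar bs) g * cmp d = cmp (d + kdeg g) * cr (epar bs) g"
  by (rule op_eqI) (simp add: cr_single)

lemma an_cmp: "an (epar bs) g * cmp d = cmp (d - kdeg g) * an (epar bs) g"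
proof (rule op_eqI)
  fix \<alpha>
  show "app (an (epar bs) g * cmp d) (single \<alpha> 1) = app (cmp (d - kdeg g) * an (epar bs) g) (single \<alpha> 1)"
  proof (cases "g \<in># \<alpha>")
    case True
    then obtain \<beta> where "\<alpha> = add_mset g \<beta>" by (metis insert_DiffM)
    then show ?thesis by (simp add: an_single)
  next
    case False
    then have "count \<alpha> g = 0" by (simp add: not_in_iff)
    then show ?thesis by (simp add: an_single)
  qed
qed

lemma cr_an_cmp: "cr (epar bs) g * an (epar bs) h * cmp d = cmp (d + (kdeg g - kdeg h)) * (cr (epar bs) g * an (epar bs) h)"
proof -
  have e: "d + (kdeg g - kdeg h) = d - kdeg h + kdeg g" by simp
  have "cr (epar bs) g * an (epar bs) h * cmp d = (cr (epar bs) g * cmp (d - kdeg h)) * an (epar bs) h"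
    by (simp only: mult.assoc an_cmp)
  also have "\<dots> = cmp (d - kdeg h + kdeg g) * cr (epar bs) g * an (epar bs) h"
    by (simp only: cr_cmp)
  finally show ?thesis by (simp only: e mult.assoc)
qed

text \<open>The adjoint action of \<open>e\<^sub>a\<^sub>b\<close> on symbols.\<close>

definition adg :: "box \<Rightarrow> box \<Rightarrow> (box \<times> box) multiset op" where "adg a b = Lop a b - Rop a b"

lemma adg_cmp: "adg a b * cmp d = cmp (d + (kdeg (a, b) - 1)) * adg a b"
proof -
  have "X a c * DD b c * cmp d = cmp (d + (kdeg (a, b) - 1)) * (X a c * DD b c)" for c
    unfolding cr_an_cmp by (simp add: kdeg_pair)
  moreover have "sg s * (X c b * DD c a) * cmp d = cmp (d + (kdeg (a, b) - 1)) * (sg s * (X c b * DD c a))" for c s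
  proof -
    have "X c b * DD c a * cmp d = cmp (d + (kdeg (a, b) - 1)) * (X c b * DD c a)"
      unfolding cr_an_cmp by (simp add: kdeg_pair)
    then show ?thesis by (simp add: sg_def)
  qed
  ultimately show ?thesis
    by (simp add: adg_def Lop_def Rop_def sum_distrib_left sum_distrib_right left_diff_distrib right_diff_distrib)
qed

text \<open>Once moved to the vacuum, \<open>RR\<close> agrees with \<open>EE\<close>; so it is
  right multiplication of the word by a matrix unit, up to sign.\<close>

lemma RR_word: "a \<in> B \<Longrightarrow> b \<in> B \<Longrightarrow> set u \<subseteq> EG \<Longrightarrow>
  RR a b * prod_list (map EV u) = sg (ep a b \<and> wpar (epar bs) u) * (prod_list (map EV u) * RR a b)"
proof (induction u)
  case Nil
  then show ?case by (simp add: wpar_def sg_def)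
next
  case (Cons g u)
  obtain c e where g: "g = (c, e)" by (metis surj_pair)
  have ce: "c \<in> B" "e \<in> B" using Cons by (auto simp: g EG_iff)
  have "EV g = EE c e" using ce by (simp add: EV_def g EG_iff)
  then have 1: "RR a b * EV g = sg (ep a b \<and> epar bs g) * (EV g * RR a b)"
    using br_E_R[OF ce Cons(2,3)] unfolding br_def g epar_pair
    by (cases "ep c e \<and> ep a b") (auto simp: sg_def eq_neg_iff_add_eq_0 add.commute)
  have w: "wpar (epar bs) (g # u) = (epar bs g \<noteq> wpar (epar bs) u)" by (simp add: wpar_def)
  have "RR a b * prod_list (map EV (g # u)) = sg (ep a b \<and> epar bs g) * (EV g * (RR a b * prod_list (map EV u)))"
    by (simp add: mult.assoc[symmetric] 1)
  also have "RR a b * prod_list (map EV u) = sg (ep a b \<and> wpar (epar bs) u) * (prod_list (map EV u) * RR a b)"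
    using Cons by simp
  also have "sg (ep a b \<and> epar bs g) * (EV g * (sg (ep a b \<and> wpar (epar bs) u) * (prod_list (map EV u) * RR a b)))
     = sg (ep a b \<and> wpar (epar bs) (g # u)) * (prod_list (map EV (g # u)) * RR a b)"
    unfolding w by (cases "ep a b"; cases "epar bs g"; cases "wpar (epar bs) u") (simp_all add: sg_def mult.assoc)
  finally show ?case .
qed

text \<open>The adjoint action is the difference of \<open>EV - \<chi>\<close> and
  \<open>RR - \<chi>\<close>. The first sends a Whittaker vector to \<open>IV\<close> by definition;
  the second sends every word to \<open>IV\<close>, as right multiplication by
  \<open>g - \<chi>(g)\<close> produces the generators.\<close>

lemma adg_IV:
  assumes f: "f \<in> fspan {w. set w \<subseteq> EG}" and w: "app (ev EV f) vac \<in> WV" and ab: "(a, b) \<in> MG"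
  shows "app (adg a b) (app (ev EV f) vac) \<in> IV"
proof -
  let ?y = "app (ev EV f) vac"
  have B: "a \<in> B" "b \<in> B" and E: "(a, b) \<in> EG" using ab by (auto simp: MG_iff EG_iff)
  have "app (RR a b - sc (ch (a, b))) (EW u) \<in> IV" if "set u \<subseteq> EG" for u
  proof -
    let ?s = "sg (ep a b \<and> wpar (epar bs) u) :: (box \<times> box) multiset op"
    have ev: "EV (a, b) = EE a b" using E by (simp add: EV_def)
    have "app (RR a b) (EW u) = app (RR a b * prod_list (map EV u)) vac" by simp
    also have "\<dots> = app ?s (app (prod_list (map EV u)) (app (EV (a, b)) vac))"
      unfolding RR_word[OF B that] ev by (simp add: E_vac R_vac)
    finally have 1: "app (RR a b) (EW u) = app ?s (app (prod_list (map EV u)) (app (EV (a, b)) vac))" .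
    have "scl (ch (a, b)) (EW u) = app ?s (scl (ch (a, b)) (EW u))"
      using ch_odd[OF ab] by (auto simp: sg_def epar_pair)
    then have "app (RR a b - sc (ch (a, b))) (EW u) = app ?s (app (prod_list (map EV u)) (app (EV (a, b) - sc (ch (a, b))) vac))"
      using 1 by (simp add: app_diff app_scl)
    moreover have "app (prod_list (map EV u)) (app (EV (a, b) - sc (ch (a, b))) vac) \<in> IV" by (rule IV_gen[OF ab])
    ultimately show ?thesis using IV_closed(4) by (auto simp: sg_def)
  qed
  then have "(\<Sum>u | f u \<noteq> 0. scl (f u) (app (RR a b - sc (ch (a, b))) (EW u))) \<in> IV"
    by (intro IV_closed) (use f in \<open>auto simp: fspan_def\<close>)
  then have 1: "app (RR a b - sc (ch (a, b))) ?y \<in> IV"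
    by (simp only: app_ev app_sum app_scl)
  have 2: "app (EV (a, b) - sc (ch (a, b))) ?y \<in> IV" using w ab unfolding WV_def by blast
  have "app (adg a b) ?y = app (EV (a, b) - sc (ch (a, b))) ?y - app (RR a b - sc (ch (a, b))) ?y"
    using E by (simp add: adg_def EV_def EE_def RR_def)
  then show ?thesis using IV_closed(3)[OF 2 1] by simp
qed

text \<open>\<open>adg\<close> is homogeneous of degree \<open>kdeg - 1\<close>, so the top
  component of the vector goes to the top component of an element of \<open>KV\<close>.\<close>

lemma adg_symbol:
  assumes f: "f \<in> fspan {w. set w \<subseteq> EG}" and w: "app (ev EV f) vac \<in> WV" and ab: "(a, b) \<in> MG"
    and d: "app (ev EV f) vac \<in> F d"
  shows "app Sb (app (adg a b) (app (cmp d) (app (ev EV f) vac))) = 0"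
proof -
  let ?y = "app (ev EV f) vac"
  have "odeg kdeg (kdeg (a, b) - 1) (Lop a b + - Rop a b)"
    by (intro odeg_add odeg_uminus odeg_L odeg_R)
  then have "odeg kdeg (kdeg (a, b) - 1) (adg a b)" by (simp add: adg_def)
  then have "app (adg a b) ?y \<in> F (d + (kdeg (a, b) - 1))" using d unfolding odeg_def by blast
  moreover have "app (adg a b) ?y \<in> KV" by (rule IV_sub_KV[OF adg_IV[OF f w ab]])
  ultimately have "app Sb (app (cmp (d + (kdeg (a, b) - 1)) * adg a b) ?y) = 0" using KV_symbol by simp
  then show ?thesis unfolding adg_cmp[symmetric] by simp
qed

section \<open>Faithfulness of the small module\<close>

definition qord :: "(box \<times> box) multiset \<Rightarrow> nat" where
  "qord \<alpha> = size {#g \<in># \<alpha>. snd (fst g) \<noteq> 1#}"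

lemma qord_add: "qord (add_mset g \<alpha>) = (if snd (fst g) \<noteq> 1 then Suc (qord \<alpha>) else qord \<alpha>)"
  by (simp add: qord_def)

lemma lookup_an_qord:
  assumes "\<And>\<alpha>. lookup v \<alpha> \<noteq> 0 \<Longrightarrow> j \<le> qord \<alpha>" "qord (add_mset g \<beta>) < j"
  shows "lookup (app (an (epar bs) g) v) \<beta> = 0"
  using assms(1)[of "add_mset g \<beta>"] assms(2) by (auto simp: lookup_an)

text \<open>For \<open>b\<close> the left neighbour of the box \<open>c\<close>, the element \<open>e\<^sub>d\<^sub>b\<close> turns the variable \<open>x\<^sub>c\<^sub>d\<close> into \<open>x\<^sub>c\<^sub>b\<close>, that
  is, into the nonzero number \<open>\<chi>(e\<^sub>c\<^sub>b)\<close>. By induction on the column of \<open>c\<close>, if \<open>c\<close> is not in column 1 then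
  \<open>x\<^sub>c\<^sub>d\<close> does not occur in the monomials with the fewest variables outside column 1.\<close>

lemma symbol_zero:
  assumes v: "v \<in> VP" and ad: "\<And>a b. (a, b) \<in> MG \<Longrightarrow> app Sb (app (adg a b) v) = 0"
    and c: "app cpart v = 0"
  shows "v = 0"
proof (rule ccontr)
  assume "v \<noteq> 0"
  then have ne: "keys v \<noteq> {}" by simp
  \<comment> \<open>Minimality of \<open>j\<close> kills every coefficient at a monomial with fewer
    than \<open>j\<close> variables outside column 1; almost all unwanted terms below are of this
    kind.\<close>
  define j where "j = Min (qord ` keys v)"
  have jmin: "j \<le> qord \<alpha>" if "lookup v \<alpha> \<noteq> 0" for \<alpha>
    unfolding j_def using that by (intro Min_le) (auto simp: in_keys_iff)
  have "j \<in> qord ` keys v" unfolding j_def by (rule Min_in) (use ne in auto)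
  then obtain \<alpha>0 where a0: "lookup v \<alpha>0 \<noteq> 0" "qord \<alpha>0 = j" by (auto simp: in_keys_iff)
  have "\<exists>h\<in>#\<alpha>0. snd (fst h) \<noteq> 1"
  proof (rule ccontr)
    assume "\<not> ?thesis"
    then have "lookup (app cpart v) \<alpha>0 = lookup v \<alpha>0" by (simp add: cpart_def)
    then show False using c a0 by simp
  qed
  then obtain h where h: "h \<in># \<alpha>0" "snd (fst h) \<noteq> 1" by blast
  obtain c0 d0 where cd0: "h = (c0, d0)" by (metis surj_pair)
  define Z where "Z \<beta> a b = lookup (app (DD a b) v) \<beta>" for \<beta> a b
  have Z: "Z \<beta> c d = 0" if qb: "qord \<beta> + 1 = j" and that: "2 \<le> snd c" "(c, d) \<in> PG" for \<beta> c d
    using that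
  proof (induction "snd c" arbitrary: c d rule: less_induct)
    case less
    define c' where "c' = (fst c, snd c - 1)"
    define d' where "d' = (fst d, snd d - 1)"
    have B: "c \<in> B" "d \<in> B" and cd: "snd c \<le> snd d" using less.prems by (auto simp: PG_iff)
    have B': "c' \<in> B" "d' \<in> B" using B cd less.prems(1) by (auto simp: c'_def d'_def boxes_def mem_Times_iff)
    have dc: "(d, c') \<in> MG" using B B' cd less.prems(1) by (auto simp: MG_iff c'_def)
    \<comment> \<open>Left multiplication contributes the same kind of coefficient one column
      further left, zero by induction or, when \<open>c'\<close> lies in column 1, by minimality of
      \<open>j\<close>.\<close>
    have Z': "Z \<beta> c' d' = 0"
    proof (cases "snd c = 2")
      case True
      then have "qord (add_mset (c', d') \<beta>) = qord \<beta>" by (simp add: qord_add c'_def)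
      then show ?thesis unfolding Z_def by (intro lookup_an_qord[of v j]) (use jmin qb in auto)
    next
      case False
      have "(c', d') \<in> PG" using B' cd by (auto simp: PG_iff c'_def d'_def)
      moreover have "snd c' < snd c" "2 \<le> snd c'" using False less.prems(1) by (auto simp: c'_def)
      ultimately show ?thesis using less.hyps by blast
    qed
    have T1: "lookup (app Sb (app (X d e) (app (DD c' e) v))) \<beta> = (if e = d' then ch (d, d') * Z \<beta> c' d' else 0)"
      if e: "e \<in> B" for e
    proof (cases "(d, e) \<in> MG")
      case True
      have "app Sb (app (X d e) (app (DD c' e) v)) = app (Sb * X d e) (app (DD c' e) v)" by simp
      also have "\<dots> = scl (ch (d, e)) (app (DD c' e) v)"
        unfolding Sb_cr_M[OF True] using Sb_VP[OF VQ_an[OF v]] by simp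
      finally have "lookup (app Sb (app (X d e) (app (DD c' e) v))) \<beta> = ch (d, e) * Z \<beta> c' e" by (simp add: Z_def)
      moreover have "ch (d, e) \<noteq> 0 \<Longrightarrow> e = d'" using B e by (auto simp: ch_eq d'_def prod_eq_iff split: if_splits)
      ultimately show ?thesis by auto
    next
      case False
      have ne: "e \<noteq> d'" using False B B' cd less.prems(1) by (auto simp: MG_iff d'_def)
      \<comment> \<open>Here \<open>x_de\<close> survives as a variable. It starts outside column 1,
        so exchanging it for \<open>x_c'e\<close> cannot raise \<open>qord\<close>.\<close>
      have de: "(d, e) \<in> PG" using False B e by (auto simp: MG_iff PG_iff)
      have "lookup (app (X d e) (app (DD c' e) v)) \<beta> = 0"
      proof (cases "(d, e) \<in># \<beta>")
        case True
        then obtain \<gamma> where g: "\<beta> = add_mset (d, e) \<gamma>" by (metis insert_DiffM)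
        have "qord \<beta> = Suc (qord \<gamma>)" using cd less.prems(1) by (simp add: g qord_add)
        then have "qord (add_mset (c', e) \<gamma>) < j" using qb by (auto simp: qord_add)
        then have "lookup (app (DD c' e) v) \<gamma> = 0" using jmin by (intro lookup_an_qord[of v j]) auto
        then show ?thesis by (simp add: g lookup_cr_add)
      next
        case False
        then show ?thesis by (rule lookup_cr_notin)
      qed
      then show ?thesis using Sb_VP[OF VQ_cr[OF de VQ_an[OF v]]] ne by simp
    qed
    have T2: "lookup (app Sb (app (X e c') (app (DD e d) v))) \<beta> = (if e = c then ch (c, c') * Z \<beta> c d else 0)"
      if e: "e \<in> B" for e
    proof (cases "(e, c') \<in> MG")
      case True
      have "app Sb (app (X e c') (app (DD e d) v)) = app (Sb * X e c') (app (DD e d) v)" by simp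
      also have "\<dots> = scl (ch (e, c')) (app (DD e d) v)"
        unfolding Sb_cr_M[OF True] using Sb_VP[OF VQ_an[OF v]] by simp
      finally have "lookup (app Sb (app (X e c') (app (DD e d) v))) \<beta> = ch (e, c') * Z \<beta> e d" by (simp add: Z_def)
      moreover have "ch (e, c') \<noteq> 0 \<Longrightarrow> e = c" using B' e less.prems(1) by (auto simp: ch_eq c'_def prod_eq_iff split: if_splits)
      ultimately show ?thesis by auto
    next
      case False
      have ne: "e \<noteq> c" using False B B' less.prems(1) by (auto simp: MG_iff c'_def)
      \<comment> \<open>This exchange keeps the first box and therefore \<open>qord\<close>.\<close>
      have de: "(e, c') \<in> PG" using False B' e by (auto simp: MG_iff PG_iff)
      have "lookup (app (X e c') (app (DD e d) v)) \<beta> = 0"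
      proof (cases "(e, c') \<in># \<beta>")
        case True
        then obtain \<gamma> where g: "\<beta> = add_mset (e, c') \<gamma>" by (metis insert_DiffM)
        have "qord (add_mset (e, d) \<gamma>) = qord \<beta>" by (simp add: g qord_add)
        then have "lookup (app (DD e d) v) \<gamma> = 0" using jmin qb by (intro lookup_an_qord[of v j]) auto
        then show ?thesis by (simp add: g lookup_cr_add)
      next
        case False
        then show ?thesis by (rule lookup_cr_notin)
      qed
      then show ?thesis using Sb_VP[OF VQ_cr[OF de VQ_an[OF v]]] ne by simp
    qed
    have s: "app Sb (app (sg t) x) = scl (sgn t) (app Sb x)" for t and x :: "(box \<times> box) multiset \<Rightarrow>\<^sub>0 complex"
      by (simp add: sg_def sgn_def app_uminus)
    have "0 = lookup (app Sb (app (adg d c') v)) \<beta>" using ad[OF dc] by simp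
    also have "\<dots> = (\<Sum>e\<in>B. lookup (app Sb (app (X d e) (app (DD c' e) v))) \<beta>)
       - (\<Sum>e\<in>B. sgn (ep e d \<and> ep d c') * lookup (app Sb (app (X e c') (app (DD e d) v))) \<beta>)"
      unfolding adg_def Lop_def Rop_def
      by (simp only: app_simps(4) app_sum_left app_diff lookup_minus app_sum lookup_sum s lookup_scl app_simps(6))
    also have "(\<Sum>e\<in>B. lookup (app Sb (app (X d e) (app (DD c' e) v))) \<beta>) = 0"
      using T1 Z' by simp
    also have "(\<Sum>e\<in>B. sgn (ep e d \<and> ep d c') * lookup (app Sb (app (X e c') (app (DD e d) v))) \<beta>)
       = (\<Sum>e\<in>B. if e = c then sgn (ep c d \<and> ep d c') * ch (c, c') * Z \<beta> c d else 0)"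
      by (rule sum.cong) (simp_all add: T2)
    finally have "sgn (ep c d \<and> ep d c') * ch (c, c') * Z \<beta> c d = 0" using B by simp
    moreover have "ch (c, c') \<noteq> 0" using B B' less.prems(1) by (simp add: ch_eq c'_def sgn_def)
    ultimately show ?case by (auto simp: sgn_def split: if_splits)
  qed
  obtain \<beta> where b: "\<alpha>0 = add_mset h \<beta>" using h by (metis insert_DiffM)
  have "set_mset \<alpha>0 \<subseteq> PG" and odd1: "\<And>g. epar bs g \<Longrightarrow> count \<alpha>0 g \<le> 1"
    using v a0 unfolding VQ_iff by blast+
  then have hP: "(c0, d0) \<in> PG" using h cd0 by auto
  then have "1 \<le> snd c0" by (auto simp: PG_iff boxes_def mem_Times_iff)
  then have "2 \<le> snd c0" using h cd0 by simp
  moreover have "qord \<beta> + 1 = j" using a0 b h by (simp add: qord_add)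
  ultimately have "Z \<beta> c0 d0 = 0" using Z hP by blast
  moreover have "even (count \<beta> h)" if "epar bs h"
  proof -
    have "count \<beta> h = 0" using odd1[OF that] b by (metis Suc_le_mono count_add_mset le_zero_eq One_nat_def)
    then show ?thesis by (metis even_zero)
  qed
  ultimately show False using a0 b unfolding Z_def cd0[symmetric]
    by (auto simp: lookup_an split: if_splits simp del: of_nat_Suc)
qed

text \<open>Applied to the component of maximal Kazhdan degree: its column 1 part is the symbol in
  the small module, so the vanishing there supplies the last premise of
  \<open>symbol_zero\<close>.\<close>

lemma Whittaker_faithful:
  assumes f: "f \<in> fspan {w. set w \<subseteq> PG}" and w: "app (ev EV f) vac \<in> WV" and m: "app (ev MV f) vac = 0"
  shows "app (ev EV f) vac = 0"
proof (rule ccontr)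
  let ?y = "app (ev EV f) vac"
  assume nz: "?y \<noteq> 0"
  have fE: "f \<in> fspan {w. set w \<subseteq> EG}" by (rule fspan_mono[OF f]) (auto dest: PG_sub)
  have yVP: "?y \<in> VP" unfolding app_ev
    by (intro VQ_closed VQ_EW) (use f in \<open>auto simp: fspan_def\<close>)
  define d where "d = Max (mdeg kdeg ` keys ?y)"
  have ne: "keys ?y \<noteq> {}" using nz by simp
  have d: "?y \<in> F d" unfolding Fil_def d_def by auto
  have "d \<in> mdeg kdeg ` keys ?y" unfolding d_def by (rule Max_in) (use ne in auto)
  then obtain \<alpha> where a: "lookup ?y \<alpha> \<noteq> 0" "mdeg kdeg \<alpha> = d" by (auto simp: in_keys_iff)
  have "app (cmp d) ?y = 0"
  proof (rule symbol_zero)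
    show "app (cmp d) ?y \<in> VP" using yVP by (auto simp: VQ_iff)
    show "app cpart (app (cmp d) ?y) = 0" using M_symbol(2)[OF f d] m by simp
    show "app Sb (app (adg a b) (app (cmp d) ?y)) = 0" if "(a, b) \<in> MG" for a b
      by (rule adg_symbol[OF fE w that d])
  qed
  then have "lookup (app (cmp d) ?y) \<alpha> = 0" by simp
  then show False using a by simp
qed

section \<open>Chain sums\<close>

text \<open>\<open>p\<close> is the least column in which the next pair may start. The degree is an
  integer, so that an overshooting pair leaves no chain; the empty chain makes the sum in degree 0
  the Kronecker delta, matching the convention for \<open>t\<close> in degree 0.\<close>

fun chain :: "nat \<Rightarrow> int \<Rightarrow> nat \<Rightarrow> nat \<Rightarrow> (box \<times> box) list \<Rightarrow> bool" where
  "chain p r i j [] \<longleftrightarrow> r = 0 \<and> i = j"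
| "chain p r i j (g # ps) \<longleftrightarrow> g \<in> PG \<and> fst (fst g) = i \<and> p \<le> snd (fst g) \<and>
     chain (snd (snd g) + 1) (r - kdeg g) (fst (snd g)) j ps"

lemma kdeg_pos: "g \<in> PG \<Longrightarrow> 1 \<le> kdeg g"
  by (auto simp: Pgens_def kdeg_def)

lemma chain_length: "chain p r i j ps \<Longrightarrow> set ps \<subseteq> PG \<and> int (length ps) \<le> r"
proof (induction ps arbitrary: p r i)
  case (Cons g ps)
  then show ?case using kdeg_pos[of g] by force
qed simp

lemma finite_PG: "finite PG"
  by (rule finite_subset[of _ "B \<times> B"]) (auto simp: Pgens_def Egens_def)

lemma finite_chains: "finite {ps. chain p r i j ps}"
  by (rule finite_subset[OF _ finite_lists_length_le[OF finite_PG, of "nat r"]]) (use chain_length in force)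

text \<open>The pairs span disjoint intervals of columns, and the degree of a pair is the number of
  columns it spans. This is why the elements \<open>t\<close> vanish beyond degree
  \<open>l\<close>.\<close>

lemma chain_bound: "chain p r i j ps \<Longrightarrow> p \<le> l + 1 \<Longrightarrow> r \<le> int (l + 1) - int p"
proof (induction ps arbitrary: p r i)
  case (Cons g ps)
  then have g: "g \<in> PG" "p \<le> snd (fst g)" and c: "chain (snd (snd g) + 1) (r - kdeg g) (fst (snd g)) j ps" by auto
  have "snd (snd g) \<le> l" using g by (auto simp: Pgens_def Egens_def boxes_def)
  then have "r - kdeg g \<le> int (l + 1) - int (snd (snd g) + 1)" using Cons.IH[OF c] by simp
  then show ?case using g by (simp add: kdeg_def)
qed simp

definition TH :: "(box \<times> box \<Rightarrow> (box \<times> box) multiset op) \<Rightarrow> nat \<Rightarrow> int \<Rightarrow> nat \<Rightarrow> nat \<Rightarrow> (box \<times> box) multiset op" where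
  "TH A p r i j = (\<Sum>ps | chain p r i j ps. prod_list (map A ps))"

lemma TH_neg: "r < 0 \<Longrightarrow> TH A p r i j = 0"
  using chain_length[of p r i j] by (force simp: TH_def intro: sum.neutral)

lemma TH_large: "p \<le> l + 1 \<Longrightarrow> r > int (l + 1) - int p \<Longrightarrow> TH A p r i j = 0"
  using chain_bound[of p r i j] by (force simp: TH_def intro: sum.neutral)

lemma TH_rec: "TH A p r i j = (if r = 0 \<and> i = j then 1 else 0) +
   (\<Sum>g | g \<in> PG \<and> fst (fst g) = i \<and> p \<le> snd (fst g). A g * TH A (snd (snd g) + 1) (r - kdeg g) (fst (snd g)) j)"
proof -
  let ?G = "{g. g \<in> PG \<and> fst (fst g) = i \<and> p \<le> snd (fst g)}"
  let ?C = "\<lambda>g. {ps. chain (snd (snd g) + 1) (r - kdeg g) (fst (snd g)) j ps}"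
  have finG: "finite ?G" by (rule finite_subset[OF _ finite_PG]) auto
  have eq: "{ps. chain p r i j ps} = (if r = 0 \<and> i = j then {[]} else {}) \<union> (\<Union>g\<in>?G. (#) g ` ?C g)"
  proof (rule set_eqI)
    fix ps
    show "ps \<in> {ps. chain p r i j ps} \<longleftrightarrow> ps \<in> (if r = 0 \<and> i = j then {[]} else {}) \<union> (\<Union>g\<in>?G. (#) g ` ?C g)"
    proof (cases ps)
      case (Cons g qs)
      have "g # qs \<in> (\<Union>g\<in>?G. (#) g ` ?C g) \<longleftrightarrow> g \<in> ?G \<and> qs \<in> ?C g" by blast
      then show ?thesis using Cons by simp
    qed auto
  qed
  have "TH A p r i j = (\<Sum>ps\<in>(if r = 0 \<and> i = j then {[]} else {}). prod_list (map A ps)) +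
     (\<Sum>ps\<in>(\<Union>g\<in>?G. (#) g ` ?C g). prod_list (map A ps))"
    unfolding TH_def eq by (rule sum.union_disjoint) (use finG finite_chains in auto)
  also have "(\<Sum>ps\<in>(\<Union>g\<in>?G. (#) g ` ?C g). prod_list (map A ps)) = (\<Sum>g\<in>?G. \<Sum>ps\<in>(#) g ` ?C g. prod_list (map A ps))"
    by (rule sum.UNION_disjoint) (use finG finite_chains in auto)
  also have "\<dots> = (\<Sum>g\<in>?G. A g * TH A (snd (snd g) + 1) (r - kdeg g) (fst (snd g)) j)"
    unfolding TH_def by (rule sum.cong[OF refl]) (simp add: sum.reindex sum_distrib_left)
  finally show ?thesis by auto
qed

lemma TH_zero: "TH A p 0 i j = (if i = j then 1 else 0)"
proof -
  have "(\<Sum>g | g \<in> PG \<and> fst (fst g) = i \<and> p \<le> snd (fst g). A g * TH A (snd (snd g) + 1) (0 - kdeg g) (fst (snd g)) j) = 0"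
  proof (rule sum.neutral, rule ballI)
    fix g assume "g \<in> {g \<in> PG. fst (fst g) = i \<and> p \<le> snd (fst g)}"
    then have "0 - kdeg g < 0" using kdeg_pos[of g] by simp
    then show "A g * TH A (snd (snd g) + 1) (0 - kdeg g) (fst (snd g)) j = 0" by (simp only: TH_neg mult_zero_right)
  qed
  then show ?thesis by (subst TH_rec) simp
qed

abbreviation "Bge p \<equiv> {b \<in> B. p \<le> snd b}"

text \<open>Separates the chains whose first pair starts exactly in column \<open>p\<close>; their
  tails begin right of the column where that pair ends.\<close>

lemma TH_split:
  assumes i: "i \<in> {1..k}" and p: "1 \<le> p" "p \<le> l"
  shows "TH A p r i j = TH A (p + 1) r i j +
    (\<Sum>b\<in>Bge p. A ((i, p), b) * TH A (snd b + 1) (r - (int (snd b) - int p + 1)) (fst b) j)"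
proof -
  let ?f = "\<lambda>g. A g * TH A (snd (snd g) + 1) (r - kdeg g) (fst (snd g)) j"
  have eq: "{g. g \<in> PG \<and> fst (fst g) = i \<and> p \<le> snd (fst g)} =
     {g. g \<in> PG \<and> fst (fst g) = i \<and> p + 1 \<le> snd (fst g)} \<union> Pair (i, p) ` Bge p"
    using i p by (auto simp: PG_iff boxes_def image_iff le_Suc_eq) 
  have "sum ?f {g. g \<in> PG \<and> fst (fst g) = i \<and> p \<le> snd (fst g)} =
     sum ?f {g. g \<in> PG \<and> fst (fst g) = i \<and> p + 1 \<le> snd (fst g)} + sum ?f (Pair (i, p) ` Bge p)"
    unfolding eq by (rule sum.union_disjoint) (auto intro: finite_subset[OF _ finite_PG])
  moreover have "sum ?f (Pair (i, p) ` Bge p) =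
     (\<Sum>b\<in>Bge p. A ((i, p), b) * TH A (snd b + 1) (r - (int (snd b) - int p + 1)) (fst b) j)"
    by (subst sum.reindex) (auto simp: inj_on_def kdeg_pair)
  ultimately show ?thesis
    by (subst TH_rec, subst TH_rec[of A "p + 1"]) (simp only: add.assoc)
qed

section \<open>The elements t as chain sums\<close>

definition te :: "box \<times> box \<Rightarrow> (box \<times> box) fa" where "te g = tilde_e bs m n l (fst g) (snd g)"

text \<open>The sign of a chain is distributed over its factors, one for each pair.\<close>

definition At :: "(box \<times> box \<Rightarrow> (box \<times> box) multiset op) \<Rightarrow> box \<times> box \<Rightarrow> (box \<times> box) multiset op" where
  "At A g = sg (bp (fst g)) * ev A (te g)"

lemma te_fspan: "g \<in> PG \<Longrightarrow> te g \<in> fspan {w. set w \<subseteq> PG}"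
  by (auto simp: te_def tilde_e_def fgen_def intro!: fspan_fsmul fspan_fadd)

lemma te_ev: "ev A (te (a, b)) = sc (sgn (odd (int (snd b) - int (snd a)))) *
   (A (a, b) + (if a = b then sc (sgn (bp a) * rho m n l (snd a)) else 0))"
proof -
  have 1: "fgen (a, b) \<in> fspan UNIV" "ev A (fgen (a, b)) = A (a, b)" by (auto simp: fgen_def)
  have 2: "(if a = b then fsmul (sgn (bp a) * rho m n l (snd a)) fone else fzero) \<in> fspan UNIV"
    "ev A (if a = b then fsmul (sgn (bp a) * rho m n l (snd a)) fone else fzero) = (if a = b then sc (sgn (bp a) * rho m n l (snd a)) else 0)"
    by (auto simp: ev_fsmul fspan_fsmul)
  show ?thesis unfolding te_def tilde_e_def fst_conv snd_conv
    using 1 2 by (simp only: ev_fsmul[OF fspan_fadd[OF 1(1) 2(1)]] ev_fadd[OF 1(1) 2(1)])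
qed

lemma chain_char:
  "ps \<noteq> [] \<Longrightarrow> chain p r i j ps \<longleftrightarrow> set ps \<subseteq> PG \<and> wdeg kdeg ps = r \<and>
     (\<forall>t. t + 1 < length ps \<longrightarrow> snd (snd (ps ! t)) < snd (fst (ps ! (t + 1))) \<and> fst (snd (ps ! t)) = fst (fst (ps ! (t + 1)))) \<and>
     fst (fst (hd ps)) = i \<and> fst (snd (last ps)) = j \<and> p \<le> snd (fst (hd ps))"
proof (induction ps arbitrary: p r i)
  case (Cons g ps)
  show ?case
  proof (cases ps)
    case Nil
    then show ?thesis by (auto simp: algebra_simps)
  next
    case (Cons h qs)
    have split: "(\<forall>t. t + 1 < length (g # ps) \<longrightarrow> Q ((g # ps) ! t) ((g # ps) ! (t + 1))) \<longleftrightarrow>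
       Q g (hd ps) \<and> (\<forall>t. t + 1 < length ps \<longrightarrow> Q (ps ! t) (ps ! (t + 1)))" for Q
    proof
      assume *: "\<forall>t. t + 1 < length (g # ps) \<longrightarrow> Q ((g # ps) ! t) ((g # ps) ! (t + 1))"
      have "Q g (hd ps)" using *[rule_format, of 0] Cons by simp
      moreover have "Q (ps ! t) (ps ! (t + 1))" if "t + 1 < length ps" for t
        using *[rule_format, of "Suc t"] that by simp
      ultimately show "Q g (hd ps) \<and> (\<forall>t. t + 1 < length ps \<longrightarrow> Q (ps ! t) (ps ! (t + 1)))" by blast
    next
      assume *: "Q g (hd ps) \<and> (\<forall>t. t + 1 < length ps \<longrightarrow> Q (ps ! t) (ps ! (t + 1)))"
      show "\<forall>t. t + 1 < length (g # ps) \<longrightarrow> Q ((g # ps) ! t) ((g # ps) ! (t + 1))"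
      proof (intro allI impI)
        fix t assume t: "t + 1 < length (g # ps)"
        show "Q ((g # ps) ! t) ((g # ps) ! (t + 1))"
        proof (cases t)
          case 0
          then show ?thesis using * Cons by simp
        next
          case (Suc t')
          then show ?thesis using * t by simp
        qed
      qed
    qed
    have ne: "ps \<noteq> []" using Cons by simp
    have "last (g # ps) = last ps" using ne by simp
    then show ?thesis
      unfolding chain.simps Cons.IH[OF ne] split[of "\<lambda>a b. snd (snd a) < snd (fst b) \<and> fst (snd a) = fst (fst b)"]
      by (auto simp: algebra_simps)
  qed
qed simp

text \<open>The natural subtraction in the degree is exact as columns do not decrease within a pair,
  and the bound on the length follows since every pair has degree at least 1.\<close>

lemma tseqs_chain: assumes "1 \<le> r" shows "tseqs k l i j r = {ps. chain 1 (int r) i j ps}"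
proof (rule set_eqI)
  fix ps
  have deg: "int (sum_list (map (\<lambda>g. snd (snd g) - snd (fst g) + 1) ps)) = wdeg kdeg ps" if "set ps \<subseteq> PG"
    using that by (induction ps) (auto simp: kdeg_def Pgens_def of_nat_diff)
  show "ps \<in> tseqs k l i j r \<longleftrightarrow> ps \<in> {ps. chain 1 (int r) i j ps}"
  proof (cases "ps = []")
    case True
    then show ?thesis using assms by (simp add: tseqs_def)
  next
    case False
    then have l1: "1 \<le> length ps" by (cases ps) auto
    have P: "set ps \<subseteq> EG \<and> (\<forall>g\<in>set ps. snd (fst g) \<le> snd (snd g)) \<longleftrightarrow> set ps \<subseteq> PG" by (auto simp: Pgens_def)
    show ?thesis
    proof
      assume "ps \<in> tseqs k l i j r"
      then have t: "set ps \<subseteq> PG" "sum_list (map (\<lambda>g. snd (snd g) - snd (fst g) + 1) ps) = r"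
         "(\<forall>t. t + 1 < length ps \<longrightarrow> snd (snd (ps ! t)) < snd (fst (ps ! (t + 1))) \<and> fst (snd (ps ! t)) = fst (fst (ps ! (t + 1))))"
         "fst (fst (hd ps)) = i" "fst (snd (last ps)) = j"
        unfolding tseqs_def using P by blast+
      have "hd ps \<in> PG" using t(1) False by (meson hd_in_set subsetD)
      then have "1 \<le> snd (fst (hd ps))" by (auto simp: Pgens_def Egens_def boxes_def)
      then show "ps \<in> {ps. chain 1 (int r) i j ps}"
        unfolding mem_Collect_eq chain_char[OF False] using t deg[OF t(1)] by simp
    next
      assume c: "ps \<in> {ps. chain 1 (int r) i j ps}"
      then have t: "set ps \<subseteq> PG" "wdeg kdeg ps = int r"
         "(\<forall>t. t + 1 < length ps \<longrightarrow> snd (snd (ps ! t)) < snd (fst (ps ! (t + 1))) \<and> fst (snd (ps ! t)) = fst (fst (ps ! (t + 1))))"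
         "fst (fst (hd ps)) = i" "fst (snd (last ps)) = j"
        unfolding mem_Collect_eq chain_char[OF False] by blast+
      have "length ps \<le> r" using chain_length c by fastforce
      moreover have "sum_list (map (\<lambda>g. snd (snd g) - snd (fst g) + 1) ps) = r" using deg[OF t(1)] t(2) by simp
      ultimately show "ps \<in> tseqs k l i j r" unfolding tseqs_def using t P l1 by blast
    qed
  qed
qed

lemma t_elem_fspan: "1 \<le> r \<Longrightarrow> t_elem bs m n l i j r \<in> fspan {w. set w \<subseteq> PG}"
  unfolding t_elem_def
proof (intro fspan_fsum fspan_fsmul fspan_fprod_letters)
  assume r: "1 \<le> r"
  show "finite (tseqs (m + n) l i j r)" unfolding tseqs_chain[OF r] by (rule finite_chains)
  fix ps f assume "ps \<in> tseqs (m + n) l i j r" "f \<in> set (map (\<lambda>g. tilde_e bs m n l (fst g) (snd g)) ps)"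
  then show "f \<in> fspan {w. set w \<subseteq> PG}"
    unfolding tseqs_chain[OF r] using chain_length te_fspan unfolding te_def by fastforce
qed

lemma sg_wpar: "sc (sgn (wpar par ps)) * prod_list (map A ps) = prod_list (map (\<lambda>g. sg (par g) * A g) ps)"
proof (induction ps)
  case (Cons g ps)
  have w: "wpar par (g # ps) = (par g \<noteq> wpar par ps)" by (simp add: wpar_def)
  have "sc (sgn (wpar par (g # ps))) * prod_list (map A (g # ps)) = sg (par g) * A g * (sc (sgn (wpar par ps)) * prod_list (map A ps))"
    unfolding w sc_sgn by (cases "par g"; cases "wpar par ps") (simp_all add: sg_def mult.assoc)
  then show ?case using Cons by simp
qed (simp add: wpar_def sc_sgn sg_def)

lemma t_elem_ev: assumes r: "1 \<le> r" shows "ev A (t_elem bs m n l i j r) = TH (At A) 1 (int r) i j"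
proof -
  have te: "te g \<in> fspan UNIV" if "chain 1 (int r) i j ps" "g \<in> set ps" for ps g
    using te_fspan chain_length[OF that(1)] that(2) fspan_UNIV by blast
  have "ev A (t_elem bs m n l i j r) = (\<Sum>ps | chain 1 (int r) i j ps.
     ev A (fsmul (sgn (wpar (\<lambda>g. bp (fst g)) ps)) (fprod (map te ps))))"
    unfolding t_elem_def tseqs_chain[OF r] te_def[symmetric]
    by (rule ev_fsum) (use te finite_chains in \<open>auto intro!: fspan_fsmul fspan_fprod\<close>)
  also have "\<dots> = TH (At A) 1 (int r) i j"
    unfolding TH_def
  proof (rule sum.cong[OF refl])
    fix ps assume "ps \<in> {ps. chain 1 (int r) i j ps}"
    then have c: "chain 1 (int r) i j ps" by simp
    have f: "\<And>f. f \<in> set (map te ps) \<Longrightarrow> f \<in> fspan UNIV" using te[OF c] by auto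
    have "ev A (fsmul (sgn (wpar (\<lambda>g. bp (fst g)) ps)) (fprod (map te ps)))
       = sc (sgn (wpar (\<lambda>g. bp (fst g)) ps)) * prod_list (map (\<lambda>g. ev A (te g)) ps)"
      using f by (simp only: ev_fsmul[OF fspan_fprod[OF f]] ev_fprod[OF f] map_map comp_def)
    also have "\<dots> = prod_list (map (\<lambda>g. sg (bp (fst g)) * ev A (te g)) ps)" by (rule sg_wpar)
    finally show "ev A (fsmul (sgn (wpar (\<lambda>g. bp (fst g)) ps)) (fprod (map te ps))) = prod_list (map (At A) ps)"
      by (simp add: At_def[abs_def])
  qed
  finally show ?thesis .
qed

section \<open>The generators preserve Whittaker vectors\<close>

abbreviation "ip \<equiv> ipar bs"
abbreviation "Xo x \<equiv> EV x - sc (ch x)"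
abbreviation "Wt \<equiv> At EV"

definition cg :: "fock \<Rightarrow> fock \<Rightarrow> bool" where
  "cg y z \<longleftrightarrow> y - z \<in> IV"

lemma cg_refl [simp]: "cg y y"
  by (simp add: cg_def IV_closed)

lemma cg_add: "cg y z \<Longrightarrow> cg y' z' \<Longrightarrow> cg (y + y') (z + z')"
  unfolding cg_def using IV_closed(2)[of "y - z" "y' - z'"] by (simp add: algebra_simps)

lemma cg_trans [trans]: "cg y z \<Longrightarrow> cg z z' \<Longrightarrow> cg y z'"
  unfolding cg_def using IV_closed(2)[of "y - z" "z - z'"] by simp

lemma cg_scl: "cg y z \<Longrightarrow> cg (scl c y) (scl c z)"
  unfolding cg_def using IV_closed(5)[of "y - z" c] by (simp add: cvs.scale_right_diff_distrib)

lemma cg_zero: "cg y 0 \<longleftrightarrow> y \<in> IV"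
  by (simp add: cg_def)

lemma cg_sum: "(\<And>i. i \<in> I \<Longrightarrow> cg (f i) (g i)) \<Longrightarrow> cg (\<Sum>i\<in>I. f i) (\<Sum>i\<in>I. g i)"
  by (induction I rule: infinite_finite_induct) (auto intro: cg_add)

lemma IV_W: "v \<in> IV \<Longrightarrow> app (Wt g) v \<in> IV"
  by (auto simp: At_def sg_def intro: IV_ev IV_closed)

lemma cg_W: "cg y z \<Longrightarrow> cg (app (Wt g) y) (app (Wt g) z)"
  unfolding cg_def using IV_W[of "y - z"] by (simp add: app_diff)

lemma cg_EV: "app (Xo x) z \<in> IV \<Longrightarrow> cg (app (EV x) z) (scl (ch x) z)"
  by (simp add: cg_def)

text \<open>The sign between a factor \<open>Wt\<close> and the matrix unit \<open>EV\<close>; it is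
  its own inverse, so it converts both ways.\<close>

definition eps :: "box \<Rightarrow> box \<Rightarrow> complex" where
  "eps a b = sgn (bp a) * sgn (odd (int (snd b) - int (snd a)))"

lemma W_app: "app (Wt (a, b)) z = scl (eps a b) (app (EV (a, b)) z + scl (if a = b then sgn (bp a) * rho m n l (snd a) else 0) z)"
  by (simp add: At_def te_ev eps_def sc_sgn[symmetric] cvs.scale_right_distrib)

lemma eps_sq [simp]: "eps a b * eps a b = 1"
  by (simp add: eps_def sgn_def)

lemma EV_W: "app (EV (a, b)) z = scl (eps a b) (app (Wt (a, b)) z) - scl (if a = b then sgn (bp a) * rho m n l (snd a) else 0) z"
  by (simp only: W_app cvs.scale_scale eps_sq cvs.scale_one add_diff_cancel_right')

text \<open>A lowering element either changes one box of a factor or moves on to the next factor.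
  The shifts drop out, because a diagonal letter is even and \<chi> vanishes on odd letters.\<close>

lemma X_commute_W:
  assumes x: "x \<in> MG" and ab: "(a, b) \<in> PG"
  shows "app (Xo x) (app (Wt (a, b)) z) =
    scl (eps a b) ((if snd x = a then app (EV (fst x, b)) z else 0)
       - scl (sgn (epar bs x \<and> ep a b)) (if fst x = b then app (EV (a, snd x)) z else 0))
    + scl (sgn (epar bs x \<and> ep a b)) (app (Wt (a, b)) (app (Xo x) z))"
proof -
  let ?s = "epar bs x \<and> ep a b"
  have "EV x * EV (a, b) = sg ?s * (EV (a, b) * EV x) + ((if snd x = a then EV (fst x, b) else 0) - sg ?s * (if fst x = b then EV (a, snd x) else 0))"
    using EV_br[OF MG_sub[OF x] PG_sub[OF ab]] unfolding br_def epar_pair fst_conv snd_conv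
    by (metis add.commute diff_add_cancel)
  then have "app (EV x * EV (a, b)) z = app (sg ?s * (EV (a, b) * EV x) + ((if snd x = a then EV (fst x, b) else 0) - sg ?s * (if fst x = b then EV (a, snd x) else 0))) z"
    by simp
  then have 1: "app (EV x) (app (EV (a, b)) z) = scl (sgn ?s) (app (EV (a, b)) (app (EV x) z))
      + ((if snd x = a then app (EV (fst x, b)) z else 0) - scl (sgn ?s) (if fst x = b then app (EV (a, snd x)) z else 0))"
    by (auto simp: sc_sgn[symmetric])
  have c: "sgn ?s * ch x = ch x" using ch_odd[OF x] by (auto simp: sgn_def)
  have d: "sgn ?s * (if a = b then sgn (bp a) * rho m n l (snd a) else 0) = (if a = b then sgn (bp a) * rho m n l (snd a) else 0)"
    by (auto simp: ep_def sgn_def)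
  let ?d = "if a = b then sgn (bp a) * rho m n l (snd a) else 0"
  define P where "P = (if snd x = a then app (EV (fst x, b)) z else 0) - scl (sgn ?s) (if fst x = b then app (EV (a, snd x)) z else 0)"
  have "app (Xo x) (app (Wt (a, b)) z) = scl (eps a b) (app (EV x) (app (EV (a, b)) z) + scl ?d (app (EV x) z) - scl (ch x) (app (EV (a, b)) z) - scl (ch x * ?d) z)"
    unfolding W_app by (simp add: app_add app_scl cvs.scale_right_distrib cvs.scale_right_diff_distrib mult.commute)
  moreover have "scl (sgn ?s) (app (Wt (a, b)) (app (Xo x) z)) = scl (eps a b) (scl (sgn ?s) (app (EV (a, b)) (app (EV x) z)) - scl (sgn ?s * ch x) (app (EV (a, b)) z)
     + scl (sgn ?s * ?d) (app (EV x) z) - scl (sgn ?s * ch x * ?d) z)"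
    unfolding W_app by (simp add: app_diff app_scl cvs.scale_right_distrib cvs.scale_right_diff_distrib mult_ac)
  ultimately show ?thesis unfolding 1 c d P_def[symmetric]
    by (simp add: cvs.scale_right_distrib cvs.scale_right_diff_distrib)
qed

text \<open>Letters lowering by one column generate \<mm>. On a bracket both orders reduce to the
  same product of values of \<chi>, which cancels, in accordance with \<chi> vanishing
  there.\<close>

lemma adjacent_Whittaker:
  assumes "\<And>i h q. i \<in> {1..k} \<Longrightarrow> h \<in> {1..k} \<Longrightarrow> 1 \<le> q \<Longrightarrow> Suc q \<le> l \<Longrightarrow> app (Xo ((i, Suc q), (h, q))) v \<in> IV"
  shows "v \<in> WV"
proof -
  have "app (Xo (a, c)) v \<in> IV" if "(a, c) \<in> MG" for a c
    using that
  proof (induction "snd a - snd c" arbitrary: a c rule: less_induct)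
    case less
    have B: "a \<in> B" "c \<in> B" "snd c < snd a" using less.prems by (auto simp: MG_iff)
    show ?case
    proof (cases "snd a = Suc (snd c)")
      case True
      then have "(a, c) = ((fst a, Suc (snd c)), (fst c, snd c))" by (metis prod.collapse)
      then show ?thesis using assms[of "fst a" "fst c" "snd c"] B True by (auto simp: boxes_def mem_Times_iff)
    next
      case False
      define b where "b = (fst a, snd a - 1)"
      have b: "b \<in> B" using B by (auto simp: b_def boxes_def mem_Times_iff)
      have ab: "(a, b) \<in> MG" and bc: "(b, c) \<in> MG" using B b False by (auto simp: MG_iff b_def)
      have ne: "a \<noteq> c" using B by auto
      have 1: "app (Xo (a, b)) v \<in> IV" by (rule less.hyps[OF _ ab]) (use B False in \<open>auto simp: b_def\<close>)
      have 2: "app (Xo (b, c)) v \<in> IV" by (rule less.hyps[OF _ bc]) (use B False in \<open>auto simp: b_def\<close>)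
      let ?s = "epar bs (a, b) \<and> epar bs (b, c)"
      have "EV (a, c) = EV (a, b) * EV (b, c) - sg ?s * (EV (b, c) * EV (a, b))"
        using EV_br[OF MG_sub[OF ab] MG_sub[OF bc]] ne by (simp add: br_def)
      then have e: "app (EV (a, c)) v = app (EV (a, b)) (app (EV (b, c)) v) - scl (sgn ?s) (app (EV (b, c)) (app (EV (a, b)) v))"
        by (simp add: sc_sgn[symmetric])
      have 3: "app (EV (a, b)) (app (EV (b, c)) v) - scl (ch (b, c) * ch (a, b)) v \<in> IV"
      proof -
        have "app (EV (a, b)) (app (Xo (b, c)) v) + scl (ch (b, c)) (app (Xo (a, b)) v) \<in> IV"
          by (intro IV_closed(2,5) IV_EV 1 2)
        then show ?thesis by (simp add: app_diff app_scl cvs.scale_right_diff_distrib)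
      qed
      have 4: "app (EV (b, c)) (app (EV (a, b)) v) - scl (ch (b, c) * ch (a, b)) v \<in> IV"
      proof -
        have "app (EV (b, c)) (app (Xo (a, b)) v) + scl (ch (a, b)) (app (Xo (b, c)) v) \<in> IV"
          by (intro IV_closed(2,5) IV_EV 1 2)
        then show ?thesis by (simp add: app_diff app_scl cvs.scale_right_diff_distrib mult.commute)
      qed
      have z: "sgn ?s * (ch (b, c) * ch (a, b)) = ch (b, c) * ch (a, b)"
        using ch_odd[OF ab] by (auto simp: sgn_def)
      have "(app (EV (a, b)) (app (EV (b, c)) v) - scl (ch (b, c) * ch (a, b)) v)
         - scl (sgn ?s) (app (EV (b, c)) (app (EV (a, b)) v) - scl (ch (b, c) * ch (a, b)) v) \<in> IV"
        by (intro IV_closed(3,5) 3 4)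
      moreover have "(app (EV (a, b)) (app (EV (b, c)) v) - scl (ch (b, c) * ch (a, b)) v)
         - scl (sgn ?s) (app (EV (b, c)) (app (EV (a, b)) v) - scl (ch (b, c) * ch (a, b)) v) = app (EV (a, c)) v"
        unfolding e cvs.scale_right_diff_distrib cvs.scale_scale z by simp
      moreover have "ch (a, c) = 0" using ch_bracket[OF ab bc] .
      ultimately show ?thesis by (simp add: sc_simps)
    qed
  qed
  then show ?thesis unfolding WV_def by auto
qed

lemma bp_pair [simp]: "bp (a, b) = ip a"
  by (simp add: bpar_def)

lemma eps_pair: "eps (a, b) (c, d) = sgn (ip a) * sgn (odd (int d - int b))"
  by (simp add: eps_def)

text \<open>The superdimension of a column; it reappears as the increment of
  \<open>rho\<close>.\<close>

lemma sum_sgn: "(\<Sum>d\<in>{1..k}. sgn (ip d)) = of_nat m - of_nat n"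
proof -
  have "(\<Sum>x\<leftarrow>xs. sgn (x = Eps)) = of_nat (length (filter (\<lambda>x. x = Delta) xs)) - of_nat (length (filter (\<lambda>x. x = Eps) xs))" for xs
  proof (induction xs)
    case (Cons x xs)
    then show ?case by (cases x) (simp_all add: sgn_def)
  qed simp
  then have 1: "(\<Sum>x\<leftarrow>bs. sgn (x = Eps)) = of_nat m - of_nat n" using lenD lenE by simp
  have "length xs = length (filter (\<lambda>x. x = Delta) xs) + length (filter (\<lambda>x. x = Eps) xs)" for xs :: "pty list"
  proof (induction xs)
    case (Cons x xs)
    then show ?case by (cases x) simp_all
  qed simp
  then have len: "length bs = k" using lenD lenE by metis
  have "(\<Sum>d\<in>{1..k}. sgn (ip d)) = (\<Sum>d\<in>{0..<k}. sgn (bs ! d = Eps))"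
    unfolding ipar_def by (rule sum.reindex_bij_witness[of _ Suc "\<lambda>d. d - 1"]) auto
  also have "\<dots> = (\<Sum>x\<leftarrow>bs. sgn (x = Eps))"
    by (simp add: sum_list_sum_nth len)
  finally show ?thesis using 1 by simp
qed

lemma rho_step: "Suc q \<le> l \<Longrightarrow> rho m n l (Suc q) - rho m n l q = of_nat m - of_nat n"
  by (simp add: rho_def algebra_simps)

section \<open>Lowering elements on partial chain sums\<close>

context
  fixes v :: "(box \<times> box) multiset \<Rightarrow>\<^sub>0 complex"
  assumes v: "v \<in> WV"
begin

definition th :: "nat \<Rightarrow> int \<Rightarrow> nat \<Rightarrow> nat \<Rightarrow> fock" where
  "th p r i j = app (TH Wt p r i j) v"

lemma th_split:
  assumes "i \<in> {1..k}" "1 \<le> p" "p \<le> l"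
  shows "th p r i j = th (Suc p) r i j +
    (\<Sum>b\<in>Bge p. app (Wt ((i, p), b)) (th (Suc (snd b)) (r - (int (snd b) - int p + 1)) (fst b) j))"
  unfolding th_def by (subst TH_split[OF assms]) (simp add: app_sum_left)

text \<open>Both boxes of \<open>x\<close> lie left of all boxes of the chain, so \<open>x\<close>
  passes through every factor and reaches the Whittaker vector.\<close>

lemma X_far:
  assumes x: "x \<in> MG" and p: "snd (fst x) < p"
  shows "app (Xo x) (th p r i j) \<in> IV"
  using p
proof (induction "nat r" arbitrary: p r i rule: less_induct)
  case less
  let ?G = "{g. g \<in> PG \<and> fst (fst g) = i \<and> p \<le> snd (fst g)}"
  have g: "app (Xo x) (app (Wt g) (th (snd (snd g) + 1) (r - kdeg g) (fst (snd g)) j)) \<in> IV" if "g \<in> ?G" for g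
  proof -
    obtain a b where ab: "g = (a, b)" by (metis surj_pair)
    have g: "(a, b) \<in> PG" "p \<le> snd a" "snd a \<le> snd b" using that by (auto simp: ab PG_iff)
    have "snd (snd x) < snd (fst x)" using x by (auto simp: Mgens_def)
    then have ne: "snd x \<noteq> a" "fst x \<noteq> b" using g less.prems by auto
    let ?t = "th (snd b + 1) (r - kdeg (a, b)) (fst b) j"
    have "app (Xo x) ?t \<in> IV"
    proof (cases "r - kdeg (a, b) < 0")
      case True
      then show ?thesis by (simp add: th_def TH_neg IV_closed)
    next
      case False
      then have "nat (r - kdeg (a, b)) < nat r" using kdeg_pos[OF g(1)] by simp
      then show ?thesis by (rule less.hyps) (use g less.prems in simp)
    qed
    then have "scl (sgn (epar bs x \<and> ep a b)) (app (Wt (a, b)) (app (Xo x) ?t)) \<in> IV"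
      by (intro IV_closed IV_W)
    then show ?thesis unfolding ab fst_conv snd_conv X_commute_W[OF x g(1)] using ne by simp
  qed
  have vx: "app (Xo x) v \<in> IV" using v x unfolding WV_def by blast
  have "th p r i j = (if r = 0 \<and> i = j then v else 0) +
     (\<Sum>g\<in>?G. app (Wt g) (th (snd (snd g) + 1) (r - kdeg g) (fst (snd g)) j))"
    unfolding th_def by (subst TH_rec) (simp add: app_sum_left)
  then have "app (Xo x) (th p r i j) = app (Xo x) (if r = 0 \<and> i = j then v else 0) +
     (\<Sum>g\<in>?G. app (Xo x) (app (Wt g) (th (snd (snd g) + 1) (r - kdeg g) (fst (snd g)) j)))"
    by (simp only: app_add app_sum)
  moreover have "(\<Sum>g\<in>?G. app (Xo x) (app (Wt g) (th (snd (snd g) + 1) (r - kdeg g) (fst (snd g)) j))) \<in> IV"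
    by (intro IV_closed(6) g)
  moreover have "app (Xo x) (if r = 0 \<and> i = j then v else 0) \<in> IV" using vx by (auto intro: IV_closed)
  ultimately show ?case by (simp only: IV_closed(2))
qed

abbreviation "x0 i h q \<equiv> ((i, Suc q), (h, q))"

lemma x0_MG: "i \<in> {1..k} \<Longrightarrow> h \<in> {1..k} \<Longrightarrow> 1 \<le> q \<Longrightarrow> Suc q \<le> l \<Longrightarrow> x0 i h q \<in> MG"
  by (auto simp: MG_iff boxes_def)

lemma ch_pair: "1 \<le> q \<Longrightarrow> Suc q \<le> l \<Longrightarrow> c \<in> {1..k} \<Longrightarrow> d \<in> {1..k} \<Longrightarrow> ch ((c, Suc q), (d, q)) = (if c = d then sgn (ip c) else 0)"
  by (subst ch_eq) (auto simp: boxes_def)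

text \<open>Only the first pair from \<open>(c, q+1)\<close> to \<open>(i, q+1)\<close> is affected.
  It becomes the lowering letter from \<open>(c, q+1)\<close> to \<open>(h, q)\<close>, which by
  \<open>X_far\<close> acts on the tail through \<chi>, and this forces
  \<open>c = h\<close>.\<close>

lemma X_next:
  assumes ih: "i \<in> {1..k}" "h \<in> {1..k}" and q: "1 \<le> q" "Suc q \<le> l" and c: "c \<in> {1..k}"
  shows "cg (app (Xo (x0 i h q)) (th (Suc q) r c j))
     (if c = h then scl (- sgn (ip i \<noteq> ip h)) (th (Suc (Suc q)) (r - 1) i j) else 0)"
proof -
  let ?t = "\<lambda>b. th (Suc (snd b)) (r - (int (snd b) - int (Suc q) + 1)) (fst b) j"
  let ?u = "th (Suc (Suc q)) (r - 1) i j"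
  let ?y = "((c, Suc q), (h, q))"
  let ?s = "(ip i \<noteq> ip h) \<and> (ip c \<noteq> ip i)"
  define V where "V = scl (- (sgn (ip c) * sgn ?s)) (app (EV ?y) ?u)"
  have y: "?y \<in> MG" using c ih q by (auto simp: MG_iff boxes_def)
  have f: "cg (app (Xo (x0 i h q)) (app (Wt ((c, Suc q), b)) (?t b))) (if b = (i, Suc q) then V else 0)" if b: "b \<in> Bge (Suc q)" for b
  proof -
    have P: "((c, Suc q), b) \<in> PG" using b c q by (auto simp: PG_iff boxes_def)
    let ?r = "scl (sgn (epar bs (x0 i h q) \<and> ep (c, Suc q) b)) (app (Wt ((c, Suc q), b)) (app (Xo (x0 i h q)) (?t b)))"
    have "?r \<in> IV" by (intro IV_closed IV_W X_far x0_MG[OF ih q]) (use b in simp)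
    moreover have "app (Xo (x0 i h q)) (app (Wt ((c, Suc q), b)) (?t b)) = (if b = (i, Suc q) then V else 0) + ?r"
      unfolding X_commute_W[OF x0_MG[OF ih q] P] by (auto simp: V_def eps_pair epar_pair ep_def sgn_def cvs.scale_minus_left)
    ultimately show ?thesis by (simp add: cg_def)
  qed
  have "(i, Suc q) \<in> Bge (Suc q)" using ih q by (auto simp: boxes_def)
  then have S: "(\<Sum>b\<in>Bge (Suc q). if b = (i, Suc q) then V else 0) = V" by simp
  have T: "th (Suc q) r c j = th (Suc (Suc q)) r c j + (\<Sum>b\<in>Bge (Suc q). app (Wt ((c, Suc q), b)) (?t b))"
    by (rule th_split[OF c]) (use q in auto)
  have "app (Xo (x0 i h q)) (th (Suc q) r c j) = app (Xo (x0 i h q)) (th (Suc (Suc q)) r c j) +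
     (\<Sum>b\<in>Bge (Suc q). app (Xo (x0 i h q)) (app (Wt ((c, Suc q), b)) (?t b)))"
    unfolding T app_add app_sum by (rule refl)
  also have "cg \<dots> V"
  proof -
    have c1: "cg (app (Xo (x0 i h q)) (th (Suc (Suc q)) r c j)) 0"
      unfolding cg_zero by (intro X_far x0_MG[OF ih q]) simp
    have c2: "cg (\<Sum>b\<in>Bge (Suc q). app (Xo (x0 i h q)) (app (Wt ((c, Suc q), b)) (?t b))) (\<Sum>b\<in>Bge (Suc q). if b = (i, Suc q) then V else 0)"
      by (rule cg_sum) (rule f)
    from cg_add[OF c1 c2] show ?thesis by (simp only: S add_0_left)
  qed
  also have "cg V (scl (- (sgn (ip c) * sgn ?s)) (scl (ch ?y) ?u))"
    unfolding V_def by (intro cg_scl cg_EV X_far y) simp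
  also have "scl (- (sgn (ip c) * sgn ?s)) (scl (ch ?y) ?u) = (if c = h then scl (- sgn (ip i \<noteq> ip h)) ?u else 0)"
    unfolding ch_pair[OF q c ih(2)] by (auto simp: sgn_def)
  finally show ?thesis .
qed

text \<open>Columns \<open>q\<close> and \<open>q+1\<close> interact here. For \<open>c = h\<close>
  a multiple of \<open>u\<close> arises from three sources: the row sum of \<open>X_next\<close>,
  which gives \<open>m - n\<close>, and the shifts of the two columns. They cancel because
  \<open>rho\<close> grows by \<open>m - n\<close> per column; this is the origin of
  \<open>rho\<close>.\<close>

lemma X_level:
  assumes ih: "i \<in> {1..k}" "h \<in> {1..k}" and q: "1 \<le> q" "Suc q \<le> l" and c: "c \<in> {1..k}"
  shows "app (Xo (x0 i h q)) (th q r c j) \<in> IV"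
proof -
  let ?t = "\<lambda>b. th (Suc (snd b)) (r - (int (snd b) - int q + 1)) (fst b) j"
  let ?s = "(ip i \<noteq> ip h) \<and> (ip c \<noteq> ip i)" and ?\<kappa> = "sgn (ip i \<noteq> ip h)"
  define u where "u = th (Suc (Suc q)) (r - 2) i j"
  define a1 where "a1 = th (Suc q) (r - 1) i j"
  define a2 where "a2 = th (Suc (Suc q)) (r - 1) i j"
  define wu where "wu = app (Wt ((c, q), (h, q))) u"
  define \<delta> :: complex where "\<delta> = (if c = h then 1 else 0)"
  \<comment> \<open>\<open>g1 d\<close> and \<open>g2 b\<close> are the values modulo
    \<open>IV\<close> on chains whose first pair ends in \<open>(d, q)\<close>, respectively in a
    box \<open>b\<close> right of column \<open>q\<close>.\<close>
  define g1 where "g1 d = scl (\<delta> * sgn (ip h)) (scl (if d = i then sgn (ip i) else 0) a1 - scl (sgn (ip i \<noteq> ip d)) u)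
     + (if d = h then scl (- (sgn ((ip i \<noteq> ip h) \<and> (ip c \<noteq> ip h)) * ?\<kappa>)) wu else 0)" for d
  define g2 where "g2 b = scl (- (\<delta> * ?\<kappa>)) (app (Wt ((i, Suc q), b)) (?t b))
     + (if b = (i, Suc q) then scl (\<delta> * ?\<kappa> * rho m n l (Suc q)) u + scl (sgn ?s) wu
          - scl (\<delta> * sgn ?s * rho m n l q) u else 0)" for b
  have t1: "?t (d, q) = th (Suc q) (r - 1) d j" for d by simp
  have tS: "?t (i, Suc q) = u" by (simp add: u_def)
  have P: "((c, q), b) \<in> PG" if "b \<in> Bge q" for b using that c q by (auto simp: PG_iff boxes_def)
  have move: "app (Xo (x0 i h q)) (app (Wt ((c, q), b)) (?t b)) =
     scl (eps (c, q) b) ((if h = c then app (EV ((i, Suc q), b)) (?t b) else 0)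
       - scl (sgn (epar bs (x0 i h q) \<and> ep (c, q) b)) (if (i, Suc q) = b then app (EV ((c, q), (h, q))) (?t b) else 0))
     + scl (sgn (epar bs (x0 i h q) \<and> ep (c, q) b)) (app (Wt ((c, q), b)) (app (Xo (x0 i h q)) (?t b)))" if "b \<in> Bge q" for b
    unfolding X_commute_W[OF x0_MG[OF ih q] P[OF that]] by simp
  have f1: "cg (app (Xo (x0 i h q)) (app (Wt ((c, q), (d, q))) (?t (d, q)))) (g1 d)" if d: "d \<in> {1..k}" for d
  proof -
    have b: "(d, q) \<in> Bge q" using d q by (auto simp: boxes_def)
    let ?y = "((i, Suc q), (d, q))"
    \<comment> \<open>The commutator has replaced \<open>(c, q)\<close> by \<open>(i, q+1)\<close>,
      so a lowering letter meets the tail: \<chi> contributes for \<open>d = i\<close> only, but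
      \<open>X_next\<close> contributes for every row \<open>d\<close>.\<close>
    have A: "cg (app (EV ?y) (th (Suc q) (r - 1) d j)) (scl (if d = i then sgn (ip i) else 0) a1 - scl (sgn (ip i \<noteq> ip d)) u)"
    proof -
      have "app (EV ?y) (th (Suc q) (r - 1) d j) = app (Xo ?y) (th (Suc q) (r - 1) d j) + scl (ch ?y) (th (Suc q) (r - 1) d j)"
        by simp
      also have "cg \<dots> (scl (- sgn (ip i \<noteq> ip d)) (th (Suc (Suc q)) (r - 1 - 1) i j) + scl (ch ?y) (th (Suc q) (r - 1) d j))"
        using X_next[OF ih(1) d q d, of "r - 1"] by (intro cg_add) (simp_all del: app_simps)
      also have "\<dots> = scl (if d = i then sgn (ip i) else 0) a1 - scl (sgn (ip i \<noteq> ip d)) u"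
        unfolding ch_pair[OF q ih(1) d] by (auto simp: a1_def u_def cvs.scale_minus_left)
      finally show ?thesis .
    qed
    have C: "cg (app (Wt ((c, q), (d, q))) (app (Xo (x0 i h q)) (th (Suc q) (r - 1) d j)))
        (if d = h then scl (- ?\<kappa>) wu else 0)"
    proof -
      have "cg (app (Wt ((c, q), (d, q))) (app (Xo (x0 i h q)) (th (Suc q) (r - 1) d j)))
         (app (Wt ((c, q), (d, q))) (if d = h then scl (- ?\<kappa>) (th (Suc (Suc q)) (r - 1 - 1) i j) else 0))"
        by (intro cg_W X_next[OF ih q d])
      then show ?thesis by (simp add: wu_def u_def app_scl app_uminus if_distrib[of "app _"] del: app_simps split: if_splits)
    qed
    have E: "app (Xo (x0 i h q)) (app (Wt ((c, q), (d, q))) (?t (d, q))) =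
      scl (\<delta> * sgn (ip h)) (app (EV ?y) (th (Suc q) (r - 1) d j))
      + scl (sgn ((ip i \<noteq> ip h) \<and> (ip c \<noteq> ip d))) (app (Wt ((c, q), (d, q))) (app (Xo (x0 i h q)) (th (Suc q) (r - 1) d j)))"
      unfolding t1 move[OF b, unfolded t1] by (auto simp: \<delta>_def eps_pair epar_pair ep_def sgn_def simp del: app_simps)
    have D: "scl (sgn ((ip i \<noteq> ip h) \<and> (ip c \<noteq> ip d))) (if d = h then scl (- ?\<kappa>) wu else 0)
       = (if d = h then scl (- (sgn ((ip i \<noteq> ip h) \<and> (ip c \<noteq> ip h)) * ?\<kappa>)) wu else 0)"
      by (cases "d = h") (simp_all only: simp_thms if_True if_False cvs.scale_scale mult_minus_right cvs.scale_zero_right)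
    show ?thesis unfolding E g1_def D[symmetric] by (rule cg_add[OF cg_scl[OF A] cg_scl[OF C]])
  qed
  have f2: "cg (app (Xo (x0 i h q)) (app (Wt ((c, q), b)) (?t b))) (g2 b)" if b: "b \<in> Bge (Suc q)" for b
  proof -
    have b': "b \<in> Bge q" using b by simp
    let ?R = "scl (sgn (epar bs (x0 i h q) \<and> ep (c, q) b)) (app (Wt ((c, q), b)) (app (Xo (x0 i h q)) (?t b)))"
    have R: "?R \<in> IV" by (intro IV_closed IV_W X_far x0_MG[OF ih q]) (use b in simp)
    have e: "c = h \<Longrightarrow> eps (c, q) b * eps (i, Suc q) b = - ?\<kappa>"
      by (simp add: eps_def sgn_def)
    \<comment> \<open>Rewriting \<open>EV\<close> as \<open>Wt\<close> costs the shift of column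
      \<open>q+1\<close> when the pair is diagonal; in the next term the shift of column
      \<open>q\<close> enters likewise.\<close>
    have 1: "scl (eps (c, q) b) (if h = c then app (EV ((i, Suc q), b)) (?t b) else 0)
       = scl (- (\<delta> * ?\<kappa>)) (app (Wt ((i, Suc q), b)) (?t b)) + (if b = (i, Suc q) then scl (\<delta> * ?\<kappa> * rho m n l (Suc q)) u else 0)"
    proof (cases "c = h")
      case True
      have "scl (eps (c, q) b) (app (EV ((i, Suc q), b)) (?t b)) = scl (- ?\<kappa>) (app (Wt ((i, Suc q), b)) (?t b))
          - scl (eps (c, q) b * (if (i, Suc q) = b then sgn (ip i) * rho m n l (Suc q) else 0)) (?t b)"
        unfolding EV_W cvs.scale_right_diff_distrib cvs.scale_scale e[OF True] snd_conv bp_pair by (rule refl)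
      also have "\<dots> = scl (- ?\<kappa>) (app (Wt ((i, Suc q), b)) (?t b)) + (if b = (i, Suc q) then scl (?\<kappa> * rho m n l (Suc q)) u else 0)"
        using True by (auto simp: u_def eps_pair sgn_def)
      finally show ?thesis using True by (simp add: \<delta>_def)
    qed (simp add: \<delta>_def)
    have 2: "- scl (eps (c, q) b * sgn (epar bs (x0 i h q) \<and> ep (c, q) b)) (if (i, Suc q) = b then app (EV ((c, q), (h, q))) (?t b) else 0)
       = (if b = (i, Suc q) then scl (sgn ?s) wu - scl (\<delta> * sgn ?s * rho m n l q) u else 0)"
    proof (cases "b = (i, Suc q)")
      case True
      have "app (EV ((c, q), (h, q))) u = scl (sgn (ip c)) wu - scl (\<delta> * sgn (ip c) * rho m n l q) u"
        unfolding EV_W wu_def by (auto simp: \<delta>_def eps_pair sgn_def)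
      moreover have "eps (c, q) b * sgn (epar bs (x0 i h q) \<and> ep (c, q) b) = - (sgn (ip c) * sgn ?s)"
        unfolding True by (auto simp: eps_pair epar_pair ep_def sgn_def)
      ultimately show ?thesis using True tS
        by (simp add: cvs.scale_right_diff_distrib) (auto simp: sgn_def)
    qed simp
    have "app (Xo (x0 i h q)) (app (Wt ((c, q), b)) (?t b)) =
      (scl (eps (c, q) b) (if h = c then app (EV ((i, Suc q), b)) (?t b) else 0)
      + (- scl (eps (c, q) b * sgn (epar bs (x0 i h q) \<and> ep (c, q) b)) (if (i, Suc q) = b then app (EV ((c, q), (h, q))) (?t b) else 0)))
      + ?R"
      unfolding move[OF b'] cvs.scale_right_diff_distrib cvs.scale_scale by simp
    also have "\<dots> = g2 b + ?R" unfolding 1 2 g2_def by simp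
    finally show ?thesis using R by (simp add: cg_def)
  qed
  have split: "Bge q = (\<lambda>d. (d, q)) ` {1..k} \<union> Bge (Suc q)"
    using q by (auto simp: boxes_def image_iff le_Suc_eq)
  have E: "(\<Sum>b\<in>Bge q. app (Xo (x0 i h q)) (app (Wt ((c, q), b)) (?t b))) =
     (\<Sum>d\<in>{1..k}. app (Xo (x0 i h q)) (app (Wt ((c, q), (d, q))) (?t (d, q)))) + (\<Sum>b\<in>Bge (Suc q). app (Xo (x0 i h q)) (app (Wt ((c, q), b)) (?t b)))"
    unfolding split by (subst sum.union_disjoint) (auto simp: sum.reindex inj_on_def simp del: app_simps)
  have s1: "cg (\<Sum>d\<in>{1..k}. app (Xo (x0 i h q)) (app (Wt ((c, q), (d, q))) (?t (d, q)))) (\<Sum>d\<in>{1..k}. g1 d)"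
    by (rule cg_sum) (rule f1)
  have s2: "cg (\<Sum>b\<in>Bge (Suc q). app (Xo (x0 i h q)) (app (Wt ((c, q), b)) (?t b))) (\<Sum>b\<in>Bge (Suc q). g2 b)"
    by (rule cg_sum) (rule f2)
  have sum: "cg (\<Sum>b\<in>Bge q. app (Xo (x0 i h q)) (app (Wt ((c, q), b)) (?t b))) ((\<Sum>d\<in>{1..k}. g1 d) + (\<Sum>b\<in>Bge (Suc q). g2 b))"
    unfolding E by (rule cg_add[OF s1 s2])
  have "(\<Sum>d\<in>{1..k}. sgn (ip i \<noteq> ip d)) = sgn (ip i) * (\<Sum>d\<in>{1..k}. sgn (ip d))"
    unfolding sum_distrib_left by (rule sum.cong) (auto simp: sgn_def)
  then have sgnsum: "(\<Sum>d\<in>{1..k}. sgn (ip i \<noteq> ip d)) = sgn (ip i) * (of_nat m - of_nat n)" by (simp only: sum_sgn)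
  have G1: "(\<Sum>d\<in>{1..k}. g1 d) = scl (\<delta> * sgn (ip h)) (scl (sgn (ip i)) a1 - scl (sgn (ip i) * (of_nat m - of_nat n)) u)
     + scl (- (sgn ((ip i \<noteq> ip h) \<and> (ip c \<noteq> ip h)) * ?\<kappa>)) wu"
  proof -
    have "(\<Sum>d\<in>{1..k}. scl (if d = i then sgn (ip i) else 0) a1) = (\<Sum>d\<in>{1..k}. if d = i then scl (sgn (ip i)) a1 else 0)"
      by (rule sum.cong) auto
    then have "(\<Sum>d\<in>{1..k}. scl (if d = i then sgn (ip i) else 0) a1) = scl (sgn (ip i)) a1" using ih by simp
    moreover have "(\<Sum>d\<in>{1..k}. scl (sgn (ip i \<noteq> ip d)) u) = scl (sgn (ip i) * (of_nat m - of_nat n)) u"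
      by (simp only: cvs.scale_sum_left[symmetric] sgnsum)
    ultimately show ?thesis unfolding g1_def sum.distrib cvs.scale_sum_right[symmetric] sum_subtractf
      using ih by simp
  qed
  have G2: "(\<Sum>b\<in>Bge (Suc q). g2 b) = scl (- (\<delta> * ?\<kappa>)) (a1 - a2)
     + (scl (\<delta> * ?\<kappa> * rho m n l (Suc q)) u + scl (sgn ?s) wu - scl (\<delta> * sgn ?s * rho m n l q) u)"
  proof -
    have A: "a1 = a2 + (\<Sum>b\<in>Bge (Suc q). app (Wt ((i, Suc q), b)) (th (Suc (snd b)) (r - 1 - (int (snd b) - int (Suc q) + 1)) (fst b) j))"
      unfolding a1_def a2_def by (rule th_split[OF ih(1)]) (use q in auto)
    have idx: "r - 1 - (int (snd b) - int (Suc q) + 1) = r - (int (snd b) - int q + 1)" for b :: box by simp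
    have "(\<Sum>b\<in>Bge (Suc q). app (Wt ((i, Suc q), b)) (?t b)) = a1 - a2"
      using A unfolding idx by simp
    moreover have "(i, Suc q) \<in> Bge (Suc q)" using ih q by (auto simp: boxes_def)
    ultimately show ?thesis unfolding g2_def sum.distrib cvs.scale_sum_right[symmetric] by simp
  qed
  have X1: "cg (app (Xo (x0 i h q)) (th (Suc q) r c j)) (scl (- (\<delta> * ?\<kappa>)) a2)"
    using X_next[OF ih q c, of r] by (auto simp: \<delta>_def a2_def simp del: app_simps)
  have T: "th q r c j = th (Suc q) r c j + (\<Sum>b\<in>Bge q. app (Wt ((c, q), b)) (?t b))"
    by (rule th_split[OF c q(1)]) (use q in auto)
  have X0: "app (Xo (x0 i h q)) (th q r c j) = app (Xo (x0 i h q)) (th (Suc q) r c j) + (\<Sum>b\<in>Bge q. app (Xo (x0 i h q)) (app (Wt ((c, q), b)) (?t b)))"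
    unfolding T app_add app_sum by (rule refl)
  have Z: "scl (- (\<delta> * ?\<kappa>)) a2 + ((\<Sum>d\<in>{1..k}. g1 d) + (\<Sum>b\<in>Bge (Suc q). g2 b)) = 0"
  proof -
    have r: "rho m n l (Suc q) = rho m n l q + (of_nat m - of_nat n)" using rho_step[OF q(2)] by (simp add: algebra_simps)
    show ?thesis unfolding G1 G2 r
      by (cases "c = h"; cases "ip i"; cases "ip h"; cases "ip c";
        simp add: \<delta>_def sgn_def cvs.scale_right_diff_distrib cvs.scale_left_distrib cvs.scale_left_diff_distrib cvs.scale_minus_left)
  qed
  show ?thesis unfolding cg_zero[symmetric] X0 using cg_add[OF X1 sum] unfolding Z .
qed

text \<open>Two kinds of first pair react: one ending in \<open>(i, q+1)\<close> is shortened to end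
  in \<open>(h, q)\<close>, and one ending in \<open>(h, q)\<close> hands the lowering element to
  \<open>X_next\<close>. Both leave \<open>wu\<close>, with opposite signs; the remaining tails fall
  under the induction or \<open>X_far\<close>.\<close>

lemma X_below:
  assumes ih: "i \<in> {1..k}" "h \<in> {1..k}" and q: "1 \<le> q" "Suc q \<le> l" and c: "c \<in> {1..k}" and s: "1 \<le> s" "s \<le> q"
  shows "app (Xo (x0 i h q)) (th s r c j) \<in> IV"
  using c s
proof (induction "q - s" arbitrary: s r c rule: less_induct)
  case less
  show ?case
  proof (cases "s = q")
    case True
    then show ?thesis using X_level[OF ih q less.prems(1)] by simp
  next
    case False
    then have sq: "s < q" using less.prems by simp
    let ?t = "\<lambda>b. th (Suc (snd b)) (r - (int (snd b) - int s + 1)) (fst b) j"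
    let ?s1 = "(ip i \<noteq> ip h) \<and> (ip c \<noteq> ip i)" and ?s2 = "(ip i \<noteq> ip h) \<and> (ip c \<noteq> ip h)" and ?\<kappa> = "sgn (ip i \<noteq> ip h)"
    define u where "u = th (Suc (Suc q)) (r - (int (Suc q) - int s + 1)) i j"
    define wu where "wu = app (Wt ((c, s), (h, q))) u"
    define g where "g b = (if b = (i, Suc q) then scl (sgn ?s1) wu else 0) + (if b = (h, q) then scl (- (sgn ?s2 * ?\<kappa>)) wu else 0)" for b
    have f: "cg (app (Xo (x0 i h q)) (app (Wt ((c, s), b)) (?t b))) (g b)" if b: "b \<in> Bge s" for b
    proof -
      have P: "((c, s), b) \<in> PG" using b less.prems q by (auto simp: PG_iff boxes_def)
      have bB: "fst b \<in> {1..k}" using b by (auto simp: boxes_def)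
      let ?R = "app (Wt ((c, s), b)) (app (Xo (x0 i h q)) (?t b))"
      have move: "app (Xo (x0 i h q)) (app (Wt ((c, s), b)) (?t b)) =
         - scl (eps (c, s) b * sgn (epar bs (x0 i h q) \<and> ep (c, s) b)) (if (i, Suc q) = b then app (EV ((c, s), (h, q))) (?t b) else 0)
         + scl (sgn (epar bs (x0 i h q) \<and> ep (c, s) b)) ?R"
        unfolding X_commute_W[OF x0_MG[OF ih q] P] using sq by (simp add: cvs.scale_right_diff_distrib del: app_simps)
      have 1: "- scl (eps (c, s) b * sgn (epar bs (x0 i h q) \<and> ep (c, s) b)) (if (i, Suc q) = b then app (EV ((c, s), (h, q))) (?t b) else 0)
         = (if b = (i, Suc q) then scl (sgn ?s1) wu else 0)"
      proof (cases "b = (i, Suc q)")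
        case True
        have "?t b = u" by (simp add: True u_def)
        moreover have "app (EV ((c, s), (h, q))) u = scl (eps (c, s) (h, q)) wu"
          unfolding EV_W wu_def using sq by simp
        moreover have "eps (c, s) b * sgn (epar bs (x0 i h q) \<and> ep (c, s) b) * eps (c, s) (h, q) = - sgn ?s1"
          unfolding True using sq by (auto simp: eps_pair epar_pair ep_def sgn_def)
        ultimately show ?thesis using True by (simp add: cvs.scale_minus_left)
      qed simp
      have 2: "cg (scl (sgn (epar bs (x0 i h q) \<and> ep (c, s) b)) ?R) (if b = (h, q) then scl (- (sgn ?s2 * ?\<kappa>)) wu else 0)"
      proof (cases "snd b = q")
        case True
        then have bq: "b = (fst b, q)" by (metis prod.collapse)
        have t: "?t b = th (Suc q) (r - (int q - int s + 1)) (fst b) j" by (simp add: True)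
        have i: "r - (int q - int s + 1) - 1 = r - (int (Suc q) - int s + 1)" by simp
        have "cg (app (Xo (x0 i h q)) (?t b)) (if fst b = h then scl (- ?\<kappa>) u else 0)"
          unfolding t u_def i[symmetric] by (rule X_next[OF ih q bB])
        from cg_scl[OF cg_W[OF this]] have "cg (scl (sgn (epar bs (x0 i h q) \<and> ep (c, s) b)) ?R)
           (scl (sgn (epar bs (x0 i h q) \<and> ep (c, s) b)) (app (Wt ((c, s), b)) (if fst b = h then scl (- ?\<kappa>) u else 0)))" .
        moreover have "scl (sgn (epar bs (x0 i h q) \<and> ep (c, s) b)) (app (Wt ((c, s), b)) (if fst b = h then scl (- ?\<kappa>) u else 0))
           = (if b = (h, q) then scl (- (sgn ?s2 * ?\<kappa>)) wu else 0)"
        proof (cases "fst b = h")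
          case True
          then have "b = (h, q)" using bq by simp
          then show ?thesis by (simp add: wu_def epar_pair ep_def app_scl app_uminus cvs.scale_minus_left)
        next
          case False
          then have "b \<noteq> (h, q)" by auto
          then show ?thesis using False by simp
        qed
        ultimately show ?thesis by (simp only:)
      next
        case False
        have "app (Xo (x0 i h q)) (?t b) \<in> IV"
        proof (cases "snd b < q")
          case True
          then show ?thesis using b by (intro less.hyps) (use sq bB in auto)
        next
          case False': False
          then show ?thesis using False by (intro X_far x0_MG[OF ih q]) simp
        qed
        then have "scl (sgn (epar bs (x0 i h q) \<and> ep (c, s) b)) ?R \<in> IV" by (intro IV_closed IV_W)
        moreover have "b \<noteq> (h, q)" using False by auto
        ultimately show ?thesis by (simp only: if_False cg_zero)
      qed
      show ?thesis unfolding move 1 g_def by (rule cg_add[OF cg_refl 2])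
    qed
    have mem: "(i, Suc q) \<in> Bge s" "(h, q) \<in> Bge s" using ih q sq by (auto simp: boxes_def)
    have "(\<Sum>b\<in>Bge s. g b) = scl (sgn ?s1) wu + scl (- (sgn ?s2 * ?\<kappa>)) wu"
      unfolding g_def sum.distrib using mem by simp
    also have "\<dots> = 0"
      by (cases "ip i"; cases "ip h"; cases "ip c"; simp add: sgn_def)
    finally have Z: "(\<Sum>b\<in>Bge s. g b) = 0" .
    have "cg (\<Sum>b\<in>Bge s. app (Xo (x0 i h q)) (app (Wt ((c, s), b)) (?t b))) (\<Sum>b\<in>Bge s. g b)"
      by (rule cg_sum) (rule f)
    then have 2: "(\<Sum>b\<in>Bge s. app (Xo (x0 i h q)) (app (Wt ((c, s), b)) (?t b))) \<in> IV"
      unfolding Z cg_zero .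
    have 1: "app (Xo (x0 i h q)) (th (Suc s) r c j) \<in> IV"
      by (rule less.hyps) (use sq less.prems in auto)
    have T: "th s r c j = th (Suc s) r c j + (\<Sum>b\<in>Bge s. app (Wt ((c, s), b)) (?t b))"
      by (rule th_split) (use less.prems q in auto)
    show ?thesis unfolding T app_add app_sum by (rule IV_closed(2)[OF 1 2])
  qed
qed

end

lemma T_Whittaker:
  assumes v: "v \<in> WV" and ij: "i \<in> {1..k}"
  shows "app (TH Wt 1 r i j) v \<in> WV"
proof (rule adjacent_Whittaker)
  fix a h q assume a: "a \<in> {1..k}" "h \<in> {1..k}" "1 \<le> q" "Suc q \<le> l"
  show "app (Xo ((a, Suc q), (h, q))) (app (TH Wt 1 r i j) v) \<in> IV"
    using X_below[OF v a ij, of 1 r j] a unfolding th_def[OF v] by simp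
qed

section \<open>The generators on the vacuum module\<close>

abbreviation "WM \<equiv> At MV"

lemma WM_eq: "(a, b) \<in> PG \<Longrightarrow> WM (a, b) = sc (eps a b) * MO a b"
proof -
  assume ab: "(a, b) \<in> PG"
  have "MV (a, b) + (if a = b then sc (sgn (bp a) * rho m n l (snd a)) else 0) = MO a b"
    using ab by (simp add: MV_def \<psi>_def sc_simps)
  then show ?thesis unfolding At_def te_ev by (simp add: eps_def sc_sgn[symmetric] sc_simps mult.assoc)
qed

text \<open>\<open>Chat\<close> is the contribution of a chain consisting of a single box pair starting in column 1, and \<open>Cc\<close> its
  leading part.\<close>

definition Cc :: "nat \<Rightarrow> nat \<Rightarrow> nat \<Rightarrow> (box \<times> box) multiset op" where
  "Cc i j r = (if r = 0 then if i = j then 1 else 0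
     else if r \<le> l then sc (eps (i, 1) (j, r)) * X (i, 1) (j, r) else 0)"

definition Chat :: "nat \<Rightarrow> nat \<Rightarrow> nat \<Rightarrow> (box \<times> box) multiset op" where
  "Chat i j r = (if r = 0 then if i = j then 1 else 0 else if r \<le> l then WM ((i, 1), (j, r)) else 0)"

definition vc :: "nat \<Rightarrow> nat \<Rightarrow> nat \<Rightarrow> fock" where
  "vc i j r = app (Cc i j r) vac"

definition PP :: "nat \<Rightarrow> nat \<Rightarrow> nat \<Rightarrow> nat \<Rightarrow> nat \<Rightarrow> nat \<Rightarrow> fock" where
  "PP i j r h g s = app (Cc i j r) (vc h g s)"

text \<open>Up to a minus sign, the scalar with which a pair from \<open>(g, s)\<close> to row
  \<open>j\<close> moves the endpoint of a variable from \<open>(h, 1)\<close> to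
  \<open>(g, s)\<close>.\<close>

definition yeps :: "nat \<Rightarrow> nat \<Rightarrow> nat \<Rightarrow> complex" where
  "yeps h g j = sgn (ip g) * sgn ((ip h \<noteq> ip g) \<and> (ip g \<noteq> ip j))"

lemma PG_row: "i \<in> {1..k} \<Longrightarrow> j \<in> {1..k} \<Longrightarrow> 1 \<le> r \<Longrightarrow> r \<le> l \<Longrightarrow> ((i, 1), (j, r)) \<in> PG"
  by (auto simp: PG_iff boxes_def)

lemma vc_large: "l < r \<Longrightarrow> vc i j r = 0"
  by (simp add: vc_def Cc_def)

text \<open>Only \<open>r = 1\<close> has a derivation part, since \<open>MO\<close> keeps
  \<open>Lop\<close> just for pairs inside column 1.\<close>

lemma Chat_eq: "i \<in> {1..k} \<Longrightarrow> j \<in> {1..k} \<Longrightarrow>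
   Chat i j r = Cc i j r + (if r = 1 \<and> r \<le> l then sc (sgn (ip i)) * Lop (i, 1) (j, 1) else 0)"
proof -
  assume ij: "i \<in> {1..k}" "j \<in> {1..k}"
  show ?thesis
  proof (cases "1 \<le> r \<and> r \<le> l")
    case True
    then show ?thesis using WM_eq[OF PG_row[OF ij, of r]]
      by (auto simp: Chat_def Cc_def MO_def eps_pair sgn_def distrib_left)
  qed (auto simp: Chat_def Cc_def)
qed

lemma Chat_vac: "i \<in> {1..k} \<Longrightarrow> j \<in> {1..k} \<Longrightarrow> app (Chat i j r) vac = vc i j r"
  by (simp add: Chat_eq vc_def)

lemma PP_sym: "PP i j r h g s = scl (sgn ((ip i \<noteq> ip j) \<and> (ip h \<noteq> ip g))) (PP h g s i j r)"
proof (cases "1 \<le> r \<and> r \<le> l \<and> 1 \<le> s \<and> s \<le> l")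
  case True
  have "X (i, 1) (j, r) * X (h, 1) (g, s) = sg ((ip i \<noteq> ip j) \<and> (ip h \<noteq> ip g)) * (X (h, 1) (g, s) * X (i, 1) (j, r))"
    using cr_cr[of "epar bs" "((i, 1), (j, r))" "((h, 1), (g, s))"] by (simp add: epar_pair ep_def)
  then have "app (X (i, 1) (j, r)) (app (X (h, 1) (g, s)) vac) = scl (sgn ((ip i \<noteq> ip j) \<and> (ip h \<noteq> ip g))) (app (X (h, 1) (g, s)) (app (X (i, 1) (j, r)) vac))"
    by (metis app_simps(6) app_sc sc_sgn)
  then show ?thesis using True by (simp add: PP_def vc_def Cc_def app_scl mult_ac)
next
  case False
  then consider "r = 0" | "s = 0" | "r > l" | "s > l" by linarith
  then show ?thesis
    by cases (auto simp: PP_def vc_def Cc_def sgn_def)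
qed

lemma Lop_vc: "i \<in> {1..k} \<Longrightarrow> j \<in> {1..k} \<Longrightarrow> g \<in> {1..k} \<Longrightarrow> 1 \<le> s \<Longrightarrow> 1 \<le> l \<Longrightarrow>
   scl (sgn (ip i)) (app (Lop (i, 1) (j, 1)) (vc h g s)) = (if j = h then scl (sgn (ip j)) (vc i g s) else 0)"
proof -
  assume ij: "i \<in> {1..k}" "j \<in> {1..k}" "g \<in> {1..k}" and s: "1 \<le> s" "1 \<le> l"
  show ?thesis
  proof (cases "s \<le> l")
    case True
    have gB: "(g, s) \<in> B" using ij s True by (auto simp: boxes_def)
    have "app (br (ep (i, 1) (j, 1) \<and> ep (h, 1) (g, s)) (Lop (i, 1) (j, 1)) (X (h, 1) (g, s))) vac
       = (if (j, 1) = (h, 1) then app (X (i, 1) (g, s)) vac else 0)"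
      unfolding br_L_X[OF gB] by simp
    then have "app (Lop (i, 1) (j, 1)) (app (X (h, 1) (g, s)) vac) = (if j = h then app (X (i, 1) (g, s)) vac else 0)"
      by (simp add: br_def sg_def)
    then show ?thesis using True s by (auto simp: vc_def Cc_def app_scl eps_pair sgn_def)
  qed (use s in \<open>simp add: vc_def Cc_def\<close>)
qed

lemma Chat_vc: "i \<in> {1..k} \<Longrightarrow> j \<in> {1..k} \<Longrightarrow> g \<in> {1..k} \<Longrightarrow> 1 \<le> s \<Longrightarrow>
   app (Chat i j r) (vc h g s) = PP i j r h g s + (if r = 1 \<and> j = h then scl (sgn (ip j)) (vc i g s) else 0)"
proof -
  assume a: "i \<in> {1..k}" "j \<in> {1..k}" "g \<in> {1..k}" "1 \<le> s"
  show ?thesis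
  proof (cases "1 \<le> l")
    case True
    then show ?thesis unfolding Chat_eq[OF a(1,2)] PP_def
      using Lop_vc[OF a True, of h] by auto
  next
    case False
    then show ?thesis unfolding Chat_eq[OF a(1,2)] PP_def using a by (simp add: vc_def Cc_def)
  qed
qed

lemma WM_lower_vac: "(a, b) \<in> PG \<Longrightarrow> 2 \<le> snd a \<Longrightarrow> app (WM (a, b)) vac = 0"
  by (simp add: WM_eq MO_def)

text \<open>A pair starting right of column 1 acts by right multiplication: it moves the endpoint of
  the variable, provided that the endpoint is the first box of the pair.\<close>

lemma WM_lower_vc:
  assumes ab: "(a, b) \<in> PG" "2 \<le> snd a" and h: "h \<in> {1..k}"
  shows "app (WM (a, b)) (vc h g s) = (if a = (g, s) then - scl (yeps h g (fst b)) (vc h (fst b) (snd b)) else 0)"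
proof (cases "1 \<le> s \<and> s \<le> l")
  case True
  have hB: "(h, 1) \<in> B" using h True by (auto simp: boxes_def)
  have bl: "1 \<le> snd b" "snd b \<le> l" using ab by (auto simp: PG_iff boxes_def)
  obtain b1 b2 where bb: "b = (b1, b2)" by fastforce
  have "app (br (ep a b \<and> ep (h, 1) (g, s)) (Rop a b) (X (h, 1) (g, s))) vac =
     (if (g, s) = a then scl (sgn (ep (h, 1) a \<and> ep a b)) (app (X (h, 1) b) vac) else 0)"
    unfolding br_R_X[OF hB] by (simp add: sc_sgn[symmetric])
  then have "app (Rop a b) (app (X (h, 1) (g, s)) vac) = (if (g, s) = a then scl (sgn (ep (h, 1) a \<and> ep a b)) (app (X (h, 1) b) vac) else 0)"
    by (simp add: br_def sg_def app_uminus)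
  then have R: "app (WM (a, b)) (vc h g s) = (if a = (g, s) then - scl (eps a b * eps (h, 1) (g, s) * sgn (ep (h, 1) a \<and> ep a b)) (app (X (h, 1) b) vac) else 0)"
    unfolding WM_eq[OF ab(1)] using True ab(2) by (auto simp: MO_def vc_def Cc_def app_scl)
  show ?thesis
  proof (cases "a = (g, s)")
    case True': True
    have "s \<le> snd b" using ab True' by (simp add: PG_iff)
    then have "eps a b * eps (h, 1) (g, s) * sgn (ep (h, 1) a \<and> ep a b) = yeps h g (fst b) * eps (h, 1) b"
      unfolding True' bb by (auto simp: eps_pair ep_def yeps_def sgn_def)
    then show ?thesis unfolding R using True' bl by (simp add: vc_def Cc_def)
  qed (simp add: R)
next
  case False
  then show ?thesis
  proof (cases "s = 0")
    case True
    then show ?thesis using ab WM_lower_vac[OF ab] by (auto simp: vc_def Cc_def)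
  next
    case False': False
    then have "s > l" using False by simp
    moreover have "snd a \<le> l" using ab by (auto simp: PG_iff boxes_def)
    ultimately show ?thesis using False' by (auto simp: vc_def Cc_def)
  qed
qed

lemma TH_lower_vac: "2 \<le> p \<Longrightarrow> app (TH WM p r i j) vac = (if r = 0 \<and> i = j then vac else 0)"
proof (induction "nat r" arbitrary: p r i rule: less_induct)
  case less
  let ?G = "{g. g \<in> PG \<and> fst (fst g) = i \<and> p \<le> snd (fst g)}"
  have "app (WM g * TH WM (snd (snd g) + 1) (r - kdeg g) (fst (snd g)) j) vac = 0" if "g \<in> ?G" for g
  proof -
    obtain a b where ab: "g = (a, b)" by (metis surj_pair)
    have g: "(a, b) \<in> PG" "2 \<le> snd a" "snd a \<le> snd b" using that less.prems by (auto simp: ab PG_iff)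
    show ?thesis
    proof (cases "r - kdeg g < 0")
      case True
      then show ?thesis by (simp only: TH_neg mult_zero_right app_simps)
    next
      case False
      then have "nat (r - kdeg g) < nat r" using kdeg_pos[of g] g ab by simp
      from less.hyps[OF this, of "snd b + 1" "fst b"] show ?thesis
        using g WM_lower_vac[OF g(1,2)] by (simp add: ab)
    qed
  qed
  then show ?case by (subst TH_rec) (simp add: app_sum_left)
qed

text \<open>The rightmost pair acts first and moves the endpoint to the right, out of reach of the
  other pairs. Besides the empty chain, only the single pair from \<open>(g, s)\<close> to
  \<open>(j, s + r - 1)\<close> survives.\<close>

lemma TH_lower_vc:
  assumes h: "h \<in> {1..k}" and j: "j \<in> {1..k}" and s: "1 \<le> s"
  and g: "g \<in> {1..k}" shows "2 \<le> p \<Longrightarrow> app (TH WM p (int r) i j) (vc h g s) = (if r = 0 \<and> i = j then vc h g s else 0)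
     - (if 1 \<le> r \<and> p \<le> s \<and> i = g then scl (yeps h g j) (vc h j (s + r - 1)) else 0)"
proof (induction r arbitrary: p i rule: less_induct)
  case (less r)
  let ?G = "{x. x \<in> PG \<and> fst (fst x) = i \<and> p \<le> snd (fst x)}"
  let ?E = "- scl (yeps h g j) (vc h j (s + r - 1))"
  have f: "app (WM x * TH WM (snd (snd x) + 1) (int r - kdeg x) (fst (snd x)) j) (vc h g s) = (if x = ((g, s), (j, s + r - 1)) then ?E else 0)"
    if x: "x \<in> ?G" for x
  proof -
    obtain a b where ab: "x = (a, b)" by (metis surj_pair)
    have G: "(a, b) \<in> PG" "2 \<le> snd a" "snd a \<le> snd b" "fst a = i" "p \<le> snd a" using x less.prems by (auto simp: ab PG_iff)
    have kd: "kdeg x = int (snd b - snd a + 1)" using G by (simp add: ab kdeg_def of_nat_diff)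
    show ?thesis
    proof (cases "snd b - snd a + 1 \<le> r")
      case False
      then have "int r - kdeg x < 0" using kd by simp
      then have "app (WM x * TH WM (snd (snd x) + 1) (int r - kdeg x) (fst (snd x)) j) (vc h g s) = 0"
        by (simp only: TH_neg mult_zero_right app_simps)
      moreover have "x \<noteq> ((g, s), (j, s + r - 1))" using False ab G s by (cases r) auto
      ultimately show ?thesis by simp
    next
      case True
      define r' where "r' = r - (snd b - snd a + 1)"
      have r': "int r - kdeg x = int r'" using True kd by (simp add: r'_def of_nat_diff)
      have "r' < r" using True by (simp add: r'_def)
      then have IH: "app (TH WM (snd b + 1) (int r') (fst b) j) (vc h g s) = (if r' = 0 \<and> fst b = j then vc h g s else 0)
          - (if 1 \<le> r' \<and> snd b + 1 \<le> s \<and> fst b = g then scl (yeps h g j) (vc h j (s + r' - 1)) else 0)"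
        by (rule less.IH) (use G in simp)
      have z: "app (WM (a, b)) (if 1 \<le> r' \<and> snd b + 1 \<le> s \<and> fst b = g then scl (yeps h g j) (vc h j (s + r' - 1)) else 0) = 0"
        using WM_lower_vc[OF G(1,2) h, of j "s + r' - 1"] G by (auto simp: app_scl)
      have "app (WM x * TH WM (snd (snd x) + 1) (int r - kdeg x) (fst (snd x)) j) (vc h g s)
          = (if r' = 0 \<and> fst b = j then app (WM (a, b)) (vc h g s) else 0)"
        by (simp only: ab fst_conv snd_conv app_simps(6) r'[unfolded ab] IH app_diff z) simp
      also have "\<dots> = (if r' = 0 \<and> fst b = j \<and> a = (g, s) then - scl (yeps h g (fst b)) (vc h (fst b) (snd b)) else 0)"
        using WM_lower_vc[OF G(1,2) h, of g s] by auto
      also have "\<dots> = (if x = ((g, s), (j, s + r - 1)) then ?E else 0)"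
      proof (cases "a = (g, s) \<and> fst b = j")
        case True': True
        have "r' = 0 \<longleftrightarrow> snd b = s + r - 1" using True True' G by (auto simp: r'_def)
        then show ?thesis using True' by (auto simp: ab prod_eq_iff)
      qed (auto simp: ab)
      finally show ?thesis .
    qed
  qed
  have fin: "finite ?G" by (rule finite_subset[OF _ finite_PG]) auto
  have "app (TH WM p (int r) i j) (vc h g s) = (if r = 0 \<and> i = j then vc h g s else 0) +
      (\<Sum>x\<in>?G. app (WM x * TH WM (snd (snd x) + 1) (int r - kdeg x) (fst (snd x)) j) (vc h g s))"
    by (subst TH_rec) (simp add: app_sum_left)
  also have "(\<Sum>x\<in>?G. app (WM x * TH WM (snd (snd x) + 1) (int r - kdeg x) (fst (snd x)) j) (vc h g s)) =
      (\<Sum>x\<in>?G. if x = ((g, s), (j, s + r - 1)) then ?E else 0)"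
    by (rule sum.cong[OF refl f])
  also have "\<dots> = (if ((g, s), (j, s + r - 1)) \<in> ?G then ?E else 0)"
    using fin by simp
  also have "\<dots> = - (if 1 \<le> r \<and> p \<le> s \<and> i = g then scl (yeps h g j) (vc h j (s + r - 1)) else 0)"
  proof (cases "1 \<le> r \<and> p \<le> s \<and> i = g")
    case True
    show ?thesis
    proof (cases "s + r - 1 \<le> l")
      case True': True
      then have "((g, s), (j, s + r - 1)) \<in> ?G" using True g j s by (auto simp: PG_iff boxes_def)
      then show ?thesis using True by simp
    next
      case False
      then have "vc h j (s + r - 1) = 0" by (intro vc_large) simp
      then show ?thesis by simp
    qed
  next
    case False
    then have "((g, s), (j, s + r - 1)) \<notin> ?G" using s by (cases r) (auto simp: PG_iff)
    then show ?thesis by (simp only: False if_False minus_zero)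
  qed
  finally show ?case by simp
qed

definition Tm :: "nat \<Rightarrow> nat \<Rightarrow> nat \<Rightarrow> (box \<times> box) multiset op" where
  "Tm i j r = TH WM 1 (int r) i j"

lemma Tm_zero: "Tm i j 0 = (if i = j then 1 else 0)"
  by (simp add: Tm_def TH_zero)

text \<open>A first pair in column 1 of degree \<open>q\<close> is split off, \<open>q = 0\<close>
  standing for its absence; the tail moves the endpoint, which needs \<open>s \<ge> 2\<close> as
  tails start outside column 1. The degrees \<open>q\<close> and \<open>r + s - 1 - q\<close> are
  those of the Yangian relation.\<close>

lemma Tm_vc_Chat:
  assumes i: "i \<in> {1..k}" and j: "j \<in> {1..k}" and h: "h \<in> {1..k}" and g: "g \<in> {1..k}" and r: "1 \<le> r" and s: "1 \<le> s" and l: "1 \<le> l"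
  shows "app (Tm i j r) (vc h g s) = app (Chat i j r) (vc h g s) -
    (if 2 \<le> s then scl (yeps h g j) (\<Sum>q<min r s. app (Chat i g q) (vc h j (r + s - 1 - q))) else 0)"
proof -
  let ?z = "vc h g s"
  define G where "G q = (if q < min r s then scl (yeps h g j) (app (Chat i g q) (vc h j (r + s - 1 - q))) else 0)" for q
  have f: "app (WM ((i, 1), b) * TH WM (snd b + 1) (int r - (int (snd b) - int 1 + 1)) (fst b) j) ?z =
      (if b = (j, r) then app (Chat i j r) ?z else 0) - (if fst b = g then G (snd b) else 0)" if b: "b \<in> B" for b
  proof -
    obtain d q where bd: "b = (d, q)" by fastforce
    have q: "1 \<le> q" "q \<le> l" and d: "d \<in> {1..k}" using b by (auto simp: bd boxes_def)
    have W: "WM ((i, 1), b) = Chat i d q" using q by (simp add: Chat_def bd)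
    show ?thesis
    proof (cases "q \<le> r")
      case False
      then have "app (WM ((i, 1), b) * TH WM (snd b + 1) (int r - (int (snd b) - int 1 + 1)) (fst b) j) ?z = 0"
        by (simp add: bd TH_neg)
      then show ?thesis using False by (simp add: bd G_def)
    next
      case True
      then have e: "int r - (int (snd b) - int 1 + 1) = int (r - q)" by (simp add: bd of_nat_diff)
      have "app (TH WM (snd b + 1) (int (r - q)) d j) ?z = (if r - q = 0 \<and> d = j then ?z else 0)
         - (if 1 \<le> r - q \<and> snd b + 1 \<le> s \<and> d = g then scl (yeps h g j) (vc h j (s + (r - q) - 1)) else 0)"
        by (rule TH_lower_vc[OF h j s g]) (use q bd in simp)
      moreover have "s + (r - q) - 1 = r + s - 1 - q" using True by simp
      ultimately have "app (WM ((i, 1), b) * TH WM (snd b + 1) (int r - (int (snd b) - int 1 + 1)) (fst b) j) ?z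
        = app (Chat i d q) ((if r - q = 0 \<and> d = j then ?z else 0) - (if 1 \<le> r - q \<and> q + 1 \<le> s \<and> d = g then scl (yeps h g j) (vc h j (r + s - 1 - q)) else 0))"
        unfolding e W by (simp add: bd)
      also have "\<dots> = (if b = (j, r) then app (Chat i j r) ?z else 0) - (if fst b = g then G (snd b) else 0)"
        using True by (auto simp: bd G_def app_diff app_scl app_uminus)
      finally show ?thesis .
    qed
  qed
  have B1: "Bge 1 = B" by (auto simp: boxes_def)
  have "(\<Sum>b\<in>B. if fst b = g then G (snd b) else 0) = (\<Sum>d\<in>{1..k}. \<Sum>q\<in>{1..l}. if d = g then G q else 0)"
    unfolding boxes_def sum.cartesian_product by (rule sum.cong) (auto simp: case_prod_beta)
  also have "\<dots> = (\<Sum>q\<in>{1..l}. \<Sum>d\<in>{1..k}. if d = g then G q else 0)" by (rule sum.swap)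
  also have "\<dots> = (\<Sum>q\<in>{1..l}. G q)" using g by simp
  also have "\<dots> = (\<Sum>q\<in>{1..<min r s}. G q)"
  proof -
    have "(\<Sum>q\<in>{1..l}. G q) = (\<Sum>q\<in>{1..l} \<inter> {1..<min r s}. G q)"
      by (rule sum.mono_neutral_right) (auto simp: G_def)
    \<comment> \<open>Indices above \<open>l\<close> may be added, since \<open>Chat\<close>
      vanishes there.\<close>
    also have "\<dots> = (\<Sum>q\<in>{1..<min r s}. G q)"
      by (rule sum.mono_neutral_left) (auto simp: G_def Chat_def)
    finally show ?thesis .
  qed
  finally have GS: "(\<Sum>b\<in>B. if fst b = g then G (snd b) else 0) = (\<Sum>q\<in>{1..<min r s}. G q)" .
  have mem: "(j, r) \<in> B \<longleftrightarrow> r \<le> l" using j r by (auto simp: boxes_def)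
  have CS: "(\<Sum>b\<in>B. if b = (j, r) then app (Chat i j r) ?z else 0) = app (Chat i j r) ?z"
    using mem r by (auto simp: Chat_def)
  have "app (Tm i j r) ?z = app (TH WM (1 + 1) (int r) i j) ?z +
     (\<Sum>b\<in>B. app (WM ((i, 1), b) * TH WM (snd b + 1) (int r - (int (snd b) - int 1 + 1)) (fst b) j) ?z)"
    unfolding Tm_def by (subst TH_split[OF i order_refl l]) (simp only: B1 app_simps(3) app_sum_left)
  also have "(\<Sum>b\<in>B. app (WM ((i, 1), b) * TH WM (snd b + 1) (int r - (int (snd b) - int 1 + 1)) (fst b) j) ?z)
     = app (Chat i j r) ?z - (\<Sum>q\<in>{1..<min r s}. G q)"
    by (simp only: sum.cong[OF refl f] sum_subtractf CS GS)
  also have "app (TH WM (1 + 1) (int r) i j) ?z = - (if 2 \<le> s then G 0 else 0)"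
    using TH_lower_vc[OF h j s g, of "1 + 1" r i] r s by (auto simp: G_def Chat_def add.commute)
  also have "- (if 2 \<le> s then G 0 else 0) + (app (Chat i j r) ?z - (\<Sum>q\<in>{1..<min r s}. G q))
     = app (Chat i j r) ?z - (if 2 \<le> s then (\<Sum>q<min r s. G q) else 0)"
  proof (cases "2 \<le> s")
    case True
    have "{..<min r s} = insert 0 {1..<min r s}" using r s by auto
    then show ?thesis using True by simp
  next
    case False
    then have "{1..<min r s} = {}" using s by auto
    then show ?thesis using False by simp
  qed
  also have "(\<Sum>q<min r s. G q) = scl (yeps h g j) (\<Sum>q<min r s. app (Chat i g q) (vc h j (r + s - 1 - q)))"
    unfolding cvs.scale_sum_right by (rule sum.cong) (auto simp: G_def)
  finally show ?thesis .
qed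

lemma Tm_vc:
  assumes i: "i \<in> {1..k}" and j: "j \<in> {1..k}" and h: "h \<in> {1..k}" and g: "g \<in> {1..k}" and r: "1 \<le> r" and s: "1 \<le> s"
  shows "app (Tm i j r) (vc h g s) = PP i j r h g s + (if r = 1 \<and> j = h then scl (sgn (ip j)) (vc i g s) else 0) -
    (if 2 \<le> s then scl (yeps h g j) ((\<Sum>q<min r s. PP i g q h j (r + s - 1 - q))
        + (if 2 \<le> r \<and> g = h then scl (sgn (ip g)) (vc i j (r + s - 2)) else 0)) else 0)"
proof (cases "1 \<le> l")
  case True
  have "(\<Sum>q<min r s. app (Chat i g q) (vc h j (r + s - 1 - q))) =
     (\<Sum>q<min r s. PP i g q h j (r + s - 1 - q) + (if q = 1 then if g = h then scl (sgn (ip g)) (vc i j (r + s - 2)) else 0 else 0))"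
  proof (rule sum.cong[OF refl])
    fix q assume "q \<in> {..<min r s}"
    then have "1 \<le> r + s - 1 - q" by auto
    then show "app (Chat i g q) (vc h j (r + s - 1 - q)) = PP i g q h j (r + s - 1 - q)
       + (if q = 1 then if g = h then scl (sgn (ip g)) (vc i j (r + s - 2)) else 0 else 0)"
      by (auto simp: Chat_vc[OF i g j] numeral_2_eq_2)
  qed
  also have "\<dots> = (\<Sum>q<min r s. PP i g q h j (r + s - 1 - q)) + (if 1 < min r s then if g = h then scl (sgn (ip g)) (vc i j (r + s - 2)) else 0 else 0)"
    by (simp add: sum.distrib)
  finally show ?thesis unfolding Tm_vc_Chat[OF i j h g r s True] Chat_vc[OF i j g s]
    by auto
next
  case False
  then have l: "l = 0" by simp
  have "Tm i j r = 0" unfolding Tm_def by (rule TH_large) (use l r in auto)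
  moreover have z: "vc a b c = 0" if "1 \<le> c" for a b c
    unfolding vc_def Cc_def using that l by simp
  have "PP i g q h j (r + s - 1 - q) = 0" if "q < min r s" for q
    unfolding PP_def by (subst z) (use that in auto)
  then have "(\<Sum>q<min r s. PP i g q h j (r + s - 1 - q)) = 0" by simp
  moreover have "PP i j r h g s = 0" unfolding PP_def by (subst z) (use s in auto)
  moreover have "2 \<le> r \<Longrightarrow> 2 \<le> s \<Longrightarrow> vc i j (r + s - 2) = 0" by (rule z) simp
  ultimately show ?thesis using z[OF s] by auto
qed

text \<open>Pairs starting right of column 1 kill the vacuum, so only the one-pair chain from column
  1 remains: \<open>t\<close> creates its variable without lower terms.\<close>

lemma Tm_vac:
  assumes i: "i \<in> {1..k}" and j: "j \<in> {1..k}"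
  shows "app (Tm i j r) vac = vc i j r"
proof (cases "r = 0 \<or> l = 0")
  case True
  show ?thesis
  proof (cases "r = 0")
    case True
    then show ?thesis by (simp add: Tm_zero vc_def Cc_def)
  next
    case False
    then have "l = 0" using True by simp
    have "Tm i j r = 0" unfolding Tm_def by (rule TH_large) (use \<open>l = 0\<close> False in auto)
    then show ?thesis using vc_large[of r i j] \<open>l = 0\<close> False by simp
  qed
next
  case False
  then have r: "1 \<le> r" and l: "1 \<le> l" by auto
  have f: "app (WM ((i, 1), b) * TH WM (snd b + 1) (int r - (int (snd b) - int 1 + 1)) (fst b) j) vac =
      (if b = (j, r) then app (Chat i j r) vac else 0)" if b: "b \<in> B" for b
  proof -
    obtain d q where bd: "b = (d, q)" by fastforce
    have q: "1 \<le> q" "q \<le> l" using b by (auto simp: bd boxes_def)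
    have "app (TH WM (snd b + 1) (int r - (int (snd b) - int 1 + 1)) (fst b) j) vac = (if int r - (int (snd b) - int 1 + 1) = 0 \<and> fst b = j then vac else 0)"
      by (rule TH_lower_vac) (use q bd in simp)
    then show ?thesis using q by (auto simp: bd Chat_def)
  qed
  have B1: "Bge 1 = B" by (auto simp: boxes_def)
  have mem: "(j, r) \<in> B \<longleftrightarrow> r \<le> l" using j r by (auto simp: boxes_def)
  have CS: "(\<Sum>b\<in>B. if b = (j, r) then app (Chat i j r) vac else 0) = app (Chat i j r) vac"
    using mem r by (auto simp: Chat_def)
  have "app (Tm i j r) vac = app (TH WM (1 + 1) (int r) i j) vac +
     (\<Sum>b\<in>B. app (WM ((i, 1), b) * TH WM (snd b + 1) (int r - (int (snd b) - int 1 + 1)) (fst b) j) vac)"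
    unfolding Tm_def by (subst TH_split[OF i order_refl l]) (simp only: B1 app_simps(3) app_sum_left)
  also have "(\<Sum>b\<in>B. app (WM ((i, 1), b) * TH WM (snd b + 1) (int r - (int (snd b) - int 1 + 1)) (fst b) j) vac)
     = app (Chat i j r) vac"
    by (simp only: sum.cong[OF refl f] CS)
  also have "app (TH WM (1 + 1) (int r) i j) vac = 0"
    using TH_lower_vac[of "1 + 1" "int r" i j] r by simp
  finally show ?thesis by (simp add: Chat_vac[OF i j])
qed

definition ysgn :: "nat \<Rightarrow> nat \<Rightarrow> nat \<Rightarrow> complex" where
  "ysgn i j h = sgn (((ip i \<and> ip j) \<noteq> (ip i \<and> ip h)) \<noteq> (ip j \<and> ip h))"

lemma PP_zero_left: "PP i j 0 h g s = (if i = j then vc h g s else 0)"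
  and PP_zero_right: "PP i j r h g 0 = (if h = g then vc i j r else 0)"
  by (auto simp: PP_def vc_def Cc_def)

text \<open>The sum in \<open>Tm_vc\<close> occurs only for \<open>s \<ge> 2\<close> and its
  corrections distinguish \<open>r = 1\<close> from \<open>r \<ge> 2\<close>, whence four cases. In
  the last one the sums of the left side become those of the right side by \<open>PP_sym\<close>,
  and the inner sums produced on the right cancel each other for \<open>t \<ge> 2\<close>.\<close>

lemma Yangian_vac:
  assumes i: "i \<in> {1..k}" and j: "j \<in> {1..k}" and h: "h \<in> {1..k}" and g: "g \<in> {1..k}" and r: "1 \<le> r" and s: "1 \<le> s"
  shows "app (Tm i j r) (app (Tm h g s) vac) - scl (sgn ((ip i \<noteq> ip j) \<and> (ip h \<noteq> ip g))) (app (Tm h g s) (app (Tm i j r) vac))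
   = scl (ysgn i j h) (\<Sum>t<min r s. app (Tm h j t) (app (Tm i g (r + s - 1 - t)) vac) - app (Tm h j (r + s - 1 - t)) (app (Tm i g t) vac))"
proof -
  let ?\<sigma> = "ysgn i j h" and ?s = "sgn ((ip i \<noteq> ip j) \<and> (ip h \<noteq> ip g))"
  note vacs = Tm_vac[OF i j] Tm_vac[OF h g] Tm_vac[OF i g] Tm_vac[OF h j]
  note T1 = Tm_vc[OF i j h g r s] and T2 = Tm_vc[OF h g i j s r]
  have sy: "PP i j r h g s = scl ?s (PP h g s i j r)" by (rule PP_sym)
  have t0: "app (Tm h j 0) (vc i g (r + s - 1)) - app (Tm h j (r + s - 1)) (vc i g 0)
     = (if h = j then vc i g (r + s - 1) else 0) - (if i = g then vc h j (r + s - 1) else 0)"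
    using Tm_vac[OF h j] by (auto simp: Tm_zero vc_def Cc_def)
  consider (a) "r = 1" "s = 1" | (b) "r = 1" "2 \<le> s" | (c) "2 \<le> r" "s = 1" | (d) "2 \<le> r" "2 \<le> s" using r s by linarith
  then show ?thesis
  proof cases
    case a
    have R: "(\<Sum>t<min r s. app (Tm h j t) (vc i g (r + s - 1 - t)) - app (Tm h j (r + s - 1 - t)) (vc i g t))
       = (if h = j then vc i g (r + s - 1) else 0) - (if i = g then vc h j (r + s - 1) else 0)"
      using t0 a by simp
    show ?thesis unfolding vacs R T1 T2 sy
      by (cases "ip i"; cases "ip j"; cases "ip h"; cases "ip g"; use a in \<open>auto simp: ysgn_def sgn_def\<close>)
  next
    case b
    have R: "(\<Sum>t<1. app (Tm h j t) (vc i g (r + s - 1 - t)) - app (Tm h j (r + s - 1 - t)) (vc i g t))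
       = (if h = j then vc i g (r + s - 1) else 0) - (if i = g then vc h j (r + s - 1) else 0)"
      using t0 by simp
    have m: "min r s = 1" "min s r = 1" using b by auto
    show ?thesis unfolding vacs m R T1 T2 sy
      by (cases "ip i"; cases "ip j"; cases "ip h"; cases "ip g"; use b in \<open>auto simp: ysgn_def yeps_def sgn_def PP_zero_left\<close>)
  next
    case c
    have R: "(\<Sum>t<1. app (Tm h j t) (vc i g (r + s - 1 - t)) - app (Tm h j (r + s - 1 - t)) (vc i g t))
       = (if h = j then vc i g (r + s - 1) else 0) - (if i = g then vc h j (r + s - 1) else 0)"
      using t0 by simp
    have m: "min r s = 1" "min s r = 1" using c by auto
    show ?thesis unfolding vacs m R T1 T2 sy
      by (cases "ip i"; cases "ip j"; cases "ip h"; cases "ip g"; use c in \<open>auto simp: ysgn_def yeps_def sgn_def PP_zero_left\<close>)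
  next
    case d
    define R where "R = r + s - 1"
    define M where "M = min r s"
    have RM: "r + s - 1 = R" "s + r - 1 = R" "min r s = M" "min s r = M" "r + s - 2 = R - 1" "s + r - 2 = R - 1"
      by (auto simp: R_def M_def)
    \<comment> \<open>The linear remainder at \<open>t = 1\<close>, where one inner sum is absent
      and the derivation part of column 1 contributes.\<close>
    define E where "E = (if j = i then scl (sgn (ip j)) (vc h g (R - 1)) else 0) - (if h = g then scl (yeps i g j) (vc i j (R - 1)) else 0)"
    define Q1 where "Q1 = (\<Sum>q<M. PP h j q i g (R - q))"
    define Q2 where "Q2 = (\<Sum>q<M. PP h j (R - q) i g q)"
    have M2: "2 \<le> M" using d by (simp add: M_def)
    have D: "app (Tm h j t) (vc i g (R - t)) - app (Tm h j (R - t)) (vc i g t)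
       = (PP h j t i g (R - t) - PP h j (R - t) i g t) + (if t = 1 then E else 0)" if t: "t < M" for t
    proof (cases "t = 0")
      case True
      then show ?thesis using t0 unfolding RM by (simp add: PP_zero_left PP_zero_right)
    next
      case False
      then have t1: "1 \<le> t" by simp
      have Rt: "1 \<le> R - t" "2 \<le> R - t" "t \<le> R - t" "R - t \<noteq> 1" "t + (R - t) - 1 = R - 1" "R - t + t - 1 = R - 1" "t + (R - t) - 2 = R - 2" "R - t + t - 2 = R - 2"
        using t d by (auto simp: R_def M_def min_def split: if_splits)
      note A1 = Tm_vc[OF h j i g t1 Rt(1), unfolded Rt(5,7)] and A2 = Tm_vc[OF h j i g Rt(1) t1, unfolded Rt(6,8)]
      \<comment> \<open>Since \<open>t \<le> R - t\<close>, the inner sums of both orders have the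
        same length and cancel when both are present.\<close>
      have m: "min t (R - t) = t" "min (R - t) t = t" using Rt by auto
      show ?thesis
      proof (cases "t = 1")
        case True
        show ?thesis unfolding A1 A2 m E_def using Rt True by (auto simp: PP_zero_left)
      next
        case False
        then show ?thesis unfolding A1 A2 m using Rt t1 by auto
      qed
    qed
    have "(\<Sum>t<M. app (Tm h j t) (vc i g (R - t)) - app (Tm h j (R - t)) (vc i g t))
       = (\<Sum>t<M. (PP h j t i g (R - t) - PP h j (R - t) i g t) + (if t = 1 then E else 0))"
      by (rule sum.cong[OF refl]) (simp only: D lessThan_iff)
    also have "\<dots> = Q1 - Q2 + E" unfolding Q1_def Q2_def sum.distrib sum_subtractf using M2 by simp
    finally have rhs: "(\<Sum>t<M. app (Tm h j t) (vc i g (R - t)) - app (Tm h j (R - t)) (vc i g t)) = Q1 - Q2 + E" .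
    have A: "(\<Sum>q<M. PP i g q h j (R - q)) = scl (sgn ((ip i \<noteq> ip g) \<and> (ip h \<noteq> ip j))) Q2"
      unfolding Q2_def cvs.scale_sum_right by (rule sum.cong[OF refl]) (rule PP_sym)
    have e1: "yeps h g j * sgn ((ip i \<noteq> ip g) \<and> (ip h \<noteq> ip j)) = ?\<sigma>"
      and e2: "?s * yeps i j g = ?\<sigma>"
      by (cases "ip i"; cases "ip j"; cases "ip h"; cases "ip g"; simp add: ysgn_def yeps_def sgn_def)+
    have e3: "yeps h g j * sgn (ip g) = ?\<sigma> * yeps i g j" if "g = h"
      unfolding that by (cases "ip i"; cases "ip j"; cases "ip h"; simp add: ysgn_def yeps_def sgn_def)
    have s2: "?s * ?s = 1" by (simp add: sgn_def)
    have A': "scl (yeps h g j) (\<Sum>q<M. PP i g q h j (R - q)) = scl ?\<sigma> Q2"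
      unfolding A by (simp only: cvs.scale_scale e1)
    have L1: "app (Tm i j r) (vc h g s) = scl ?s (PP h g s i j r) - scl ?\<sigma> Q2 - (if h = g then scl (?\<sigma> * yeps i g j) (vc i j (R - 1)) else 0)"
      unfolding T1 RM sy using d e3 A' by (auto simp: cvs.scale_right_distrib)
    have L2: "scl ?s (app (Tm h g s) (vc i j r)) = scl ?s (PP h g s i j r) - scl ?\<sigma> Q1 - (if j = i then scl (?\<sigma> * sgn (ip j)) (vc h g (R - 1)) else 0)"
    proof -
      have T2': "app (Tm h g s) (vc i j r) = PP h g s i j r - scl (yeps i j g) (Q1 + (if j = i then scl (sgn (ip j)) (vc h g (R - 1)) else 0))"
        unfolding T2 RM Q1_def[symmetric] using d by auto
      have e2': "scl ?s (scl (yeps i j g) z) = scl ?\<sigma> z" for z :: "(box \<times> box) multiset \<Rightarrow>\<^sub>0 complex"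
        by (simp only: cvs.scale_scale e2)
      show ?thesis unfolding T2' cvs.scale_right_diff_distrib e2' cvs.scale_right_distrib by auto
    qed
    show ?thesis unfolding vacs RM rhs L1 L2 E_def
      by (auto simp: cvs.scale_right_distrib cvs.scale_right_diff_distrib)
  qed
qed

section \<open>Column 1 polynomials and leading parts\<close>

definition CG :: "(box \<times> box) set" where "CG = {g \<in> PG. snd (fst g) = 1}"

lemma CG_iff: "(a, b) \<in> CG \<longleftrightarrow> (a, b) \<in> PG \<and> snd a = 1"
  by (simp add: CG_def)

text \<open>Polynomials in the column 1 variables are stable: they are the small module proper
  inside the Fock space.\<close>

lemma PG_VC: assumes g: "g \<in> PG" and v: "v \<in> VQ CG" shows "app (WM g) v \<in> VQ CG" "app (MV g) v \<in> VQ CG"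
proof -
  obtain a b where ab: "g = (a, b)" by (metis surj_pair)
  have R: "app (Rop a b) v \<in> VQ CG"
    unfolding Rop_def app_sum_left
  proof (rule VQ_closed(6))
    fix c assume c: "c \<in> B"
    have "app (X c b) (app (DD c a) v) \<in> VQ CG"
    proof (cases "(c, a) \<in> CG")
      case True
      then have "(c, b) \<in> CG" using g c by (auto simp: ab PG_iff CG_iff)
      then show ?thesis by (intro VQ_cr VQ_an v)
    next
      case False
      then show ?thesis by (simp add: VQ_an_zero[OF v False] VQ_closed)
    qed
    then show "app (sg (ep c a \<and> ep a b) * (X c b * DD c a)) v \<in> VQ CG"
      by (simp add: sg_def VQ_closed)
  qed
  have L: "app (Lop a b) v \<in> VQ CG" if "snd a = 1"
    unfolding Lop_def app_sum_left
  proof (rule VQ_closed(6))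
    fix c assume c: "c \<in> B"
    show "app (X a c * DD b c) v \<in> VQ CG"
    proof (cases "(b, c) \<in> CG")
      case True
      then have "(a, c) \<in> CG" using g c that by (auto simp: ab PG_iff CG_iff)
      then show ?thesis by (simp add: VQ_cr VQ_an v)
    next
      case False
      then show ?thesis by (simp add: VQ_an_zero[OF v False] VQ_closed)
    qed
  qed
  have Xv: "app (X a b) v \<in> VQ CG" if "snd a = 1" by (rule VQ_cr[OF _ v]) (use g ab that in \<open>simp add: CG_iff\<close>)
  have M: "app (MO a b) v \<in> VQ CG"
    unfolding MO_def using R L Xv by (auto simp: VQ_closed)
  then show "app (WM g) v \<in> VQ CG" using g by (simp add: ab WM_eq VQ_closed)
  show "app (MV g) v \<in> VQ CG" using g M v by (auto simp: ab MV_def VQ_closed)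
qed

lemma TH_VC: "v \<in> VQ CG \<Longrightarrow> app (TH WM p r i j) v \<in> VQ CG"
proof -
  assume v: "v \<in> VQ CG"
  have "app (prod_list (map WM ps)) v \<in> VQ CG" if "set ps \<subseteq> PG" for ps
    using that
  proof (induction ps)
    case (Cons g ps)
    then show ?case using PG_VC(1)[of g "app (prod_list (map WM ps)) v"] by simp
  qed (simp add: v)
  then show ?thesis unfolding TH_def app_sum_left using chain_length by (intro VQ_closed(6)) blast
qed

lemma WM_odeg:
  assumes "g \<in> PG"
  shows "snd (fst g) = 1 \<Longrightarrow> odeg kdeg (kdeg g - 1) (WM g - sc (eps (fst g) (snd g)) * cr (epar bs) g)"
    and "snd (fst g) \<noteq> 1 \<Longrightarrow> odeg kdeg (kdeg g - 1) (WM g)" and "odeg kdeg (kdeg g) (WM g)"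
proof -
  obtain a b where ab: "g = (a, b)" by (metis surj_pair)
  have s: "odeg kdeg e A \<Longrightarrow> odeg kdeg e (sc c * A)" for e c A
    using odeg_mult[OF odeg_sc, of kdeg e A c] by simp
  note W = WM_eq[OF assms[unfolded ab]]
  show 1: "odeg kdeg (kdeg g - 1) (WM g - sc (eps (fst g) (snd g)) * cr (epar bs) g)" if "snd (fst g) = 1"
    using that odeg_L[of a b] by (simp add: ab W MO_def distrib_left s)
  show 2: "odeg kdeg (kdeg g - 1) (WM g)" if "snd (fst g) \<noteq> 1"
    using that odeg_R[of a b] by (simp add: ab W MO_def s odeg_uminus)
  show "odeg kdeg (kdeg g) (WM g)"
  proof (cases "snd (fst g) = 1")
    case True
    have "odeg kdeg (kdeg g) ((WM g - sc (eps (fst g) (snd g)) * cr (epar bs) g) + sc (eps (fst g) (snd g)) * cr (epar bs) g)"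
      by (rule odeg_add[OF odeg_mono[OF 1[OF True]] s[OF odeg_cr]]) simp
    then show ?thesis by simp
  next
    case False
    then show ?thesis using odeg_mono[OF 2] by simp
  qed
qed

text \<open>A pair starting right of column 1 acts as a derivation and loses a degree; hence so does
  every sum of nonempty chains from column 2 on.\<close>

lemma TH_odeg: "odeg kdeg r (TH WM p r i j)" "2 \<le> p \<Longrightarrow> 1 \<le> r \<Longrightarrow> odeg kdeg (r - 1) (TH WM p r i j)"
proof -
  have "odeg kdeg r (TH WM p r i j) \<and> (2 \<le> p \<longrightarrow> 1 \<le> r \<longrightarrow> odeg kdeg (r - 1) (TH WM p r i j))"
  proof (induction "nat r" arbitrary: p r i rule: less_induct)
    case less
    have g: "odeg kdeg r (WM g * TH WM (snd (snd g) + 1) (r - kdeg g) (fst (snd g)) j) \<and>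
       (2 \<le> p \<longrightarrow> odeg kdeg (r - 1) (WM g * TH WM (snd (snd g) + 1) (r - kdeg g) (fst (snd g)) j))"
      if "g \<in> PG" "p \<le> snd (fst g)" for g
    proof (cases "r - kdeg g < 0")
      case True
      then show ?thesis by (simp only: TH_neg mult_zero_right odeg_zero simp_thms)
    next
      case False
      then have "nat (r - kdeg g) < nat r" using kdeg_pos[OF that(1)] by simp
      then have t: "odeg kdeg (r - kdeg g) (TH WM (snd (snd g) + 1) (r - kdeg g) (fst (snd g)) j)" using less by blast
      have "odeg kdeg r (WM g * TH WM (snd (snd g) + 1) (r - kdeg g) (fst (snd g)) j)"
        using odeg_mult[OF WM_odeg(3)[OF that(1)] t] by simp
      moreover have "odeg kdeg (r - 1) (WM g * TH WM (snd (snd g) + 1) (r - kdeg g) (fst (snd g)) j)" if "2 \<le> p"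
        using odeg_mult[OF WM_odeg(2)[OF \<open>g \<in> PG\<close>] t] that \<open>p \<le> snd (fst g)\<close> by simp
      ultimately show ?thesis by blast
    qed
    have one: "odeg kdeg r (if r = 0 \<and> i = j then 1 else 0)"
      using odeg_sc[of kdeg 1] by (auto simp: sc_simps)
    show ?case
      by (subst (1 2) TH_rec) (use g one in \<open>auto intro!: odeg_add odeg_sum\<close>)
  qed
  then show "odeg kdeg r (TH WM p r i j)" "2 \<le> p \<Longrightarrow> 1 \<le> r \<Longrightarrow> odeg kdeg (r - 1) (TH WM p r i j)" by auto
qed

text \<open>Only the single pair from \<open>(i, 1)\<close> to \<open>(j, r)\<close> reaches degree
  \<open>r\<close>: a longer chain has a nonempty tail, and a chain starting later loses a degree as
  well.\<close>

lemma Tm_lead: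
  assumes i: "i \<in> {1..k}" and j: "j \<in> {1..k}" and r: "1 \<le> r" "r \<le> l"
  shows "odeg kdeg (int r - 1) (Tm i j r - sc (eps (i, 1) (j, r)) * X (i, 1) (j, r))"
proof -
  let ?f = "\<lambda>b. WM ((i, 1), b) * TH WM (snd b + 1) (int r - (int (snd b) - int 1 + 1)) (fst b) j"
  let ?L = "sc (eps (i, 1) (j, r)) * X (i, 1) (j, r)"
  have l: "1 \<le> l" using r by simp
  have B1: "Bge 1 = B" by (auto simp: boxes_def)
  have mem: "(j, r) \<in> B" using j r by (auto simp: boxes_def)
  have S: "(\<Sum>b\<in>B. ?f b - (if b = (j, r) then ?L else 0)) = (\<Sum>b\<in>B. ?f b) - ?L"
    using mem by (simp add: sum_subtractf)
  have Tm: "Tm i j r - ?L = TH WM (1 + 1) (int r) i j + (\<Sum>b\<in>B. ?f b - (if b = (j, r) then ?L else 0))"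
    unfolding Tm_def S by (subst TH_split[OF i order_refl l]) (simp only: B1 add_diff_eq)
  have "odeg kdeg (int r - 1) (?f b - (if b = (j, r) then ?L else 0))" if b: "b \<in> B" for b
  proof -
    obtain d q where bd: "b = (d, q)" by fastforce
    have q: "1 \<le> q" "q \<le> l" "d \<in> {1..k}" using b by (auto simp: bd boxes_def)
    have P: "((i, 1), (d, q)) \<in> PG" using PG_row[OF i q(3) q(1,2)] .
    have kd: "kdeg ((i, 1), (d, q)) = int q" by (simp add: kdeg_def)
    consider "q > r" | "q = r" | "q < r" by linarith
    then show ?thesis
    proof cases
      case 1
      then show ?thesis by (simp add: bd TH_neg)
    next
      case 2
      have "?f b - (if b = (j, r) then ?L else 0) = (if d = j then WM ((i, 1), (j, r)) - ?L else 0)"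
        using 2 by (simp add: bd TH_zero)
      moreover have "odeg kdeg (int r - 1) (WM ((i, 1), (j, r)) - ?L)" if "d = j"
        using WM_odeg(1)[OF P] kd 2 that by simp
      ultimately show ?thesis by (auto split: if_splits)
    next
      case 3
      then have "odeg kdeg (int r - int q - 1) (TH WM (snd b + 1) (int r - (int (snd b) - int 1 + 1)) (fst b) j)"
        using TH_odeg(2)[of "snd b + 1" "int r - int q" "fst b" j] q by (simp add: bd)
      note t = this
      have P': "((i, 1), b) \<in> PG" and e: "kdeg ((i, 1), b) + (int r - int q - 1) = int r - 1" using P by (simp_all add: bd kdeg_def)
      from odeg_mult[OF WM_odeg(3)[OF P'] t] have "odeg kdeg (int r - 1) (?f b)" unfolding e .
      then show ?thesis using 3 by (simp add: bd)
    qed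
  qed
  moreover have "odeg kdeg (int r - 1) (TH WM (1 + 1) (int r) i j)" using r by (intro TH_odeg(2)) auto
  ultimately show ?thesis unfolding Tm by (intro odeg_add odeg_sum)
qed

end

section \<open>The isomorphism\<close>

lemma fmul_fsum:
  assumes "finite I"
  shows "fmul c (fsum G I) = fsum (\<lambda>i. fmul c (G i)) I" "fmul (fsum G I) c = fsum (\<lambda>i. fmul (G i) c) I"
  using assms by (induction I rule: finite_induct) (simp_all add: fmul_simps)

lemma reducible_fsum:
  "finite I \<Longrightarrow> (\<And>i. i \<in> I \<Longrightarrow> reducible S (two_ideal G) (H i)) \<Longrightarrow> reducible S (two_ideal G) (fsum H I)"
  by (induction I rule: finite_induct) (auto intro: reducible_fadd reducible_ideal two_ideal.zero)

text \<open>A relation between a word and the words of its image has to be checked only on letters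
  and under concatenation; used for degree and parity together.\<close>

lemma fspan_fprod_map:
  assumes "\<And>x. x \<in> set w \<Longrightarrow> \<sigma> x \<in> fspan {u. Q x u}"
    and "P [] []" "\<And>x u w v. Q x u \<Longrightarrow> P w v \<Longrightarrow> P (x # w) (u @ v)"
  shows "fprod (map \<sigma> w) \<in> fspan {u. P w u}"
  using assms(1)
proof (induction w)
  case Nil
  then show ?case using assms(2) by simp
next
  case (Cons x w)
  then have "\<sigma> x \<in> fspan {u. Q x u}" "fprod (map \<sigma> w) \<in> fspan {u. P w u}" by auto
  then show ?case using assms(3) by (auto intro: fspan_fmul_gen)
qed

lemma hom_ext_fspan:
  assumes "f \<in> fspan S" "\<And>w. w \<in> S \<Longrightarrow> fprod (map \<sigma> w) \<in> fspan T"
  shows "hom_ext \<sigma> f \<in> fspan T"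
  unfolding hom_ext_def
  by (intro fspan_fsum fspan_fsmul) (use assms in \<open>auto simp: fspan_def\<close>)

context rect
begin

section \<open>The homomorphism on representatives\<close>

abbreviation "YG \<equiv> Tgens k"
abbreviation "\<phi> \<equiv> hom_ext (sigma bs m n l)"

definition TG :: "tgen set" where "TG = {t \<in> YG. snd (snd t) \<le> l}"

text \<open>The variable that a generator creates on the vacuum. It matches the generators in
  \<open>TG\<close> with \<open>CG\<close> and respects degree, order and parity.\<close>

definition lt :: "tgen \<Rightarrow> box \<times> box" where "lt t = ((fst t, 1), (fst (snd t), snd (snd t)))"

definition TT :: "(box \<times> box \<Rightarrow> (box \<times> box) multiset op) \<Rightarrow> tgen \<Rightarrow> (box \<times> box) multiset op" where
  "TT A t = TH (At A) 1 (int (snd (snd t))) (fst t) (fst (snd t))"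

abbreviation "ydeg w \<equiv> sum_list (map (\<lambda>g :: tgen. snd (snd g)) w)"

lemma YG_iff: "(i, j, r) \<in> YG \<longleftrightarrow> i \<in> {1..k} \<and> j \<in> {1..k} \<and> 1 \<le> r"
  by (simp add: Tgens_def)

lemma sigma_fspan: "t \<in> YG \<Longrightarrow> sigma bs m n l t \<in> fspan {w. set w \<subseteq> PG}"
  by (auto simp: sigma_def YG_iff intro: t_elem_fspan split: prod.splits)

text \<open>For \<open>r > l\<close> the value \<open>fzero\<close> of \<open>sigma\<close> agrees
  with the chain sum, which is then empty; one formula covers all generators.\<close>

lemma sigma_ev: "t \<in> YG \<Longrightarrow> ev A (sigma bs m n l t) = TT A t"
proof -
  assume t: "t \<in> YG"
  obtain i j r where e: "t = (i, j, r)" by (metis surj_pair)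
  then have r: "1 \<le> r" using t by (simp add: YG_iff)
  show ?thesis
  proof (cases "r \<le> l")
    case True
    then show ?thesis by (simp add: e sigma_def TT_def t_elem_ev[OF r])
  next
    case False
    then have "TT A t = 0" unfolding TT_def e fst_conv snd_conv by (intro TH_large) auto
    then show ?thesis using False by (simp add: e sigma_def)
  qed
qed

lemma phi_fspan: "y \<in> Ycar k \<Longrightarrow> \<phi> y \<in> fspan {w. set w \<subseteq> PG}"
  unfolding Ycar_def by (rule fspan_hom_ext_letters[where B = YG]) (auto intro: sigma_fspan)

lemma PG_fspan: "f \<in> fspan {w. set w \<subseteq> PG} \<Longrightarrow> f \<in> Ucar k l"
  unfolding Ucar_def by (rule fspan_mono) (auto dest: PG_sub)

lemma phi_ev: assumes y: "y \<in> Ycar k" shows "ev A (\<phi> y) = ev (TT A) y"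
proof -
  have "ev A (\<phi> y) = ev (\<lambda>x. ev A (sigma bs m n l x)) y"
    by (rule ev_hom_ext[OF y[unfolded Ycar_def]]) (use sigma_fspan fspan_UNIV in blast)
  also have "\<dots> = ev (TT A) y"
    by (rule ev_cong[OF y[unfolded Ycar_def]]) (rule sigma_ev)
  finally show ?thesis .
qed

lemma phi_Whittaker: assumes y: "y \<in> Ycar k" shows "app (ev EV (\<phi> y)) vac \<in> WV"
proof -
  have "vac \<in> WV" using IV_gen[of _ "[]"] unfolding WV_def by simp
  then have "app (prod_list (map (TT EV) w)) vac \<in> WV" if "set w \<subseteq> YG" for w
    using that
  proof (induction w)
    case (Cons t w)
    then have "fst t \<in> {1..k}" by (cases t) (simp add: YG_iff)
    then show ?case using Cons T_Whittaker by (simp add: TT_def)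
  qed simp
  then show ?thesis unfolding phi_ev[OF y] app_ev
    by (intro WV_closed) (use y in \<open>auto simp: Ycar_def fspan_def\<close>)
qed

text \<open>From one vector to an operator identity: \<open>Whittaker_faithful\<close> passes from
  the small vacuum to the large one, and \<open>IU_iff\<close> from there to the whole Fock
  space.\<close>

lemma phi_zero:
  assumes y: "y \<in> Ycar k" and z: "app (ev (TT MV) y) vac = 0"
  shows "ev (TT EV) y = 0"
proof -
  have "app (ev EV (\<phi> y)) vac = 0"
    by (rule Whittaker_faithful[OF phi_fspan[OF y] phi_Whittaker[OF y]]) (simp add: phi_ev[OF y] z)
  then show ?thesis using IU_iff(2)[OF PG_fspan[OF phi_fspan[OF y]]] phi_ev[OF y] by metis
qed

lemma tY_fspan: "i \<in> {1..k} \<Longrightarrow> j \<in> {1..k} \<Longrightarrow> tY i j r \<in> fspan {w. set w \<subseteq> YG}"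
  by (auto simp: tY_def fgen_def YG_iff)

lemma tY_ev: "ev (TT MV) (tY i j r) = Tm i j r"
  by (auto simp: tY_def fgen_def TT_def Tm_def TH_zero)

lemma Y_rel_fspan: "x \<in> YG \<Longrightarrow> y \<in> YG \<Longrightarrow> Y_rel bs x y \<in> fspan {w. set w \<subseteq> YG}"
  by (cases x; cases y)
    (auto simp: Y_rel_def YG_iff intro!: fspan_fsub fspan_fsmul fspan_fsum fspan_fmul_letters tY_fspan)

lemma Y_rel_ev:
  assumes x: "x \<in> YG" and y: "y \<in> YG"
  shows "ev (TT EV) (Y_rel bs x y) = 0"
proof (rule phi_zero)
  show "Y_rel bs x y \<in> Ycar k" unfolding Ycar_def by (rule Y_rel_fspan[OF x y])
  obtain i j r h g s where e: "x = (i, j, r)" "y = (h, g, s)" by (metis surj_pair)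
  have i: "i \<in> {1..k}" "j \<in> {1..k}" "h \<in> {1..k}" "g \<in> {1..k}" "1 \<le> r" "1 \<le> s" using x y by (auto simp: e YG_iff)
  have tU: "tY a b c \<in> fspan UNIV" for a b c by (auto simp: tY_def fgen_def)
  have S: "ev (TT MV) (fsum (\<lambda>t. fsub (fmul (tY h j t) (tY i g (r + s - 1 - t))) (fmul (tY h j (r + s - 1 - t)) (tY i g t))) {0..<min r s})
     = (\<Sum>t\<in>{0..<min r s}. Tm h j t * Tm i g (r + s - 1 - t) - Tm h j (r + s - 1 - t) * Tm i g t)"
    by (subst ev_fsum) (auto simp: ev_fsub ev_fmul tU tY_ev fspan_fmul fspan_fsub)
  have SU: "fsum (\<lambda>t. fsub (fmul (tY h j t) (tY i g (r + s - 1 - t))) (fmul (tY h j (r + s - 1 - t)) (tY i g t))) {0..<min r s} \<in> fspan UNIV"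
    by (intro fspan_fsum fspan_fsub fspan_fmul tU) simp
  have "ev (TT MV) (Y_rel bs x y) = Tm i j r * Tm h g s - sc (sgn ((ip i \<noteq> ip j) \<and> (ip h \<noteq> ip g))) * (Tm h g s * Tm i j r)
     - sc (ysgn i j h) * (\<Sum>t\<in>{0..<min r s}. Tm h j t * Tm i g (r + s - 1 - t) - Tm h j (r + s - 1 - t) * Tm i g t)"
    unfolding e Y_rel_def prod.case tpar_def ysgn_def
    by (simp only: ev_fsub ev_fsmul ev_fmul tU tY_ev fspan_fmul fspan_fsub fspan_fsmul S SU)
  then have "app (ev (TT MV) (Y_rel bs x y)) vac = (app (Tm i j r) (app (Tm h g s) vac) - scl (sgn ((ip i \<noteq> ip j) \<and> (ip h \<noteq> ip g))) (app (Tm h g s) (app (Tm i j r) vac)))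
     - scl (ysgn i j h) (\<Sum>t<min r s. app (Tm h j t) (app (Tm i g (r + s - 1 - t)) vac) - app (Tm h j (r + s - 1 - t)) (app (Tm i g t) vac))"
    by (simp add: app_sum_left lessThan_atLeast0)
  then show "app (ev (TT MV) (Y_rel bs x y)) vac = 0"
    unfolding Yangian_vac[OF i] by simp
qed

section \<open>Straightening in the truncated Yangian\<close>

definition Jrels :: "tgen fa set" where
  "Jrels = {Y_rel bs x y | x y. x \<in> YG \<and> y \<in> YG} \<union> {fgen g | g. g \<in> YG \<and> snd (snd g) > l}"

lemma Jrels_I: "x \<in> YG \<Longrightarrow> y \<in> YG \<Longrightarrow> Y_rel bs x y \<in> Jrels"
  unfolding Jrels_def by blast

lemma Jideal_eq: "Jideal bs k l = two_ideal Jrels"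
  by (simp add: Jideal_def Jrels_def)

lemma Jideal_ev:
  assumes "y \<in> Jideal bs k l" "y \<in> Ycar k"
  shows "ev (TT EV) y = 0"
proof -
  define T0 where "T0 t = (if t \<in> YG then TT EV t else 0)" for t
  have T0: "ev T0 f = ev (TT EV) f" if "f \<in> fspan {w. set w \<subseteq> YG}" for f
    by (rule ev_cong[OF that]) (simp add: T0_def)
  have "g \<in> fspan UNIV \<and> ev T0 g = 0" if "g \<in> Jrels" for g
  proof -
    from that consider x y where "g = Y_rel bs x y" "x \<in> YG" "y \<in> YG" | t where "g = fgen t" "t \<in> YG" "snd (snd t) > l"
      unfolding Jrels_def by blast
    then show ?thesis
    proof cases
      case 1
      then have f: "g \<in> fspan {w. set w \<subseteq> YG}" by (simp add: Y_rel_fspan)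
      have "ev T0 g = 0" unfolding T0[OF f] using Y_rel_ev 1 by simp
      then show ?thesis using fspan_UNIV[OF f] by simp
    next
      case 2
      have "TT EV t = 0" unfolding TT_def by (rule TH_large) (use 2 in auto)
      then show ?thesis using 2 by (simp add: fgen_def T0_def)
    qed
  qed
  from two_ideal_ev[OF assms(1)[unfolded Jideal_eq] this] have "ev T0 y = 0" by blast
  then show ?thesis using T0 assms(2) by (simp add: Ycar_def)
qed

lemma tY_reducible:
  assumes IH: "\<And>w'. ydeg w' < N \<Longrightarrow> set w' \<subseteq> YG \<Longrightarrow> reducible S (two_ideal G) (fmono w')"
    and uv: "set u \<subseteq> YG" "set v \<subseteq> YG" and d: "ydeg u + ydeg v + t + t' < N"
    and i: "i \<in> {1..k}" "j \<in> {1..k}" "h \<in> {1..k}" "g \<in> {1..k}"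
  shows "reducible S (two_ideal G) (fmul (fmul (fmono u) (fmul (tY i j t) (tY h g t'))) (fmono v))"
proof -
  have z: "reducible S (two_ideal G) fzero" by (rule reducible_ideal) (rule two_ideal.zero)
  have a: "reducible S (two_ideal G) (fmono (u @ v))" if "t = 0" "t' = 0" using d that uv by (intro IH) auto
  have b: "reducible S (two_ideal G) (fmono (u @ (i, j, t) # v))" if "t \<noteq> 0" "t' = 0" using d that uv i by (intro IH) (auto simp: YG_iff)
  have c: "reducible S (two_ideal G) (fmono (u @ (h, g, t') # v))" if "t = 0" "t' \<noteq> 0" using d that uv i by (intro IH) (auto simp: YG_iff)
  have e: "reducible S (two_ideal G) (fmono (u @ (i, j, t) # (h, g, t') # v))" if "t \<noteq> 0" "t' \<noteq> 0" using d that uv i by (intro IH) (auto simp: YG_iff)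
  show ?thesis using a b c e z
    by (cases "t = 0"; cases "t' = 0") (auto simp: tY_def fgen_def fone_fmono fmul_simps)
qed

text \<open>The right side of a relation has total degree \<open>r + s - 1\<close>, one less than
  the left side, so \<open>ydeg\<close> is the measure. Straightening may create letters with
  \<open>r > l\<close>; they are removed when a sorted word still contains one.\<close>

lemma Y_reducible:
  assumes "set w \<subseteq> YG"
  shows "reducible {w. set w \<subseteq> TG \<and> good (tpar bs) w} (two_ideal Jrels) (fmono w)"
proof -
  let ?S = "{w. set w \<subseteq> TG \<and> good (tpar bs) w}"
  let ?R = "reducible ?S (two_ideal Jrels)"
  \<comment> \<open>\<open>h\<close> collects the correction terms, reducible by the induction
    hypothesis; stated for arbitrary neighbours, it serves both swaps and odd squares.\<close>
  have split: "\<exists>h. ?R h \<and> fmul (fmul (fmono u) (Y_rel bs x y)) (fmono v) =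
      fsub (fsub (fmono (u @ [x, y] @ v)) (fsmul (sgn (tpar bs x \<and> tpar bs y)) (fmono (u @ [y, x] @ v)))) h"
    if IH: "\<And>w'. ydeg w' < ydeg (u @ [x, y] @ v) \<Longrightarrow> set w' \<subseteq> YG \<longrightarrow> ?R (fmono w')" and sub: "set (u @ [x, y] @ v) \<subseteq> YG" for u v x y
  proof -
    obtain i j r h g s where e: "x = (i, j, r)" "y = (h, g, s)" by (metis surj_pair)
    have i: "i \<in> {1..k}" "j \<in> {1..k}" "h \<in> {1..k}" "g \<in> {1..k}" "1 \<le> r" "1 \<le> s" and uv: "set u \<subseteq> YG" "set v \<subseteq> YG"
      using sub by (auto simp: e YG_iff)
    define H where "H t = fsub (fmul (tY h j t) (tY i g (r + s - 1 - t))) (fmul (tY h j (r + s - 1 - t)) (tY i g t))" for t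
    define z where "z = fsmul (ysgn i j h) (fsum (\<lambda>t. fmul (fmul (fmono u) (H t)) (fmono v)) {0..<min r s})"
    have H: "?R (fmul (fmul (fmono u) (H t)) (fmono v))" if "t \<in> {0..<min r s}" for t
      unfolding H_def fmul_simps using that i
      by (intro reducible_fsub tY_reducible[where N = "ydeg (u @ [x, y] @ v)"] uv) (use IH in \<open>auto simp: e\<close>)
    have "?R z" unfolding z_def by (intro reducible_fsmul reducible_fsum H) simp
    moreover have "fmul (fmul (fmono u) (Y_rel bs x y)) (fmono v) =
      fsub (fsub (fmono (u @ [x, y] @ v)) (fsmul (sgn (tpar bs x \<and> tpar bs y)) (fmono (u @ [y, x] @ v)))) z"
    proof -
      have t: "tY i j r = fmono [x]" "tY h g s = fmono [y]" using i by (simp_all add: tY_def fgen_def e)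
      have Y: "Y_rel bs x y = fsub (fsub (fmul (fmono [x]) (fmono [y])) (fsmul (sgn (tpar bs x \<and> tpar bs y)) (fmul (fmono [y]) (fmono [x]))))
          (fsmul (ysgn i j h) (fsum H {0..<min r s}))"
        unfolding Y_rel_def e prod.case t[unfolded e] H_def[abs_def] ysgn_def by (rule refl)
      show ?thesis unfolding Y z_def by (simp add: fmul_simps fmul_fsum)
    qed
    ultimately show ?thesis by blast
  qed
  have "set w \<subseteq> YG \<longrightarrow> ?R (fmono w)"
  proof (induction w rule: word_sort_induct[where par = "tpar bs" and meas = ydeg])
    case (good w)
    show ?case
    proof
      assume w: "set w \<subseteq> YG"
      show "?R (fmono w)"
      proof (cases "set w \<subseteq> TG")
        case True
        then show ?thesis using good by (intro reducible_fmono) simp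
      next
        case False
        then obtain t where t': "t \<in> set w" "t \<notin> TG" by blast
        then have t: "t \<in> set w" "snd (snd t) > l" using w unfolding TG_def by fastforce+
        then obtain u v where uv: "w = u @ t # v" by (meson split_list)
        have "fgen t \<in> Jrels" using t w unfolding Jrels_def by blast
        then have "fmul (fmul (fmono u) (fgen t)) (fmono v) \<in> two_ideal Jrels" by (rule two_ideal.gen)
        then show ?thesis by (intro reducible_ideal) (simp add: fgen_def uv)
      qed
    qed
  next
    case (swap u x y v)
    show ?case
    proof
      assume sub: "set (u @ [x, y] @ v) \<subseteq> YG"
      let ?r = "fmul (fmul (fmono u) (Y_rel bs x y)) (fmono v)" and ?s = "sgn (tpar bs x \<and> tpar bs y)"
      have "Y_rel bs x y \<in> Jrels" using sub by (intro Jrels_I) auto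
      then have r: "?R ?r" by (intro reducible_ideal two_ideal.gen)
      obtain h where h: "?R h" "?r = fsub (fsub (fmono (u @ [x, y] @ v)) (fsmul ?s (fmono (u @ [y, x] @ v)))) h"
        using split[OF swap(1) sub] by blast
      have q: "?R (fmono (u @ [y, x] @ v))" using swap(2) sub by auto
      have "fmono (u @ [x, y] @ v) = fadd ?r (fadd (fsmul ?s (fmono (u @ [y, x] @ v))) h)"
        unfolding h(2) by (simp add: fadd_def fsub_def fsmul_def)
      then show "?R (fmono (u @ [x, y] @ v))"
        using reducible_fadd[OF r reducible_fadd[OF reducible_fsmul[OF q] h(1)]] by simp
    qed
  next
    case (dup u x v)
    show ?case
    proof
      assume sub: "set (u @ [x, x] @ v) \<subseteq> YG"
      let ?r = "fmul (fmul (fmono u) (Y_rel bs x x)) (fmono v)"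
      have "Y_rel bs x x \<in> Jrels" using sub by (intro Jrels_I) auto
      then have r: "?R ?r" by (intro reducible_ideal two_ideal.gen)
      obtain h where h: "?R h" "?r = fsub (fsub (fmono (u @ [x, x] @ v)) (fsmul (sgn (tpar bs x \<and> tpar bs x)) (fmono (u @ [x, x] @ v)))) h"
        using split[OF dup(1) sub] by blast
      have "fmono (u @ [x, x] @ v) = fsmul (1/2) (fadd ?r h)"
        unfolding h(2) using dup(2) by (simp add: fadd_def fsub_def fsmul_def sgn_def)
      then show "?R (fmono (u @ [x, x] @ v))" using reducible_fsmul[OF reducible_fadd[OF r h(1)]] by simp
    qed
  qed (simp add: ac_simps)
  then show ?thesis using assms by simp
qed

section \<open>Leading terms of words in the generators\<close>

definition TA :: "box \<times> box \<Rightarrow> (box \<times> box) multiset op" where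
  "TA g = Tm (fst (fst g)) (fst (snd g)) (snd (snd g))"

abbreviation "TW w \<equiv> app (prod_list (map (TT MV) w)) vac"

lemma TT_TA: "TT MV t = TA (lt t)"
  by (simp add: TT_def TA_def lt_def Tm_def)

lemma lt_inj: "inj lt"
  by (auto simp: inj_def lt_def prod_eq_iff)

lemma lt_CG: "t \<in> TG \<Longrightarrow> lt t \<in> CG"
  by (cases t) (auto simp: TG_def lt_def CG_iff YG_iff intro!: PG_row[simplified])

lemma CG_lt: "g \<in> CG \<Longrightarrow> \<exists>t\<in>TG. lt t = g"
proof -
  assume g: "g \<in> CG"
  obtain i c j r where e: "g = ((i, c), (j, r))" by (metis surj_pair)
  have "c = 1" "i \<in> {1..k}" "j \<in> {1..k}" "1 \<le> r" "r \<le> l" using g by (auto simp: e CG_iff PG_iff boxes_def)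
  then have "(i, j, r) \<in> TG" "lt (i, j, r) = g" by (auto simp: TG_def YG_iff lt_def e)
  then show ?thesis by blast
qed

lemma kdeg_lt: "kdeg (lt t) = int (snd (snd t))"
  by (simp add: lt_def kdeg_def)

lemma wdeg_lt: "wdeg kdeg (map lt w) = int (ydeg w)"
  by (induction w) (simp_all add: kdeg_lt)

lemma TW_lead:
  assumes w: "set w \<subseteq> TG" and odd: "\<And>g. epar bs g \<Longrightarrow> count (mset (map lt w)) g \<le> 1"
  shows "\<exists>\<epsilon>. \<epsilon> \<noteq> 0 \<and> TW w - single (mset (map lt w)) \<epsilon> \<in> F (int (ydeg w) - 1)"
proof -
  define Bo where "Bo g = sc (eps (fst g) (snd g)) * cr (epar bs) g" for g
  have 1: "odeg kdeg (kdeg g) (Bo g)" for g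
    unfolding Bo_def using odeg_mult[OF odeg_sc odeg_cr[of kdeg g "epar bs"]] by simp
  have 2: "odeg kdeg (kdeg g - 1) (TA g - Bo g)" if g: "g \<in> CG" for g
  proof -
    obtain t where t: "t \<in> TG" "lt t = g" using CG_lt[OF g] by blast
    obtain i j r where e: "t = (i, j, r)" by (metis surj_pair)
    have "odeg kdeg (int r - 1) (Tm i j r - sc (eps (i, 1) (j, r)) * X (i, 1) (j, r))"
      by (rule Tm_lead) (use t e in \<open>auto simp: TG_def YG_iff\<close>)
    then show ?thesis unfolding t(2)[symmetric] kdeg_lt by (simp add: TA_def Bo_def lt_def e)
  qed
  have "set (map lt w) \<subseteq> CG" using w lt_CG by auto
  then have L: "app (prod_list (map TA (map lt w))) vac - app (prod_list (map Bo (map lt w))) vac \<in> F (wdeg kdeg (map lt w) - 1)"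
    using lead_word[where S = CG and D = kdeg and A = TA and Bo = Bo] 1 2 by blast
  have B: "\<exists>c. c \<noteq> 0 \<and> app (prod_list (map Bo u)) vac = scl c (XW u)" for u
  proof (induction u)
    case Nil
    show ?case by (rule exI[of _ 1]) simp
  next
    case (Cons g u)
    then obtain c where "c \<noteq> 0" "app (prod_list (map Bo u)) vac = scl c (XW u)" by blast
    moreover have "eps (fst g) (snd g) \<noteq> 0" by (simp add: eps_def sgn_def)
    ultimately show ?case by (intro exI[of _ "eps (fst g) (snd g) * c"]) (simp add: Bo_def[of g] app_scl)
  qed
  then obtain c where c: "c \<noteq> 0" "app (prod_list (map Bo (map lt w))) vac = scl c (XW (map lt w))" by blast
  obtain \<epsilon> where e: "\<epsilon> \<noteq> 0" "XW (map lt w) = single (mset (map lt w)) \<epsilon>" using cr_word[OF odd] by blast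
  have tw: "map TA (map lt w) = map (TT MV) w" by (simp add: TT_TA[abs_def] comp_def)
  have "TW w - single (mset (map lt w)) (c * \<epsilon>) \<in> F (int (ydeg w) - 1)"
    using L unfolding c e tw wdeg_lt by simp
  then show ?thesis using c e by (intro exI[of _ "c * \<epsilon>"]) simp
qed

lemma good_lt: assumes "good (tpar bs) w" shows "good (epar bs) (map lt w)"
proof -
  have "lt a < lt b \<or> (lt a = lt b \<and> \<not> epar bs (lt a))" if "a < b \<or> (a = b \<and> \<not> tpar bs a)" for a b
    using that by (cases a; cases b) (auto simp: lt_def tpar_def epar_pair ep_def)
  then show ?thesis using assms unfolding good_def sorted_wrt_map by (elim sorted_wrt_mono_rel[rotated]) blast
qed

text \<open>Distinct sorted words have distinct leading monomials, since \<open>lt\<close> is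
  injective and keeps words sorted; \<open>triangular\<close> then compares degrees.\<close>

lemma T_independent:
  assumes f: "f \<in> fspan {w. set w \<subseteq> TG \<and> good (tpar bs) w}" and d: "app (ev (TT MV) f) vac \<in> F d" and w: "f w \<noteq> 0"
  shows "int (ydeg w) \<le> d"
proof -
  have fin: "finite {w. f w \<noteq> 0}" and S: "\<And>w. f w \<noteq> 0 \<Longrightarrow> set w \<subseteq> TG \<and> good (tpar bs) w"
    using f by (auto simp: fspan_def)
  have "mdeg kdeg (mset (map lt w)) \<le> d"
  proof (rule triangular[where A = "{w. f w \<noteq> 0}" and b = TW and c = f and \<mu> = "\<lambda>w. mset (map lt w)"])
    show "inj_on (\<lambda>w. mset (map lt w)) {w. f w \<noteq> 0}"
    proof (rule inj_onI)
      fix u v assume uv: "u \<in> {w. f w \<noteq> 0}" "v \<in> {w. f w \<noteq> 0}" "mset (map lt u) = mset (map lt v)"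
      then have "map lt u = map lt v" using S good_lt good_mset_inj by blast
      then show "u = v" using inj_map_eq_map[OF lt_inj] by blast
    qed
    show "(\<Sum>w\<in>{w. f w \<noteq> 0}. scl (f w) (TW w)) \<in> F d" using d by (simp add: app_ev)
    fix w assume "w \<in> {w. f w \<noteq> 0}"
    then have "set w \<subseteq> TG" "good (epar bs) (map lt w)" using S good_lt by auto
    then have "\<exists>\<epsilon>. \<epsilon> \<noteq> 0 \<and> TW w - single (mset (map lt w)) \<epsilon> \<in> F (int (ydeg w) - 1)"
      by (intro TW_lead good_count)
    then show "\<exists>\<epsilon>. \<epsilon> \<noteq> 0 \<and> TW w - single (mset (map lt w)) \<epsilon> \<in> F (mdeg kdeg (mset (map lt w)) - 1)"
      unfolding mdeg_mset wdeg_lt .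
  qed (use fin w in auto)
  then show ?thesis unfolding mdeg_mset wdeg_lt .
qed

lemma TW_VC: "set w \<subseteq> TG \<Longrightarrow> TW w \<in> VQ CG"
proof (induction w)
  case Nil
  then show ?case by (simp add: VQ_vac)
next
  case (Cons t w)
  then have "TW w \<in> VQ CG" by simp
  then show ?case using TH_VC by (simp add: TT_def[of _ t])
qed

lemma MW_VC: "set u \<subseteq> PG \<Longrightarrow> MW u \<in> VQ CG"
proof (induction u)
  case (Cons g u)
  then show ?case using PG_VC(2)[of g "MW u"] by simp
qed (simp add: VQ_vac)

lemma kdeg_CG: "set_mset \<alpha> \<subseteq> CG \<Longrightarrow> 0 \<le> mdeg kdeg \<alpha>"
proof (induction \<alpha>)
  case (add g \<alpha>)
  then have "1 \<le> kdeg g" by (intro kdeg_pos) (auto simp: CG_def)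
  then show ?case using add by simp
qed simp

text \<open>Triangularity read backwards: words with the right leading monomials match the top
  component of \<open>v\<close>, and the difference has smaller degree. With the bound
  \<open>int d - 1\<close> the base case is the zero space, as letters of \<open>CG\<close> have
  positive degree.\<close>

lemma T_span:
  "v \<in> VQ CG \<Longrightarrow> v \<in> F (int d - 1) \<Longrightarrow> \<exists>f\<in>fspan {w. set w \<subseteq> TG \<and> ydeg w < d}. app (ev (TT MV) f) vac = v"
proof (induction d arbitrary: v)
  case 0
  have "lookup v \<alpha> = 0" for \<alpha>
  proof (rule ccontr)
    assume nz: "lookup v \<alpha> \<noteq> 0"
    then have "set_mset \<alpha> \<subseteq> CG" using 0(1) unfolding VQ_iff by blast
    then have "0 \<le> mdeg kdeg \<alpha>" by (rule kdeg_CG)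
    moreover have "mdeg kdeg \<alpha> \<le> int 0 - 1" using nz 0(2) unfolding Fil_iff by blast
    ultimately show False by simp
  qed
  then have "v = 0" by (intro poly_mapping_eqI) simp
  then show ?case by (intro bexI[of _ fzero]) simp_all
next
  case (Suc d)
  define K where "K = {\<alpha> \<in> keys v. mdeg kdeg \<alpha> = int d}"
  have fK: "finite K" by (simp add: K_def)
  have "\<exists>w \<epsilon>. set w \<subseteq> TG \<and> ydeg w = d \<and> \<epsilon> \<noteq> 0 \<and> TW w - single \<alpha> \<epsilon> \<in> F (int d - 1)" if a: "\<alpha> \<in> K" for \<alpha>
  proof -
    have nz: "lookup v \<alpha> \<noteq> 0" and dg: "mdeg kdeg \<alpha> = int d" using a by (auto simp: K_def in_keys_iff)
    then have C: "set_mset \<alpha> \<subseteq> CG" and o: "\<And>g. epar bs g \<Longrightarrow> count \<alpha> g \<le> 1"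
      using Suc(2) unfolding VQ_iff by blast+
    obtain us where us: "mset us = \<alpha>" by (metis ex_mset)
    have "\<forall>g\<in>set us. \<exists>t. t \<in> TG \<and> lt t = g" using C us CG_lt by force
    from bchoice[OF this] obtain c where c: "\<forall>g\<in>set us. c g \<in> TG \<and> lt (c g) = g" by blast
    define w where "w = map c us"
    have w: "set w \<subseteq> TG" "map lt w = us" using c by (auto simp: w_def map_idI)
    have "int (ydeg w) = int d" using dg us w(2) wdeg_lt[of w] by (metis mdeg_mset)
    then have y: "ydeg w = d" by simp
    have "\<exists>\<epsilon>. \<epsilon> \<noteq> 0 \<and> TW w - single (mset (map lt w)) \<epsilon> \<in> F (int (ydeg w) - 1)"
      by (rule TW_lead[OF w(1)]) (use o w us in simp)
    then show ?thesis using w y us by auto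
  qed
  then obtain W e where W: "\<And>\<alpha>. \<alpha> \<in> K \<Longrightarrow> set (W \<alpha>) \<subseteq> TG \<and> ydeg (W \<alpha>) = d \<and> e \<alpha> \<noteq> 0 \<and> TW (W \<alpha>) - single \<alpha> (e \<alpha>) \<in> F (int d - 1)"
    by metis
  define g where "g = fsum (\<lambda>\<alpha>. fsmul (lookup v \<alpha> / e \<alpha>) (fmono (W \<alpha>))) K"
  have g: "g \<in> fspan {w. set w \<subseteq> TG \<and> ydeg w < Suc d}"
    unfolding g_def by (intro fspan_fsum fK fspan_fsmul) (use W in auto)
  have eg: "app (ev (TT MV) g) vac = (\<Sum>\<alpha>\<in>K. scl (lookup v \<alpha> / e \<alpha>) (TW (W \<alpha>)))"
    unfolding g_def by (subst ev_fsum[OF fK]) (auto simp: ev_fsmul app_sum_left intro!: fspan_fsmul)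
  define v' where "v' = v - app (ev (TT MV) g) vac"
  have "v' \<in> VQ CG"
    unfolding v'_def eg by (intro VQ_closed(3,5,6) Suc(2) TW_VC) (use W in auto)
  moreover have "v' \<in> F (int d - 1)"
  proof -
    define v1 where "v1 = (\<Sum>\<alpha>\<in>K. single \<alpha> (lookup v \<alpha>))"
    have l1: "lookup v1 \<beta> = (if \<beta> \<in> K then lookup v \<beta> else 0)" for \<beta>
      unfolding v1_def lookup_sum lookup_single by (simp add: when_def fK)
    have "v - v1 \<in> F (int d - 1)"
      unfolding Fil_iff
    proof (intro allI impI)
      fix \<alpha> assume "lookup (v - v1) \<alpha> \<noteq> 0"
      then have a: "lookup v \<alpha> \<noteq> 0" "\<alpha> \<notin> K" by (auto simp: lookup_minus l1 split: if_splits)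
      then have "mdeg kdeg \<alpha> \<le> int (Suc d) - 1" using Suc(3) unfolding Fil_iff by blast
      moreover have "mdeg kdeg \<alpha> \<noteq> int d" using a by (auto simp: K_def in_keys_iff)
      ultimately show "mdeg kdeg \<alpha> \<le> int d - 1" by simp
    qed
    moreover have "app (ev (TT MV) g) vac - v1 \<in> F (int d - 1)"
    proof -
      have "app (ev (TT MV) g) vac - v1 = (\<Sum>\<alpha>\<in>K. scl (lookup v \<alpha> / e \<alpha>) (TW (W \<alpha>) - single \<alpha> (e \<alpha>)))"
        unfolding eg v1_def sum_subtractf[symmetric]
        by (rule sum.cong) (use W in \<open>auto simp: cvs.scale_right_diff_distrib\<close>)
      also have "\<dots> \<in> F (int d - 1)" by (intro Fil_sum Fil_closed(5)) (use W in blast)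
      finally show ?thesis .
    qed
    ultimately have "(v - v1) - (app (ev (TT MV) g) vac - v1) \<in> F (int d - 1)" by (rule Fil_closed(3))
    then show ?thesis by (simp add: v'_def)
  qed
  ultimately obtain f where f: "f \<in> fspan {w. set w \<subseteq> TG \<and> ydeg w < d}" "app (ev (TT MV) f) vac = v'"
    using Suc(1) by blast
  have f': "f \<in> fspan {w. set w \<subseteq> TG \<and> ydeg w < Suc d}" by (rule fspan_mono[OF f(1)]) auto
  show ?case
  proof (rule bexI[of _ "fadd f g"])
    show "app (ev (TT MV) (fadd f g)) vac = v"
      using f(2) by (simp add: ev_fadd fspan_UNIV[OF f'] fspan_UNIV[OF g] v'_def)
  qed (rule fspan_fadd[OF f' g])
qed

section \<open>Kernel and image\<close>

lemma TG_YG: "set w \<subseteq> TG \<Longrightarrow> set w \<subseteq> YG"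
  by (auto simp: TG_def)

text \<open>For the converse, \<open>y\<close> is congruent to a combination \<open>f\<close> of
  sorted words with image zero. Zero has every degree bound, so \<open>T_independent\<close> leaves
  no word in \<open>f\<close>.\<close>

lemma kernel:
  assumes y: "y \<in> Ycar k"
  shows "\<phi> y \<in> IU bs k l \<longleftrightarrow> y \<in> Jideal bs k l"
proof
  have U: "\<phi> y \<in> Ucar k l" by (rule PG_fspan[OF phi_fspan[OF y]])
  show "\<phi> y \<in> IU bs k l" if "y \<in> Jideal bs k l"
    using Jideal_ev[OF that y] IU_iff[OF U] phi_ev[OF y, of EV] by simp
  assume "\<phi> y \<in> IU bs k l"
  then have z: "ev (TT EV) y = 0" using IU_iff[OF U] phi_ev[OF y, of EV] by simp
  have "reducible {w. set w \<subseteq> TG \<and> good (tpar bs) w} (two_ideal Jrels) y"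
    using y unfolding Ycar_def by (rule reducible_fspan) (use Y_reducible in blast)
  then obtain f where f: "f \<in> fspan {w. set w \<subseteq> TG \<and> good (tpar bs) w}" "fsub y f \<in> two_ideal Jrels"
    by (auto simp: reducible_def)
  have fY: "f \<in> Ycar k" unfolding Ycar_def by (rule fspan_mono[OF f(1)]) (use TG_YG in blast)
  have "fsub y f \<in> Ycar k" using y fY by (auto simp: Ycar_def)
  then have "ev (TT EV) (fsub y f) = 0" using Jideal_ev f(2) by (simp add: Jideal_eq)
  then have "ev (TT EV) f = 0"
    using z y fY by (simp add: ev_fsub Ycar_def fspan_UNIV)
  then have ze: "ev EV (\<phi> f) = 0" by (simp add: phi_ev[OF fY])
  have "f w = 0" for w
  proof (rule ccontr)
    assume w: "f w \<noteq> 0"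
    have "app (ev MV (\<phi> f)) vac \<in> F (int (ydeg w) - 1)"
      by (rule M_symbol(1)[OF phi_fspan[OF fY]]) (simp add: ze Fil_closed)
    then have "int (ydeg w) \<le> int (ydeg w) - 1"
      by (intro T_independent[OF f(1) _ w]) (simp add: phi_ev[OF fY])
    then show False by simp
  qed
  then have "fsub y f = y" by (simp add: fsub_def)
  then show "y \<in> Jideal bs k l" using f(2) by (simp add: Jideal_eq)
qed

lemma IU_eq_iff:
  assumes "f \<in> Ucar k l" "g \<in> Ucar k l"
  shows "fsub f g \<in> IU bs k l \<longleftrightarrow> app (ev EV f) vac = app (ev EV g) vac"
proof -
  have "fsub f g \<in> Ucar k l" using assms by (auto simp: Ucar_def)
  then show ?thesis using assms by (simp add: IU_iff(1) ev_fsub Ucar_def fspan_UNIV)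
qed

lemma Wset_iff:
  assumes "z \<in> Ucar k l"
  shows "z \<in> Wset bs k l \<longleftrightarrow> app (ev EV z) vac \<in> WV \<and> (\<exists>u\<in>fspan {w. set w \<subseteq> PG}. app (ev EV z) vac = app (ev EV u) vac)"
  unfolding Wset_def in_Up_def mem_Collect_eq Whittaker_iff[OF assms]
  using assms IU_eq_iff[OF assms PG_fspan] by blast

lemma phi_Wset:
  assumes y: "y \<in> Ycar k" and z: "z \<in> Ucar k l" and yz: "fsub (\<phi> y) z \<in> IU bs k l"
  shows "z \<in> Wset bs k l"
proof -
  have e: "app (ev EV (\<phi> y)) vac = app (ev EV z) vac" using yz IU_eq_iff[OF PG_fspan[OF phi_fspan[OF y]] z] by simp
  show ?thesis unfolding Wset_iff[OF z] e[symmetric] using phi_Whittaker[OF y] phi_fspan[OF y] by blast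
qed

text \<open>A representative \<open>u\<close> in letters of \<pp> gives \<open>z\<close> a value in
  the small module, and \<open>T_span\<close> finds \<open>y\<close> of the right degree with the
  same value. The difference of \<open>\<phi> y\<close> and \<open>u\<close> is Whittaker and
  vanishes there, hence is zero.\<close>

lemma Wset_phi:
  assumes z: "z \<in> Wset bs k l" and d: "app (ev EV z) vac \<in> F (int d)"
  shows "\<exists>y\<in>FY k d. fsub (\<phi> y) z \<in> IU bs k l"
proof -
  have zU: "z \<in> Ucar k l" using z by (simp add: Wset_def in_Up_def)
  obtain u where w: "app (ev EV z) vac \<in> WV" and u: "u \<in> fspan {w. set w \<subseteq> PG}" and zu: "app (ev EV z) vac = app (ev EV u) vac"
    using z unfolding Wset_iff[OF zU] by blast
  let ?v = "app (ev MV u) vac"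
  have "?v \<in> F (int (Suc d) - 1)" using M_symbol(1)[OF u, of "int d"] d zu by simp
  moreover have "?v \<in> VQ CG" unfolding app_ev by (intro VQ_closed MW_VC) (use u in \<open>auto simp: fspan_def\<close>)
  ultimately obtain y where y: "y \<in> fspan {w. set w \<subseteq> TG \<and> ydeg w < Suc d}" "app (ev (TT MV) y) vac = ?v"
    using T_span by blast
  have yF: "y \<in> FY k d" unfolding FY_def by (rule fspan_mono[OF y(1)]) (use TG_YG in auto)
  have yY: "y \<in> Ycar k" unfolding Ycar_def by (rule fspan_mono[OF y(1)]) (use TG_YG in auto)
  note P = phi_fspan[OF yY]
  let ?f = "fsub (\<phi> y) u"
  have e: "ev A ?f = ev A (\<phi> y) - ev A u" for A by (rule ev_fsub) (use P u fspan_UNIV in blast)+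
  have "app (ev EV ?f) vac = 0"
  proof (rule Whittaker_faithful)
    show "?f \<in> fspan {w. set w \<subseteq> PG}" using P u by blast
    show "app (ev EV ?f) vac \<in> WV" using phi_Whittaker[OF yY] w zu by (simp add: e WV_closed)
    show "app (ev MV ?f) vac = 0" using y(2) by (simp add: e phi_ev[OF yY])
  qed
  then have "app (ev EV (\<phi> y)) vac = app (ev EV z) vac" using zu by (simp add: e)
  then have "fsub (\<phi> y) z \<in> IU bs k l" using IU_eq_iff[OF PG_fspan[OF P] zU] by simp
  then show ?thesis using yF by blast
qed

lemma exists_degree: "\<exists>d. v \<in> F (int d)"
proof -
  let ?d = "nat (Max (insert 0 (mdeg kdeg ` keys v)))"
  have "mdeg kdeg \<alpha> \<le> int ?d" if "\<alpha> \<in> keys v" for \<alpha>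
  proof -
    have "mdeg kdeg \<alpha> \<le> Max (insert 0 (mdeg kdeg ` keys v))" using that by (intro Max_ge) auto
    then show ?thesis by simp
  qed
  then show ?thesis unfolding Fil_def by blast
qed

section \<open>Degree and parity of images\<close>

lemma te_deg: "g \<in> PG \<Longrightarrow> te g \<in> fspan {u. set u \<subseteq> EG \<and> wdeg kdeg u \<le> kdeg g \<and> wpar (epar bs) u = epar bs g}"
  using kdeg_pos[of g] PG_sub[of g]
  by (cases g) (auto simp: te_def tilde_e_def fgen_def wpar_def epar_def intro!: fspan_fsmul fspan_fadd)

lemma wpar_Cons: "wpar par (x # w) = (par x \<noteq> wpar par w)"
  by (simp add: wpar_def)

lemma wpar_append: "wpar par (u @ v) = (wpar par u \<noteq> wpar par v)"
  by (induction u) (auto simp: wpar_def)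

lemma chain_wpar: "chain p r i j ps \<Longrightarrow> wpar (epar bs) ps = (ip i \<noteq> ip j)"
proof (induction ps arbitrary: p r i)
  case (Cons g ps)
  then have "wpar (epar bs) ps = (ip (fst (snd g)) \<noteq> ip j)" and "fst (fst g) = i" by auto
  then show ?case by (auto simp: wpar_def epar_def bpar_def)
qed (simp add: wpar_def)

lemma chain_wdeg: "chain p r i j ps \<Longrightarrow> wdeg kdeg ps = r"
  by (induction ps arbitrary: p r i) force+

lemma sigma_deg:
  assumes t: "t \<in> YG"
  shows "sigma bs m n l t \<in> fspan {u. set u \<subseteq> EG \<and> wdeg kdeg u \<le> int (snd (snd t)) \<and> wpar (epar bs) u = tpar bs t}"
proof -
  obtain i j r where e: "t = (i, j, r)" by (metis surj_pair)
  have r: "1 \<le> r" using t by (simp add: e YG_iff)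
  have "fprod (map te ps) \<in> fspan {u. set u \<subseteq> EG \<and> wdeg kdeg u \<le> wdeg kdeg ps \<and> wpar (epar bs) u = wpar (epar bs) ps}"
    if "set ps \<subseteq> PG" for ps
  proof (rule fspan_fprod_map[where Q = "\<lambda>g u. set u \<subseteq> EG \<and> wdeg kdeg u \<le> kdeg g \<and> wpar (epar bs) u = epar bs g"
      and P = "\<lambda>ps u. set u \<subseteq> EG \<and> wdeg kdeg u \<le> wdeg kdeg ps \<and> wpar (epar bs) u = wpar (epar bs) ps"])
    show "te g \<in> fspan {u. set u \<subseteq> EG \<and> wdeg kdeg u \<le> kdeg g \<and> wpar (epar bs) u = epar bs g}" if "g \<in> set ps" for g
      using te_deg that \<open>set ps \<subseteq> PG\<close> by blast
  next
    fix g u w v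
    assume a: "set u \<subseteq> EG \<and> wdeg kdeg u \<le> kdeg g \<and> wpar (epar bs) u = epar bs g"
      "set v \<subseteq> EG \<and> wdeg kdeg v \<le> wdeg kdeg w \<and> wpar (epar bs) v = wpar (epar bs) w"
    then show "set (u @ v) \<subseteq> EG \<and> wdeg kdeg (u @ v) \<le> wdeg kdeg (g # w) \<and> wpar (epar bs) (u @ v) = wpar (epar bs) (g # w)"
      using a by (auto simp: wpar_append wpar_Cons)
  qed simp
  then have "fprod (map te ps) \<in> fspan {u. set u \<subseteq> EG \<and> wdeg kdeg u \<le> int r \<and> wpar (epar bs) u = tpar bs t}"
    if "chain 1 (int r) i j ps" for ps
    using chain_length[OF that] unfolding e tpar_def prod.case chain_wpar[OF that, symmetric] chain_wdeg[OF that, symmetric]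
    by blast
  then have "t_elem bs m n l i j r \<in> fspan {u. set u \<subseteq> EG \<and> wdeg kdeg u \<le> int r \<and> wpar (epar bs) u = tpar bs t}"
    unfolding t_elem_def tseqs_chain[OF r] te_def[symmetric]
    by (intro fspan_fsum fspan_fsmul finite_chains) simp
  then show ?thesis by (simp add: e sigma_def)
qed

text \<open>\<open>Q\<close> lets one statement serve twice: with \<open>UNIV\<close> for the
  filtration and with \<open>{p}\<close> for the parity.\<close>

lemma phi_deg:
  assumes y: "y \<in> fspan S" and S: "\<And>w. w \<in> S \<Longrightarrow> set w \<subseteq> YG \<and> int (ydeg w) \<le> d \<and> wpar (tpar bs) w \<in> Q"
  shows "\<phi> y \<in> fspan {u. set u \<subseteq> EG \<and> wdeg kdeg u \<le> d \<and> wpar (epar bs) u \<in> Q}"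
proof (rule hom_ext_fspan[OF y])
  fix w assume w: "w \<in> S"
  let ?D = "\<lambda>t :: tgen. int (snd (snd t))"
  have D: "wdeg ?D w = int (ydeg w)" for w by (induction w) auto
  have "fprod (map (sigma bs m n l) w) \<in> fspan {u. set u \<subseteq> EG \<and> wdeg kdeg u \<le> wdeg ?D w \<and> wpar (epar bs) u = wpar (tpar bs) w}"
  proof (rule fspan_fprod_map[where Q = "\<lambda>t u. set u \<subseteq> EG \<and> wdeg kdeg u \<le> ?D t \<and> wpar (epar bs) u = tpar bs t"
      and P = "\<lambda>w u. set u \<subseteq> EG \<and> wdeg kdeg u \<le> wdeg ?D w \<and> wpar (epar bs) u = wpar (tpar bs) w"])
    show "sigma bs m n l t \<in> fspan {u. set u \<subseteq> EG \<and> wdeg kdeg u \<le> ?D t \<and> wpar (epar bs) u = tpar bs t}" if "t \<in> set w" for t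
      using sigma_deg that S[OF w] by blast
  next
    fix t u w v
    assume a: "set u \<subseteq> EG \<and> wdeg kdeg u \<le> ?D t \<and> wpar (epar bs) u = tpar bs t"
      "set v \<subseteq> EG \<and> wdeg kdeg v \<le> wdeg ?D w \<and> wpar (epar bs) v = wpar (tpar bs) w"
    then show "set (u @ v) \<subseteq> EG \<and> wdeg kdeg (u @ v) \<le> wdeg ?D (t # w) \<and> wpar (epar bs) (u @ v) = wpar (tpar bs) (t # w)"
      using a by (auto simp: wpar_append wpar_Cons)
  qed (simp add: wpar_def)
  then show "fprod (map (sigma bs m n l) w) \<in> fspan {u. set u \<subseteq> EG \<and> wdeg kdeg u \<le> d \<and> wpar (epar bs) u \<in> Q}"
    by (rule fspan_mono) (use S[OF w] D[of w] in auto)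
qed

lemma t_elem_Wset:
  assumes "i \<in> {1..k}" "j \<in> {1..k}" "r \<in> {1..l}"
  shows "t_elem bs m n l i j r \<in> Wset bs k l"
proof (rule phi_Wset)
  show y: "fmono [(i, j, r)] \<in> Ycar k" using assms by (auto simp: Ycar_def YG_iff)
  show U: "t_elem bs m n l i j r \<in> Ucar k l" by (intro PG_fspan t_elem_fspan) (use assms in simp)
  have "ev EV (t_elem bs m n l i j r) = TT EV (i, j, r)"
    using sigma_ev[of "(i, j, r)" EV] assms by (simp add: sigma_def YG_iff)
  then show "fsub (\<phi> (fmono [(i, j, r)])) (t_elem bs m n l i j r) \<in> IU bs k l"
    by (subst IU_eq_iff[OF PG_fspan[OF phi_fspan[OF y]] U]) (simp add: phi_ev[OF y])
qed

lemma FY_Ycar: "FY k d \<subseteq> Ycar k"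
  unfolding FY_def Ycar_def by (auto intro: fspan_mono)

lemma image_eq: "{z \<in> Ucar k l. \<exists>y\<in>Ycar k. fsub (\<phi> y) z \<in> IU bs k l} = Wset bs k l"
proof (intro equalityI subsetI)
  fix z assume z: "z \<in> Wset bs k l"
  obtain d where "app (ev EV z) vac \<in> F (int d)" using exists_degree by blast
  from Wset_phi[OF z this] show "z \<in> {z \<in> Ucar k l. \<exists>y\<in>Ycar k. fsub (\<phi> y) z \<in> IU bs k l}"
    using z FY_Ycar by (auto simp: Wset_def in_Up_def)
qed (auto intro: phi_Wset)

text \<open>One inclusion is \<open>phi_deg\<close>. For the other, the Kazhdan degree of
  \<open>z\<close> is read off its vector on the vacuum and carried to the preimage by
  \<open>Wset_phi\<close>.\<close>

lemma filtered_image_eq: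
  "{z \<in> Ucar k l. \<exists>y\<in>FY k d. fsub (\<phi> y) z \<in> IU bs k l} = Wset bs k l \<inter> FU bs k l d"
proof (intro equalityI subsetI)
  fix z assume "z \<in> {z \<in> Ucar k l. \<exists>y\<in>FY k d. fsub (\<phi> y) z \<in> IU bs k l}"
  then obtain y where z: "z \<in> Ucar k l" and y: "y \<in> FY k d" and yz: "fsub (\<phi> y) z \<in> IU bs k l" by blast
  have Y: "y \<in> Ycar k" using y FY_Ycar by blast
  have "\<phi> y \<in> fspan {u. set u \<subseteq> EG \<and> wdeg kdeg u \<le> int d \<and> wpar (epar bs) u \<in> UNIV}"
    using y unfolding FY_def by (rule phi_deg) auto
  moreover have "fsub z (\<phi> y) \<in> IU bs k l"
    using yz IU_eq_iff[OF z PG_fspan[OF phi_fspan[OF Y]]] IU_eq_iff[OF PG_fspan[OF phi_fspan[OF Y]] z] by simp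
  ultimately have "z \<in> FU bs k l d" using z by (auto simp: FU_def wdeg_def)
  then show "z \<in> Wset bs k l \<inter> FU bs k l d" using phi_Wset[OF Y z yz] by simp
next
  fix z assume "z \<in> Wset bs k l \<inter> FU bs k l d"
  then obtain u where z: "z \<in> Wset bs k l" "z \<in> Ucar k l"
    and u: "u \<in> fspan {w. set w \<subseteq> EG \<and> wdeg kdeg w \<le> int d}" and zu: "fsub z u \<in> IU bs k l"
    by (auto simp: FU_def wdeg_def)
  have uU: "u \<in> Ucar k l" using u unfolding Ucar_def by (rule fspan_mono) auto
  have "EW w \<in> F (int d)" if "u w \<noteq> 0" for w
    using that u EW_lead[of w] Fil_mono[of "EW w" "mdeg kdeg" "wdeg kdeg w" "int d"] by (auto simp: fspan_def)
  then have "app (ev EV u) vac \<in> F (int d)"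
    unfolding app_ev by (intro Fil_sum Fil_closed) simp
  then have "app (ev EV z) vac \<in> F (int d)" using zu IU_eq_iff[OF z(2) uU] by simp
  then show "z \<in> {z \<in> Ucar k l. \<exists>y\<in>FY k d. fsub (\<phi> y) z \<in> IU bs k l}"
    using Wset_phi[OF z(1)] z(2) by blast
qed

lemma phi_parity:
  assumes y: "y \<in> Ycar k" and p: "\<forall>w. y w \<noteq> 0 \<longrightarrow> wpar (tpar bs) w = p"
  shows "\<exists>z\<in>Ucar k l. (\<forall>w. z w \<noteq> 0 \<longrightarrow> wpar (epar bs) w = p) \<and> fsub (\<phi> y) z \<in> IU bs k l"
proof (intro bexI conjI)
  let ?S = "{w. y w \<noteq> 0}"
  have fin: "finite ?S" and S: "\<And>w. w \<in> ?S \<Longrightarrow> set w \<subseteq> YG" using y by (auto simp: Ycar_def fspan_def)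
  have d: "int (ydeg w) \<le> int (\<Sum>w\<in>?S. ydeg w)" if "w \<in> ?S" for w
    unfolding of_nat_le_iff using fin that by (intro member_le_sum) auto
  have "y \<in> fspan ?S" using fin by (simp add: fspan_def)
  then have "\<phi> y \<in> fspan {u. set u \<subseteq> EG \<and> wdeg kdeg u \<le> int (\<Sum>w\<in>?S. ydeg w) \<and> wpar (epar bs) u \<in> {p}}"
    by (rule phi_deg) (use S d p in auto)
  then show "\<forall>w. \<phi> y w \<noteq> 0 \<longrightarrow> wpar (epar bs) w = p" by (auto simp: fspan_def)
  show "\<phi> y \<in> Ucar k l" by (rule PG_fspan[OF phi_fspan[OF y]])
  have "fsub (\<phi> y) (\<phi> y) = fzero" by (simp add: fsub_def fzero_def)
  then show "fsub (\<phi> y) (\<phi> y) \<in> IU bs k l" unfolding IU_def by (simp add: two_ideal.zero)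
qed

end

theorem theorem4p4:
  fixes m n l :: nat and bs :: "pty list"
  assumes "length (filter (\<lambda>x. x = Delta) bs) = m"
      and "length (filter (\<lambda>x. x = Eps) bs) = n"
  defines "\<phi> \<equiv> hom_ext (sigma bs m n l)"
  shows "(\<forall>i j r. i \<in> {1..m+n} \<and> j \<in> {1..m+n} \<and> r \<in> {1..l} \<longrightarrow>
             t_elem bs m n l i j r \<in> Wset bs (m+n) l)
       \<and> (\<forall>y \<in> Ycar (m+n). \<phi> y \<in> IU bs (m+n) l \<longleftrightarrow> y \<in> Jideal bs (m+n) l)
       \<and> {z \<in> Ucar (m+n) l. \<exists>y \<in> Ycar (m+n). fsub (\<phi> y) z \<in> IU bs (m+n) l} = Wset bs (m+n) l
       \<and> (\<forall>d. {z \<in> Ucar (m+n) l. \<exists>y \<in> FY (m+n) d. fsub (\<phi> y) z \<in> IU bs (m+n) l}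
               = Wset bs (m+n) l \<inter> FU bs (m+n) l d)
       \<and> (\<forall>y \<in> Ycar (m+n). \<forall>p. (\<forall>w. y w \<noteq> 0 \<longrightarrow> wpar (tpar bs) w = p) \<longrightarrow>
            (\<exists>z \<in> Ucar (m+n) l. (\<forall>w. z w \<noteq> 0 \<longrightarrow> wpar (epar bs) w = p)
                                 \<and> fsub (\<phi> y) z \<in> IU bs (m+n) l))"
proof -
  interpret rect bs m n l by unfold_locales (fact assms)+
  show ?thesis
    unfolding \<phi>_def by (intro conjI allI impI ballI; (elim conjE)?; rule t_elem_Wset kernel image_eq filtered_image_eq phi_parity; assumption)
qed

end
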